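(* Let $(\mathcal{U},\mathcal{F})$ be a commutable set system, $\Pi$ a prefix-closed order family for $(\mathcal{U},\mathcal{F})$, and $\mathrm{neighbors}(S,s)$ a canonical reconstruction function whose canonical order of each maximal solution $S$ is its solution order under $\Pi$. Then the maximal solutions of $(\mathcal{U},\mathcal{F})$ can be enumerated (each exactly once) with $$O\big(|\mathcal{U}|\,\mathcal{R}_T+|\mathcal{U}|\,\mathcal{R}_N\,q\,(\mathcal{R}_T+\mathcal{R}_N\mathcal{O}_T+\mathcal{C}_t)\big)$$ time delay and polynomial space.
   Context: A set system $(\mathcal{U},\mathcal{F})$ has finite ground set $\mathcal{U}$ and solutions $\mathcal{F}\subseteq 2^{\mathcal{U}}$; maximal solutions are inclusion-maximal members of $\mathcal{F}$. It is strongly accessible if for all $S\subsetneq S'$ in $\mathcal{F}$ there is $x\in S'\setminus S$ with $S\cup\{x\}\in\mathcal{F}$; commutable if strongly accessible and for all $S\subsetneq T$ in $\mathcal{F}$ and $a,b\in T\setminus S$, $S\cup\{a\}\in\mathcal{F}$ and $S\cup\{b\}\in\mathcal{F}$ imply $S\cup\{a,b\}\in\mathcal{F}$. Let $Z=\{e\in\mathcal{U}:\{e\}\in\mathcal{F}\}$ and $S^+=\{x: S\cup\{x\}\in\mathcal{F}\}$. A family $\Pi(X,v)$ ($X\in\mathcal{F}$, $v\in X\cap Z$) of orders, each a permutation of $X\cup X^+$, writing $x^v_1,\dots,x^v_k$ for the elements of $X$ in that order, is prefix-closed if for all such $X,v$ and $i\in\{1,\dots,k-1\}$: $x^v_1=v$;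 $X_i=\{x^v_1,\dots,x^v_i\}\in\mathcal{F}$; and $x^v_{i+1}$ is the minimal element of $X_i^+\cap X$ with respect to $\Pi(X_i,v)$. $\mathrm{seed}(S)$ is the element of smallest id in $S\cap Z$; the solution order of a maximal $S$ is the order of $S$ in $\Pi(S,\mathrm{seed}(S))$. $\mathrm{comp}(S)$ (lexicographic) repeatedly adds to $S$ the earliest element of $S^+\setminus S$ in $\Pi(S,\mathrm{seed}(S))$ until none remains. Canonical reconstruction: with each maximal $S$ having canonical order $s_1,\dots,s_{|S|}$, the proximity $S\,\tilde{\cap}\,S^*$ is the longest prefix of the canonical order of $S^*$ contained in $S$, and for $S\ne S^*$ the canonical extender is the next element of that order; one requires that every prefix of a canonical order lies in $\mathcal{F}$, and that for every maximal $S$ and $v\notin S$ there is a polynomial-time computable family $\mathcal{X}(S,v)$ of subsets of $S$ with $(S\setminus X)\cup\{v\}\in\mathcal{F}$ for all $X\in\mathcal{X}(S,v)$ and such that for every maximal $S^*$ with canonical extender $v$ for $S,S^*$ some $X$ satisfies $X\cap(S\,\tilde{\cap}\,S^* )=\emptyset$; then $\mathrm{neighbors}(S,v)=\{\mathrm{comp}((S\setminus X)\cup\{v\}):X\in\mathcal{X}(S,v)\}$ (and $\{S\}$ if $v\in S$). Parameters: $q$ is the maximum size of a solution; $\mathcal{R}_T$ the time to compute $\mathrm{neighbors}(P,w)$; $\mathcal{R}_N$ a bound on the number of solutions it returns; $\mathcal{C}_t$ the time to compute $\mathrm{comp}(X)$; $\mathcal{O}_T$ the time to compute the order $\Pi$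 on $X\cup X^+$. All these bounds are assumed polynomial in $|\mathcal{U}|$. Delay is the maximum time before the first output, between consecutive outputs, and after the last output. *)

theory Defs
  imports "HOL-Library.While_Combinator" "HOL-Computational_Algebra.Polynomial"
begin

section \<open>Set systems, prefix-closed orders, canonical reconstruction\<close>

definition set_system :: "'a set \<Rightarrow> 'a set set \<Rightarrow> bool" where
  "set_system U F \<longleftrightarrow> finite U \<and> F \<subseteq> Pow U"

definition maximal :: "'a set set \<Rightarrow> 'a set set" where
  "maximal F = {S \<in> F. \<forall>T\<in>F. \<not> S \<subset> T}"

definition strongly_accessible :: "'a set set \<Rightarrow> bool" where
  "strongly_accessible F \<longleftrightarrow>
     (\<forall>S\<in>F. \<forall>T\<in>F. S \<subset> T \<longrightarrow> (\<exists>x\<in>T - S. insert x S \<in> F))"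

definition commutable :: "'a set set \<Rightarrow> bool" where
  "commutable F \<longleftrightarrow> strongly_accessible F \<and>
     (\<forall>S\<in>F. \<forall>T\<in>F. S \<subset> T \<longrightarrow> (\<forall>a\<in>T - S. \<forall>b\<in>T - S.
        insert a S \<in> F \<longrightarrow> insert b S \<in> F \<longrightarrow> insert a (insert b S) \<in> F))"

definition singletons :: "'a set set \<Rightarrow> 'a set" where
  "singletons F = {e. {e} \<in> F}"

text \<open>This is \<open>S\<^sup>+\<close>. It contains \<open>S\<close> itself whenever \<open>S \<in> F\<close>.\<close>

definition ext :: "'a set set \<Rightarrow> 'a set \<Rightarrow> 'a set" where
  "ext F S = {x. insert x S \<in> F}"

text \<open>An order is the list of its elements; \<open>earliest A xs\<close> is the minimal element of \<open>A\<close>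
  with respect to \<open>xs\<close>, for a nonempty \<open>A \<subseteq> set xs\<close>.\<close>

definition earliest :: "'a set \<Rightarrow> 'a list \<Rightarrow> 'a" where
  "earliest A xs = hd (filter (\<lambda>x. x \<in> A) xs)"

text \<open>\<open>xs\<close> lists \<open>x\<^sub>1, \<dots>, x\<^sub>k\<close> from index 0, so \<open>xs ! i\<close> is the element following the
  prefix \<open>X\<^sub>i\<close>. That element is minimal among those of \<open>X\<close> that can be \<^emph>\<open>added\<close>
  to \<open>X\<^sub>i\<close>, hence the elements of \<open>X\<^sub>i\<close> are removed from \<open>X\<^sub>i\<^sup>+ \<inter> X\<close>.\<close>

definition prefix_closed :: "'a set set \<Rightarrow> ('a set \<Rightarrow> 'a \<Rightarrow> 'a list) \<Rightarrow> bool" where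
  "prefix_closed F \<Pi> \<longleftrightarrow>
     (\<forall>X\<in>F. \<forall>v\<in>X \<inter> singletons F.
        distinct (\<Pi> X v) \<and> set (\<Pi> X v) = X \<union> ext F X \<and>
        (let xs = filter (\<lambda>x. x \<in> X) (\<Pi> X v) in
           \<forall>i\<in>{1..<length xs}.
             let Xi = set (take i xs) in
               xs ! 0 = v \<and> Xi \<in> F \<and> xs ! i = earliest (ext F Xi \<inter> X - Xi) (\<Pi> Xi v)))"

text \<open>The linear order on the elements is that of their ids.\<close>

definition seed :: "'a::linorder set set \<Rightarrow> 'a set \<Rightarrow> 'a" where
  "seed F S = Min (S \<inter> singletons F)"

definition solution_order ::
    "'a::linorder set set \<Rightarrow> ('a set \<Rightarrow> 'a \<Rightarrow> 'a list) \<Rightarrow> 'a set \<Rightarrow> 'a list" where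
  "solution_order F \<Pi> S = filter (\<lambda>x. x \<in> S) (\<Pi> S (seed F S))"

definition lex_comp :: "'a::linorder set set \<Rightarrow> ('a set \<Rightarrow> 'a \<Rightarrow> 'a list) \<Rightarrow> 'a set \<Rightarrow> 'a set" where
  "lex_comp F \<Pi> = while (\<lambda>S. ext F S - S \<noteq> {})
                     (\<lambda>S. insert (earliest (ext F S - S) (\<Pi> S (seed F S))) S)"

text \<open>In the following, \<open>co\<close> maps each maximal solution to its canonical order.\<close>

definition proximity :: "('a set \<Rightarrow> 'a list) \<Rightarrow> 'a set \<Rightarrow> 'a set \<Rightarrow> 'a set" where
  "proximity co S T = set (takeWhile (\<lambda>x. x \<in> S) (co T))"

definition canonical_extender :: "('a set \<Rightarrow> 'a list) \<Rightarrow> 'a set \<Rightarrow> 'a set \<Rightarrow> 'a" where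
  "canonical_extender co S T = hd (dropWhile (\<lambda>x. x \<in> S) (co T))"

definition canonical_reconstruction ::
    "'a set \<Rightarrow> 'a set set \<Rightarrow> ('a set \<Rightarrow> 'a list) \<Rightarrow> ('a set \<Rightarrow> 'a set)
      \<Rightarrow> ('a set \<Rightarrow> 'a \<Rightarrow> 'a set set) \<Rightarrow> bool" where
  "canonical_reconstruction U F co cmp neighbors \<longleftrightarrow>
     (\<forall>S\<in>maximal F. distinct (co S) \<and> set (co S) = S \<and>
        (\<forall>i\<le>length (co S). set (take i (co S)) \<in> F)) \<and>
     (\<exists>\<X>. \<forall>S\<in>maximal F. \<forall>v\<in>U - S.
        \<X> S v \<subseteq> Pow S \<and>
        (\<forall>X\<in>\<X> S v. (S - X) \<union> {v} \<in> F) \<and>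
        (\<forall>T\<in>maximal F. T \<noteq> S \<and> canonical_extender co S T = v \<longrightarrow>
           (\<exists>X\<in>\<X> S v. X \<inter> proximity co S T = {})) \<and>
        neighbors S v = (\<lambda>X. cmp ((S - X) \<union> {v})) ` \<X> S v) \<and>
     (\<forall>S\<in>maximal F. \<forall>v\<in>S. neighbors S v = {S})"


section \<open>A random access machine with subroutines\<close>

text \<open>Programs are while-programs over registers and a word-addressed memory. The state is
  the pair of the register contents and the memory contents. Arithmetic is truncating addition
  and subtraction on \<open>nat\<close>; a condition holds if its value is nonzero.

  A list of words is stored at address \<open>a\<close> as its length, at \<open>a\<close>, followed by its entries.
  \<open>Call f a d\<close> runs subroutine \<open>f\<close> on the list stored at \<open>a\<close> and stores its result at \<open>d\<close>;
  \<open>Output a\<close> outputs the list stored at \<open>a\<close>.\<close>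

datatype subroutine = Neighbors | Complete | Order

datatype expr = Num nat | Reg nat | Mem expr | Plus expr expr | Minus expr expr

datatype com =
    Skip
  | SetReg nat expr
  | SetMem expr expr
  | Call subroutine expr expr
  | Output expr
  | Seq com com
  | Cond expr com com
  | Loop expr com

type_synonym state = "(nat \<Rightarrow> nat) \<times> (nat \<Rightarrow> nat)"

text \<open>A subroutine maps its input words to its output words and its running time.\<close>

type_synonym subroutines = "subroutine \<Rightarrow> nat list \<Rightarrow> nat list \<times> nat"

fun eval :: "expr \<Rightarrow> state \<Rightarrow> nat" where
  "eval (Num n) s = n"
| "eval (Reg r) s = fst s r"
| "eval (Mem e) s = snd s (eval e s)"
| "eval (Plus e1 e2) s = eval e1 s + eval e2 s"
| "eval (Minus e1 e2) s = eval e1 s - eval e2 s"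

fun cost :: "expr \<Rightarrow> nat" where
  "cost (Num n) = 1"
| "cost (Reg r) = 1"
| "cost (Mem e) = cost e + 1"
| "cost (Plus e1 e2) = cost e1 + cost e2 + 1"
| "cost (Minus e1 e2) = cost e1 + cost e2 + 1"

definition read_list :: "(nat \<Rightarrow> nat) \<Rightarrow> nat \<Rightarrow> nat list" where
  "read_list m a = map (\<lambda>i. m (a + 1 + i)) [0..<m a]"

definition write_list :: "(nat \<Rightarrow> nat) \<Rightarrow> nat \<Rightarrow> nat list \<Rightarrow> (nat \<Rightarrow> nat)" where
  "write_list m a xs =
     (\<lambda>b. if b = a then length xs
          else if a < b \<and> b \<le> a + length xs then xs ! (b - a - 1) else m b)"

text \<open>The state is held in memory words \<open>0, \<dots>, B - 1\<close> (and the finitely many registers that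
  the program mentions), each holding a value of at most \<open>B\<close>. The bound on the values keeps
  data from being packed into large numbers: for \<open>B\<close> polynomial in the size \<open>n\<close> of the
  instance, all words have \<open>O(log n)\<close> bits.\<close>

definition fits :: "nat \<Rightarrow> state \<Rightarrow> bool" where
  "fits B s \<longleftrightarrow> (\<forall>r. fst s r \<le> B) \<and> (\<forall>a. snd s a \<noteq> 0 \<longrightarrow> a < B \<and> snd s a \<le> B)"

text \<open>\<open>Tick t\<close> is the passage of \<open>t\<close> time units, \<open>Emit xs\<close> the output of \<open>xs\<close>.\<close>

datatype event = Tick nat | Emit "nat list"

text \<open>\<open>exec sub B c s es s'\<close>: started in state \<open>s\<close>, the program \<open>c\<close> terminates in state \<open>s'\<close>
  after the sequence \<open>es\<close> of events, and all states on the way fit into space \<open>B\<close>. The working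
  space of a subroutine is bounded by its running time, so a call is within
  space \<open>B\<close> (apart from the caller's own) if it takes at most \<open>B\<close> steps.\<close>

inductive exec ::
    "subroutines \<Rightarrow> nat \<Rightarrow> com \<Rightarrow> state \<Rightarrow> event list \<Rightarrow> state \<Rightarrow> bool"
  for sub :: subroutines and B :: nat where
  Skip: "fits B s \<Longrightarrow> exec sub B Skip s [] s"
| SetReg: "fits B s \<Longrightarrow> s' = ((fst s)(r := eval e s), snd s) \<Longrightarrow> fits B s' \<Longrightarrow>
    exec sub B (SetReg r e) s [Tick (1 + cost e)] s'"
| SetMem: "fits B s \<Longrightarrow> s' = (fst s, (snd s)(eval a s := eval e s)) \<Longrightarrow> fits B s' \<Longrightarrow>
    exec sub B (SetMem a e) s [Tick (1 + cost a + cost e)] s'"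
| Call: "fits B s \<Longrightarrow> sub f (read_list (snd s) (eval a s)) = (xs, t) \<Longrightarrow> t \<le> B \<Longrightarrow>
    s' = (fst s, write_list (snd s) (eval d s) xs) \<Longrightarrow> fits B s' \<Longrightarrow>
    exec sub B (Call f a d) s [Tick (1 + cost a + cost d + t)] s'"
| Output: "fits B s \<Longrightarrow> xs = read_list (snd s) (eval a s) \<Longrightarrow>
    exec sub B (Output a) s [Tick (1 + cost a + length xs), Emit xs] s"
| Seq: "exec sub B c1 s es1 s' \<Longrightarrow> exec sub B c2 s' es2 s'' \<Longrightarrow>
    exec sub B (Seq c1 c2) s (es1 @ es2) s''"
| CondTrue: "eval e s \<noteq> 0 \<Longrightarrow> exec sub B c1 s es s' \<Longrightarrow>
    exec sub B (Cond e c1 c2) s (Tick (1 + cost e) # es) s'"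
| CondFalse: "eval e s = 0 \<Longrightarrow> exec sub B c2 s es s' \<Longrightarrow>
    exec sub B (Cond e c1 c2) s (Tick (1 + cost e) # es) s'"
| LoopTrue: "eval e s \<noteq> 0 \<Longrightarrow> exec sub B c s es1 s' \<Longrightarrow> exec sub B (Loop e c) s' es2 s'' \<Longrightarrow>
    exec sub B (Loop e c) s (Tick (1 + cost e) # es1 @ es2) s''"
| LoopFalse: "eval e s = 0 \<Longrightarrow> fits B s \<Longrightarrow>
    exec sub B (Loop e c) s [Tick (1 + cost e)] s"

inductive_cases exec_elims:
  "exec sub B Skip s es s'"
  "exec sub B (SetReg r e) s es s'"
  "exec sub B (SetMem a e) s es s'"
  "exec sub B (Call f a d) s es s'"
  "exec sub B (Output a) s es s'"
  "exec sub B (Seq c1 c2) s es s'"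
  "exec sub B (Cond e c1 c2) s es s'"
  "exec sub B (Loop e c) s es s'"

lemma exec_deterministic:
  assumes "exec sub B c s es s'" "exec sub B' c s fs t'"
  shows "fs = es \<and> t' = s'"
  using assms
proof (induction arbitrary: fs t' rule: exec.induct)
  case (Skip s)
  from Skip.prems show ?case
    by (rule exec_elims(1)) (simp_all add: Skip.hyps)
next
  case (SetReg s s' r e)
  from SetReg.prems show ?case
    by (rule exec_elims(2)) (simp_all add: SetReg.hyps)
next
  case (SetMem s s' a e)
  from SetMem.prems show ?case
    by (rule exec_elims(3)) (simp_all add: SetMem.hyps)
next
  case (Call s f a xs t s' d)
  from Call.prems show ?case
    by (rule exec_elims(4)) (simp_all add: Call.hyps)
next
  case (Output s xs a)
  from Output.prems show ?case
    by (rule exec_elims(5)) (simp_all add: Output.hyps)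
next
  case (Seq c1 s es1 s' c2 es2 s'')
  from Seq.prems show ?case
    by (rule exec_elims(6)) (metis Seq.IH)+
next
  case (CondTrue e s c1 es s' c2)
  from CondTrue.prems show ?case
    by (rule exec_elims(7)) (metis One_nat_def plus_1_eq_Suc less_numeral_extra(3) CondTrue.hyps(1) CondTrue.IH)+
next
  case (CondFalse e s c2 es s' c1)
  from CondFalse.prems show ?case
    by (rule exec_elims(7)) (metis One_nat_def plus_1_eq_Suc less_numeral_extra(3) CondFalse.hyps(1) CondFalse.IH)+
next
  case (LoopTrue e s c es1 s' es2 s'')
  from LoopTrue.prems show ?case
    by (rule exec_elims(8)) (metis One_nat_def plus_1_eq_Suc less_numeral_extra(3) LoopTrue.hyps(1) LoopTrue.IH)+
next
  case (LoopFalse e s c)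
  from LoopFalse.prems show ?case
    by (rule exec_elims(8)) (metis One_nat_def plus_1_eq_Suc less_numeral_extra(3) LoopFalse.hyps(1))+
qed

fun outputs :: "event list \<Rightarrow> nat list list" where
  "outputs [] = []"
| "outputs (Tick t # es) = outputs es"
| "outputs (Emit xs # es) = xs # outputs es"

text \<open>The times elapsed before the first output, between consecutive outputs, and from the
  last output to termination.\<close>

fun gaps :: "event list \<Rightarrow> nat list" where
  "gaps [] = [0]"
| "gaps (Tick t # es) = (t + hd (gaps es)) # tl (gaps es)"
| "gaps (Emit xs # es) = 0 # gaps es"

definition delay :: "event list \<Rightarrow> nat" where
  "delay es = Max (set (gaps es))"


section \<open>Enumeration problems as machine inputs\<close>

text \<open>The elements of the ground set are represented by their ids \<open>0, \<dots>, n - 1\<close>. The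
  parameters \<open>R\<^sub>T, R\<^sub>N, C\<^sub>t, O\<^sub>T\<close> may differ from instance to instance.\<close>

record problem =
  ground_size :: nat
  sols :: "nat set set"
  orders :: "nat set \<Rightarrow> nat \<Rightarrow> nat list"
  nbrs :: "nat set \<Rightarrow> nat \<Rightarrow> nat set set"
  subs :: subroutines
  RT :: nat
  RN :: nat
  CT :: nat
  OT :: nat

definition ground :: "problem \<Rightarrow> nat set" where
  "ground p = {..<ground_size p}"

definition max_size :: "problem \<Rightarrow> nat" where
  "max_size p = Max (card ` sols p)"

text \<open>A machine word sequence representing a set is its increasing enumeration. Running times
  are at least the length of the result, as a result is written word by word. The result of
  \<open>Neighbors\<close> is the number of solutions returned, followed by each of them preceded by its
  size.\<close>

definition runs :: "subroutines \<Rightarrow> subroutine \<Rightarrow> nat list \<Rightarrow> nat list \<Rightarrow> nat \<Rightarrow> bool" where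
  "runs sub f xs ys T \<longleftrightarrow> (\<exists>t. sub f xs = (ys, t) \<and> length ys \<le> t \<and> t \<le> T)"

definition subroutines_correct :: "problem \<Rightarrow> bool" where
  "subroutines_correct p \<longleftrightarrow>
     (\<forall>P\<in>maximal (sols p). \<forall>w\<in>ground p. \<exists>Ds.
        set Ds = nbrs p P w \<and> length Ds \<le> RN p \<and>
        runs (subs p) Neighbors (w # sorted_list_of_set P)
          (length Ds # concat (map (\<lambda>D. card D # sorted_list_of_set D) Ds)) (RT p)) \<and>
     (\<forall>X\<in>sols p. X \<inter> singletons (sols p) \<noteq> {} \<longrightarrow>
        runs (subs p) Complete (sorted_list_of_set X)
          (sorted_list_of_set (lex_comp (sols p) (orders p) X)) (CT p)) \<and>
     (\<forall>X\<in>sols p. \<forall>v\<in>X \<inter> singletons (sols p).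
        runs (subs p) Order (v # sorted_list_of_set X) (orders p X v) (OT p))"

text \<open>Initially register 0 contains \<open>n\<close> and the first \<open>n\<close> memory words contain the
  characteristic vector of \<open>Z\<close>; \<open>F\<close> is accessible only through the subroutines.\<close>

definition input :: "problem \<Rightarrow> state" where
  "input p = ((\<lambda>r. if r = 0 then ground_size p else 0),
              (\<lambda>a. if a \<in> ground p \<inter> singletons (sols p) then 1 else 0))"

definition polynomially_bounded :: "problem set \<Rightarrow> (problem \<Rightarrow> nat) \<Rightarrow> bool" where
  "polynomially_bounded I f \<longleftrightarrow> (\<exists>Q :: nat poly. \<forall>p\<in>I. f p \<le> poly Q (card (ground p)))"

end

theory Submission
  imports Defs
begin

text \<open>Compare solution orders lexicographically, seeds first. If a maximal solution \<open>A\<close> contains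
  a prefix of the order of \<open>S\<close> that is not a prefix of its own order, then \<open>A\<close> precedes \<open>S\<close>,
  because at the first difference the greedy choice within \<open>A\<close> is the earlier one. The
  completion of a prefix of the order of \<open>S\<close> is \<open>S\<close> or precedes it, too.

  This yields a parent function. Walk towards \<open>S\<close> from the completion of its seed: at a solution
  \<open>A\<close>, let \<open>w\<close> be the canonical extender and \<open>T\<close> the proximity of \<open>A\<close> and \<open>S\<close> with \<open>w\<close> added,
  and let \<open>D\<close> be the last item of \<open>neighbors A w\<close> that contains \<open>T\<close>. If the order of \<open>D\<close> starts
  with that prefix of the order of \<open>S\<close>, then go to the completion of \<open>T\<close>, otherwise go to \<open>D\<close>.
  The proximity grows, so \<open>S\<close> is reached in at most \<open>q\<close> steps, and every solution before it
  precedes \<open>S\<close>. The last of them is the parent of \<open>S\<close>; since the last step was a completion, \<open>S\<close>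
  is the completion of the prefix up to \<open>w\<close> of the order of an item of \<open>neighbors (parent S) w\<close>.

  Hence the children of a node are found by trying all items of all \<open>neighbors P w\<close>, and
  repeating the walk for each candidate. The walk also gives the way back from a child to the
  place in its parent's scan, so the depth-first traversal of the forest needs no stack. Nodes
  of even depth are output before, those of odd depth after their subtrees, so that only a
  bounded number of nodes is scanned between two outputs.\<close>

section \<open>Solution orders\<close>

text \<open>Reconstruction promises some item \<open>D\<close> of \<open>neighbors A w\<close> that
  contains \<open>T\<close>, but \<open>D\<close> need not precede \<open>S\<close>. The two kinds
  of step cover this gap: if the order of \<open>D\<close> deviates from the prefix, then
  \<open>D\<close> precedes \<open>S\<close>; if it agrees, nothing is known about \<open>D\<close>,
  and the completion of \<open>T\<close> stands in for it. A step to a deviating \<open>D\<close>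
  never ends in \<open>S\<close>, since nothing precedes itself, so the last step is always a
  completion. An agreeing \<open>D\<close> has \<open>w\<close> at the same position as
  \<open>S\<close>, hence \<open>D\<close> and \<open>w\<close> determine \<open>T\<close> without
  knowledge of \<open>S\<close>; this makes children computable.

  Several slots, that is, pairs of an element \<open>w\<close> and an index into the list for
  \<open>neighbors P w\<close>, may produce the same candidate. A slot counts only if the walk to
  its candidate ends at exactly this slot, so every child is found once.

  The bound arises from at most \<open>RN\<close> tests for each element \<open>w\<close>, each test
  being a walk of at most \<open>q\<close> steps with a bounded number of subroutine calls per step;
  the separate term with \<open>RT\<close> pays for the fetch that finds a list exhausted.\<close>

definition position :: "'a list \<Rightarrow> 'a \<Rightarrow> nat" where
  "position xs x = length (takeWhile (\<lambda>y. y \<noteq> x) xs)"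

lemma nth_position: "x \<in> set xs \<Longrightarrow> xs ! position xs x = x"
  unfolding position_def by (induction xs) auto

lemma position_eqD: "x \<in> set xs \<Longrightarrow> y \<in> set xs \<Longrightarrow> position xs x = position xs y \<Longrightarrow> x = y"
  by (metis nth_position)

lemma position_less: "x \<in> set xs \<Longrightarrow> position xs x < length xs"
  unfolding position_def by (induction xs) auto

lemma position_nth: "distinct xs \<Longrightarrow> i < length xs \<Longrightarrow> position xs (xs ! i) = i"
  by (meson nth_eq_iff_index_eq nth_mem nth_position position_less)

lemma earliest_in:
  assumes "A \<inter> set xs \<noteq> {}"
  shows "earliest A xs \<in> A \<inter> set xs"
proof -
  have "filter (\<lambda>x. x \<in> A) xs \<noteq> []"
    using assms by (auto simp: filter_empty_conv)
  then have "hd (filter (\<lambda>x. x \<in> A) xs) \<in> set (filter (\<lambda>x. x \<in> A) xs)"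
    by (rule hd_in_set)
  then show ?thesis
    by (auto simp: earliest_def)
qed

lemma position_earliest:
  "y \<in> A \<Longrightarrow> y \<in> set xs \<Longrightarrow> position xs (earliest A xs) \<le> position xs y"
  unfolding position_def earliest_def
  by (induction xs) (auto simp: takeWhile_eq_Nil_iff)

text \<open>Minimality survives the removal of other elements. \<open>comp_prefix\<close> uses this
  to identify the greedy choice among all extensions with the greedy choice inside a
  solution.\<close>

lemma earliest_subset:
  assumes "B \<subseteq> A" "A \<inter> set xs \<noteq> {}" "earliest A xs \<in> B"
  shows "earliest B xs = earliest A xs"
proof -
  have A: "earliest A xs \<in> A \<inter> set xs"
    by (rule earliest_in[OF assms(2)])
  then have B: "earliest B xs \<in> B \<inter> set xs"
    using assms by (intro earliest_in) auto
  show ?thesis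
    using A B assms
    by (intro position_eqD[of _ xs] antisym position_earliest) auto
qed

lemma first_difference:
  assumes "take h xs \<noteq> take h ys" "h \<le> length xs" "h \<le> length ys"
  obtains j where "j < h" "take j xs = take j ys" "xs ! j \<noteq> ys ! j"
  using assms
proof (induction h arbitrary: thesis)
  case (Suc h)
  show ?case
  proof (cases "take h xs = take h ys")
    case True
    then show ?thesis
      using Suc.prems by (intro Suc.prems(1)[of h]) (auto simp: take_Suc_conv_app_nth)
  next
    case False
    then show ?thesis
      using Suc by (metis Suc_leD less_Suc_eq)
  qed
qed simp

lemma maximal_subset_eq: "A \<in> maximal F \<Longrightarrow> B \<in> F \<Longrightarrow> A \<subseteq> B \<Longrightarrow> A = B"
  by (auto simp: maximal_def)

section \<open>Solutions and orders of a prefix-closed family\<close>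

locale prefix_system =
  fixes U :: "'a::linorder set" and F :: "'a set set" and \<Pi> :: "'a set \<Rightarrow> 'a \<Rightarrow> 'a list"
  assumes system: "set_system U F"
    and accessible: "strongly_accessible F"
    and closed: "prefix_closed F \<Pi>"
    and empty_sol: "{} \<in> F"
begin

abbreviation "Z \<equiv> singletons F"
abbreviation "cmp \<equiv> lex_comp F \<Pi>"
abbreviation "ord \<equiv> solution_order F \<Pi>"

lemma finite_sol: "S \<in> F \<Longrightarrow> finite S"
  using system by (auto simp: set_system_def intro: finite_subset)

lemma sol_subset: "S \<in> F \<Longrightarrow> S \<subseteq> U"
  using system by (auto simp: set_system_def)

lemma finite_F: "finite F"
  using system by (auto simp: set_system_def intro: finite_subset)

lemma maximal_sol: "S \<in> maximal F \<Longrightarrow> S \<in> F"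
  by (auto simp: maximal_def)

text \<open>Strong accessibility, applied to \<open>{}\<close> and \<open>S\<close>, adds a first
  element that is a solution by itself.\<close>

lemma seeded: "S \<in> F \<Longrightarrow> S \<noteq> {} \<Longrightarrow> S \<inter> Z \<noteq> {}"
  using accessible[unfolded strongly_accessible_def, rule_format, OF empty_sol, of S]
  by (auto simp: singletons_def)

lemma seed_in: "X \<in> F \<Longrightarrow> X \<noteq> {} \<Longrightarrow> seed F X \<in> X \<inter> Z"
  unfolding seed_def using seeded finite_sol by (intro Min_in) auto

lemma seed_le: "X \<in> F \<Longrightarrow> x \<in> X \<Longrightarrow> x \<in> Z \<Longrightarrow> seed F X \<le> x"
  unfolding seed_def using finite_sol by (intro Min_le) auto

lemma seed_subset:
  assumes "X \<in> F" "Y \<in> F" "X \<subseteq> Y" "seed F Y \<in> X"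
  shows "seed F X = seed F Y"
proof (rule antisym)
  have Y: "seed F Y \<in> Y \<inter> Z" using assms by (intro seed_in) auto
  then show "seed F X \<le> seed F Y" using assms by (intro seed_le) auto
  have "seed F X \<in> X \<inter> Z" using assms by (intro seed_in) auto
  then show "seed F Y \<le> seed F X" using assms by (intro seed_le) auto
qed

lemma order_props:
  assumes "X \<in> F" "v \<in> X" "v \<in> Z"
  shows "distinct (\<Pi> X v)" "set (\<Pi> X v) = X \<union> ext F X"
  using closed assms by (auto simp: prefix_closed_def)

lemma ord_props:
  assumes "S \<in> F" "S \<noteq> {}"
  shows distinct_ord: "distinct (ord S)" and set_ord: "set (ord S) = S"
  using order_props[OF assms(1), of "seed F S"] seed_in[OF assms]
  by (auto simp: solution_order_def)

lemma length_ord: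
  assumes "S \<in> F" "S \<noteq> {}"
  shows "length (ord S) = card S"
  using distinct_card[OF distinct_ord[OF assms]] set_ord[OF assms] by simp

lemma ord_step:
  assumes "S \<in> F" "S \<noteq> {}" "1 \<le> i" "i < length (ord S)"
  shows "ord S ! 0 = seed F S" "set (take i (ord S)) \<in> F"
    "ord S ! i = earliest (ext F (set (take i (ord S))) \<inter> S - set (take i (ord S)))
                   (\<Pi> (set (take i (ord S))) (seed F S))"
proof -
  let ?v = "seed F S"
  have "\<forall>i\<in>{1..<length (ord S)}. ord S ! 0 = ?v \<and> set (take i (ord S)) \<in> F \<and>
      ord S ! i = earliest (ext F (set (take i (ord S))) \<inter> S - set (take i (ord S)))
                   (\<Pi> (set (take i (ord S))) ?v)"
    using closed[unfolded prefix_closed_def Let_def, THEN bspec, OF assms(1), THEN bspec,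
        OF seed_in[OF assms(1,2)]]
    unfolding solution_order_def by (elim conjE)
  then show "ord S ! 0 = ?v" "set (take i (ord S)) \<in> F"
    "ord S ! i = earliest (ext F (set (take i (ord S))) \<inter> S - set (take i (ord S)))
                   (\<Pi> (set (take i (ord S))) ?v)"
    using assms(3,4) by (simp_all only: atLeastLessThan_iff) 
qed

lemma ord_nonempty: "S \<in> F \<Longrightarrow> S \<noteq> {} \<Longrightarrow> ord S \<noteq> []"
  using set_ord by fastforce

lemma ord_0:
  assumes "S \<in> F" "S \<noteq> {}"
  shows "ord S ! 0 = seed F S"
proof (cases "1 < length (ord S)")
  case True
  then show ?thesis using ord_step(1)[OF assms, of 1] by simp
next
  \<comment> \<open>For a one-element solution the index range of \<open>prefix_closed\<close> is
    empty, so the first element is known only because there is no other.\<close>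
  case False
  then have "length (ord S) = 1"
    using ord_nonempty[OF assms] by (cases "ord S") auto
  then obtain x where "ord S = [x]"
    by (auto simp: length_Suc_conv)
  then show ?thesis
    using set_ord[OF assms] seed_in[OF assms] by auto
qed

lemma prefix_sol:
  assumes "S \<in> F" "S \<noteq> {}"
  shows "set (take i (ord S)) \<in> F"
proof -
  consider "i = 0" | "i \<ge> length (ord S)" | "1 \<le> i" "i < length (ord S)"
    by linarith
  then show ?thesis
    by cases (use empty_sol set_ord ord_step assms in auto)
qed

text \<open>All nonempty prefixes have the seed of \<open>S\<close>, so at a prefix \<open>X\<close>
  the order of \<open>S\<close> and the completion of \<open>X\<close> consult the same list
  \<open>\<Pi> X (seed F S)\<close>.\<close>

lemma prefix_seed:
  assumes "S \<in> F" "S \<noteq> {}" "1 \<le> i"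
  shows "seed F S \<in> set (take i (ord S))" "seed F (set (take i (ord S))) = seed F S"
proof -
  show *: "seed F S \<in> set (take i (ord S))"
    using ord_0[OF assms(1,2)] ord_nonempty[OF assms(1,2)] assms(3)
    by (cases "ord S"; cases i) auto
  show "seed F (set (take i (ord S))) = seed F S"
    using assms set_ord[OF assms(1,2)] prefix_sol[OF assms(1,2)] *
    by (intro seed_subset) (auto dest: in_set_takeD)
qed

lemma next_in_ext:
  assumes "S \<in> F" "S \<noteq> {}" "i < length (ord S)"
  shows "ord S ! i \<in> ext F (set (take i (ord S))) - set (take i (ord S))"
proof -
  have "insert (ord S ! i) (set (take i (ord S))) \<in> F"
    using prefix_sol[OF assms(1,2), of "Suc i"] assms(3) by (simp add: take_Suc_conv_app_nth)
  moreover have "ord S ! i \<notin> set (take i (ord S))"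
    using distinct_ord[OF assms(1,2)] assms(3)
    by (auto simp: in_set_conv_nth nth_eq_iff_index_eq)
  ultimately show ?thesis by (simp add: ext_def)
qed

section \<open>Lexicographic completion\<close>

lemma no_ext_maximal: "X \<in> F \<Longrightarrow> ext F X - X = {} \<Longrightarrow> X \<in> maximal F"
  using accessible[unfolded strongly_accessible_def, rule_format, of X]
  by (fastforce simp: maximal_def ext_def)

lemma maximal_no_ext: "X \<in> maximal F \<Longrightarrow> ext F X - X = {}"
  unfolding maximal_def ext_def by auto

definition next_elem :: "'a set \<Rightarrow> 'a" where
  "next_elem X = earliest (ext F X - X) (\<Pi> X (seed F X))"

lemma next_elem_in:
  assumes "X \<in> F" "X \<noteq> {}" "ext F X - X \<noteq> {}"
  shows "next_elem X \<in> ext F X - X"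
  using earliest_in[of "ext F X - X" "\<Pi> X (seed F X)"] order_props[of X "seed F X"]
    seed_in[OF assms(1,2)] assms
  unfolding next_elem_def by blast

lemma comp_unfold: "cmp X = (if ext F X - X = {} then X else cmp (insert (next_elem X) X))"
  unfolding lex_comp_def next_elem_def by (subst while_unfold) auto

text \<open>Each round of the completion takes an element out of the finite set
  \<open>U - X\<close>, which is the termination argument for the underlying
  \<open>while\<close>.\<close>

lemma comp_induct [consumes 2, case_names maximal step]:
  assumes "X \<in> F" "X \<noteq> {}"
    and "\<And>X. X \<in> F \<Longrightarrow> X \<noteq> {} \<Longrightarrow> ext F X - X = {} \<Longrightarrow> P X"
    and "\<And>X. X \<in> F \<Longrightarrow> X \<noteq> {} \<Longrightarrow> ext F X - X \<noteq> {} \<Longrightarrow> insert (next_elem X) X \<in> F \<Longrightarrow>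
      P (insert (next_elem X) X) \<Longrightarrow> P X"
  shows "P X"
  using assms(1,2)
proof (induction "card (U - X)" arbitrary: X rule: less_induct)
  case less
  show ?case
  proof (cases "ext F X - X = {}")
    case False
    then have x: "next_elem X \<in> ext F X - X"
      using less.prems by (intro next_elem_in)
    then have sol: "insert (next_elem X) X \<in> F"
      by (simp add: ext_def)
    have "finite U" using system by (simp add: set_system_def)
    then have "card (U - insert (next_elem X) X) < card (U - X)"
      using x sol_subset[OF sol] by (intro psubset_card_mono) auto
    then show ?thesis
      using less assms(4) False sol by blast
  qed (use less assms(3) in blast)
qed

lemma comp_maximal: "X \<in> F \<Longrightarrow> X \<noteq> {} \<Longrightarrow> cmp X \<in> maximal F \<and> X \<subseteq> cmp X"
proof (induction X rule: comp_induct)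
  case (maximal X)
  then show ?case by (subst (1 2) comp_unfold) (simp add: no_ext_maximal)
next
  case (step X)
  then show ?case by (subst (1 2) comp_unfold) auto
qed

lemma comp_of_maximal: "X \<in> maximal F \<Longrightarrow> cmp X = X"
  by (subst comp_unfold) (simp add: maximal_no_ext)

section \<open>Comparison of solutions by their orders\<close>

definition ranks :: "'a set \<Rightarrow> nat list" where
  "ranks S = map (\<lambda>j. position (\<Pi> (set (take j (ord S))) (seed F S)) (ord S ! j)) [0..<length (ord
      S)]"

definition precedes :: "'a set \<Rightarrow> 'a set \<Rightarrow> bool" where
  "precedes A S \<longleftrightarrow> seed F A < seed F S \<or>
     seed F A = seed F S \<and> (ranks A, ranks S) \<in> lexord less_than"

lemma precedes_irrefl: "\<not> precedes A A"
  unfolding precedes_def using lexord_irreflexive[of less_than "ranks A"] by auto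

lemma precedes_trans: "precedes A B \<Longrightarrow> precedes B C \<Longrightarrow> precedes A C"
  unfolding precedes_def
  using lexord_trans[of "ranks A" "ranks B" less_than "ranks C"] by (auto simp: trans_less_than)

text \<open>Up to the prefix of length \<open>j\<close> both solutions choose from the same lists,
  so their ranks agree before \<open>j\<close>, and entry \<open>j\<close> is for both a position in
  one common list.\<close>

lemma precedes_at:
  assumes "seed F A = seed F S" "j < length (ord A)" "j < length (ord S)"
    "take j (ord A) = take j (ord S)"
    "position (\<Pi> (set (take j (ord S))) (seed F S)) (ord A ! j) <
     position (\<Pi> (set (take j (ord S))) (seed F S)) (ord S ! j)"
  shows "precedes A S"
proof -
  have "take j (ranks A) = take j (ranks S)"
  proof (rule nth_equalityI)
    fix i assume "i < length (take j (ranks A))"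
    then have "i < j" using assms by (simp add: ranks_def)
    then have "take i (ord A) = take i (ord S)" "ord A ! i = ord S ! i"
      using assms(4) by (metis less_or_eq_imp_le min.absorb1 take_take, metis nth_take)
    then show "take j (ranks A) ! i = take j (ranks S) ! i"
      using assms \<open>i < j\<close> by (simp add: ranks_def)
  qed (use assms in \<open>simp add: ranks_def\<close>)
  then have "(ranks A, ranks S) \<in> lexord less_than"
    unfolding lexord_take_index_conv using assms by (auto simp: ranks_def intro!: exI[of _ j])
  then show ?thesis using assms(1) by (simp add: precedes_def)
qed

lemma earlier_choice:
  assumes X: "X \<in> F" "seed F X = v" "X \<noteq> {}"
    and "B \<subseteq> ext F X" "x = earliest B (\<Pi> X v)" "y \<in> B" "x \<noteq> y"
  shows "position (\<Pi> X v) x < position (\<Pi> X v) y"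
proof -
  have *: "set (\<Pi> X v) = X \<union> ext F X"
    using order_props[OF X(1), of v] seed_in[OF X(1,3)] X(2) by blast
  then have "y \<in> set (\<Pi> X v)" "x \<in> set (\<Pi> X v)"
    using assms earliest_in[of B "\<Pi> X v"] by auto
  then show ?thesis
    using position_earliest[of y B "\<Pi> X v"] position_eqD[of x "\<Pi> X v" y] assms
    by (metis nat_less_le)
qed

lemma precedes_if_prefix_subset:
  assumes "A \<in> F" "S \<in> F" "S \<noteq> {}" "1 \<le> h" "h \<le> length (ord S)"
    and sub: "set (take h (ord S)) \<subseteq> A"
    and diff: "take h (ord A) \<noteq> take h (ord S)"
  shows "precedes A S"
proof -
  have sA: "seed F S \<in> A"
    using prefix_seed(1)[OF assms(2-4)] sub by blast
  then have A: "A \<noteq> {}" by blast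
  have "seed F A \<le> seed F S"
    using sA seed_in[OF assms(2,3)] assms(1) by (intro seed_le) auto
  then consider "seed F A < seed F S" | "seed F A = seed F S"
    by fastforce
  then show ?thesis
  proof cases
    case 2
    have "card (set (take h (ord S))) = h"
      using distinct_card[OF distinct_take[OF distinct_ord[OF assms(2,3)]], of h] assms(5) by simp
    then have hA: "h \<le> length (ord A)"
      using card_mono[OF finite_sol[OF assms(1)] sub] length_ord[OF assms(1) A] by simp
    obtain j where j: "j < h" "take j (ord A) = take j (ord S)" "ord A ! j \<noteq> ord S ! j"
      using first_difference[OF diff hA assms(5)] by blast
    \<comment> \<open>Both orders start with the common seed, so they cannot differ at index 0,
      where \<open>ord_step\<close> says nothing.\<close>
    have j0: "1 \<le> j"
      using ord_0[OF assms(1) A] ord_0[OF assms(2,3)] 2 j(3) by (cases j) auto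
    let ?X = "set (take j (ord S))"
    \<comment> \<open>The element that \<open>S\<close> takes next lies in \<open>A\<close> as well,
      so it competes in the greedy choice of \<open>A\<close> and loses.\<close>
    have "ord S ! j \<in> A"
      using sub j(1) assms(5) nth_mem[of j "take h (ord S)"] by (auto simp: subset_eq)
    then have S: "ord S ! j \<in> ext F ?X \<inter> A - ?X"
      using next_in_ext[OF assms(2,3), of j] j(1) assms(5) by auto
    have "ord A ! j = earliest (ext F ?X \<inter> A - ?X) (\<Pi> ?X (seed F S))"
      using ord_step(3)[OF assms(1) A j0] j(1,2) 2 hA by simp
    moreover have "?X \<noteq> {}"
      using prefix_seed(1)[OF assms(2,3) j0] by force
    ultimately have "position (\<Pi> ?X (seed F S)) (ord A ! j) < position (\<Pi> ?X (seed F S)) (ord S !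
        j)"
      using S j(3) prefix_sol[OF assms(2,3)] prefix_seed(2)[OF assms(2,3) j0]
      by (intro earlier_choice[where B = "ext F ?X \<inter> A - ?X"]) auto
    then show ?thesis
      using 2 j(1,2) hA assms(5) by (intro precedes_at) auto
  qed (simp add: precedes_def)
qed

text \<open>The completion adds the minimum over all extensions of a prefix. If the outcome is
  \<open>E\<close>, this element lies in \<open>E\<close>, so it is also the minimum over the
  extensions inside \<open>E\<close>, which is the next element of the order of
  \<open>E\<close>.\<close>

lemma comp_prefix:
  assumes E: "E \<in> maximal F" "E \<noteq> {}" and "1 \<le> h" "cmp (set (take h (ord E))) = E"
    "h \<le> j" "j \<le> length (ord E)"
  shows "cmp (set (take j (ord E))) = E \<and>
    (j < length (ord E) \<longrightarrow> ord E ! j = next_elem (set (take j (ord E))))"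
  using assms(5,6)
proof (induction j rule: dec_induct)
  have nxt: "ord E ! j = next_elem (set (take j (ord E)))"
    if j: "h \<le> j" "j < length (ord E)" and eq: "cmp (set (take j (ord E))) = E" for j
  proof -
    let ?X = "set (take j (ord E))"
    have EF: "E \<in> F" using E by (simp add: maximal_def)
    have j1: "1 \<le> j" using j assms(3) by simp
    have X: "?X \<in> F" "?X \<noteq> {}" "seed F ?X = seed F E"
      using prefix_sol[OF EF E(2)] prefix_seed[OF EF E(2) j1] by force+
    have ne: "ext F ?X - ?X \<noteq> {}"
      using next_in_ext[OF EF E(2) j(2)] by auto
    have in_ext: "next_elem ?X \<in> ext F ?X - ?X"
      by (rule next_elem_in[OF X(1,2) ne])
    then have "insert (next_elem ?X) ?X \<in> F"
      by (simp add: ext_def)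
    then have "next_elem ?X \<in> cmp (insert (next_elem ?X) ?X)"
      using comp_maximal[of "insert (next_elem ?X) ?X"] by auto
    then have "next_elem ?X \<in> E"
      using eq ne by (subst (asm) comp_unfold) auto
    then have "earliest (ext F ?X \<inter> E - ?X) (\<Pi> ?X (seed F E)) = next_elem ?X"
      using in_ext order_props(2)[OF X(1), of "seed F ?X"] seed_in[OF X(1,2)] X(3)
      unfolding next_elem_def
      by (subst earliest_subset[where A = "ext F ?X - ?X"]) auto
    then show ?thesis
      using ord_step(3)[OF EF E(2) j1 j(2)] by simp
  qed
  {
    case base
    then show ?case using nxt[of h] assms(4) by simp
  next
    case (step j)
    then have *: "cmp (set (take j (ord E))) = E" "ord E ! j = next_elem (set (take j (ord E)))"
      by simp_all
    have "ext F (set (take j (ord E))) - set (take j (ord E)) \<noteq> {}"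
      using next_in_ext[of E j] E step by (auto simp: maximal_def)
    then have "cmp (set (take (Suc j) (ord E))) = E"
      using * step.prems by (subst (asm) comp_unfold) (simp add: take_Suc_conv_app_nth)
    then show ?case
      using nxt[of "Suc j"] step by simp
  }
qed

text \<open>Write \<open>E\<close> for the completion. If its order does not start with the prefix,
  \<open>precedes_if_prefix_subset\<close> applies. Otherwise \<open>comp_prefix\<close> shows that
  after the prefix \<open>E\<close> always takes the minimum over all extensions, so at the first
  difference \<open>S\<close> has taken a later one.\<close>

lemma comp_prefix_precedes:
  assumes S: "S \<in> maximal F" "S \<noteq> {}" and "1 \<le> h" "h \<le> length (ord S)"
    and ne: "cmp (set (take h (ord S))) \<noteq> S"
  shows "precedes (cmp (set (take h (ord S)))) S"
proof -
  let ?T = "set (take h (ord S))"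
  let ?E = "cmp ?T"
  have SF: "S \<in> F" using S by (simp add: maximal_def)
  have T: "?T \<in> F" "?T \<noteq> {}"
    using prefix_sol[OF SF S(2)] prefix_seed(1)[OF SF S(2) assms(3)] by force+
  have E: "?E \<in> maximal F" "?T \<subseteq> ?E"
    using comp_maximal[OF T] by auto
  then have EF: "?E \<in> F" "?E \<noteq> {}"
    using T by (auto simp: maximal_def)
  show ?thesis
  proof (cases "take h (ord ?E) = take h (ord S)")
    case False
    then show ?thesis
      using precedes_if_prefix_subset[OF EF(1) SF S(2) assms(3,4) E(2)] by simp
  next
    case True
    have seeds: "seed F ?E = seed F S"
      using prefix_seed(2)[OF EF assms(3)] prefix_seed(2)[OF SF S(2) assms(3)] True by simp
    define m where "m = min (length (ord ?E)) (length (ord S))"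
    \<comment> \<open>Agreement on the common length would make one of two distinct maximal
      solutions contain the other.\<close>
    have "take m (ord ?E) \<noteq> take m (ord S)"
    proof
      assume *: "take m (ord ?E) = take m (ord S)"
      have "set (ord ?E) \<subseteq> set (ord S) \<or> set (ord S) \<subseteq> set (ord ?E)"
        using * unfolding m_def
        by (cases "length (ord ?E) \<le> length (ord S)")
          (simp_all add: min_def, metis set_take_subset, metis set_take_subset)
      then have "?E \<subseteq> S \<or> S \<subseteq> ?E"
        using set_ord[OF EF] set_ord[OF SF S(2)] by simp
      then show False
        using maximal_subset_eq[OF E(1) SF] maximal_subset_eq[OF S(1) EF(1)] ne by auto
    qed
    then obtain j where j: "j < m" "take j (ord ?E) = take j (ord S)" "ord ?E ! j \<noteq> ord S ! j"
      using first_difference[of m "ord ?E" "ord S"] by (auto simp: m_def)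
    have hj: "h \<le> j"
      using True j(3) by (metis linorder_not_less nth_take)
    let ?X = "set (take j (ord S))"
    have X: "?X \<in> F" "?X \<noteq> {}" "seed F ?X = seed F S"
      using prefix_sol[OF SF S(2)] prefix_seed[OF SF S(2), of j] hj assms(3) by force+
    have "ord ?E ! j = next_elem ?X"
      using comp_prefix[OF E(1) EF(2) assms(3) _ hj] True j(1,2) by (simp add: m_def)
    then have "position (\<Pi> ?X (seed F S)) (ord ?E ! j) < position (\<Pi> ?X (seed F S)) (ord S ! j)"
      using next_in_ext[OF SF S(2), of j] j X
      by (intro earlier_choice[where B = "ext F ?X - ?X"]) (auto simp: next_elem_def m_def)
    then show ?thesis
      using seeds j(1,2) by (intro precedes_at) (auto simp: m_def)
  qed
qed

end

section \<open>Parents\<close>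

text \<open>The shift by one keeps 0 free for the absence of an index, and taking the last index is
  what a loop does that overwrites its result.\<close>

primrec last_hit :: "(nat \<Rightarrow> bool) \<Rightarrow> nat \<Rightarrow> nat" where
  "last_hit P 0 = 0"
| "last_hit P (Suc j) = (if P j then Suc j else last_hit P j)"

lemma last_hit_le: "last_hit P N \<le> N"
  by (induction N) auto

lemma last_hit_hits: "j < N \<Longrightarrow> P j \<Longrightarrow> last_hit P N \<noteq> 0 \<and> P (last_hit P N - 1)"
  by (induction N) (auto simp: less_Suc_eq)

text \<open>The list \<open>nb\<close> gives the items of \<open>neighbors\<close> the indices that
  slots need. An instance with \<open>Z = {}\<close> has only the solution \<open>{}\<close> and is
  treated separately in \<open>exec_admissible\<close>.\<close>

locale reconstruction = prefix_system U F \<Pi>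
  for U :: "'a::linorder set" and F \<Pi> +
  fixes neighbors :: "'a set \<Rightarrow> 'a \<Rightarrow> 'a set set" and nb :: "'a set \<Rightarrow> 'a \<Rightarrow> 'a set list"
  assumes canonical: "canonical_reconstruction U F ord cmp neighbors"
    and nb: "P \<in> maximal F \<Longrightarrow> w \<in> U \<Longrightarrow> set (nb P w) = neighbors P w"
    and singleton: "Z \<noteq> {}"
begin

lemma maximal_nonempty: "S \<in> maximal F \<Longrightarrow> S \<noteq> {}"
  using singleton by (auto simp: maximal_def singletons_def)

lemma comp_singleton_maximal: "v \<in> Z \<Longrightarrow> cmp {v} \<in> maximal F \<and> v \<in> cmp {v}"
  using comp_maximal[of "{v}"] by (auto simp: singletons_def)

section \<open>Steps, walks, parents and candidates\<close>

definition prox :: "'a set \<Rightarrow> 'a set \<Rightarrow> nat" where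
  "prox A S = length (takeWhile (\<lambda>x. x \<in> A) (ord S))"

definition extender :: "'a set \<Rightarrow> 'a set \<Rightarrow> 'a" where
  "extender A S = ord S ! prox A S"

definition target :: "'a set \<Rightarrow> 'a set \<Rightarrow> 'a set" where
  "target A S = set (take (Suc (prox A S)) (ord S))"

definition hit :: "'a set \<Rightarrow> 'a set \<Rightarrow> nat" where
  "hit A S = last_hit (\<lambda>j. target A S \<subseteq> nb A (extender A S) ! j) (length (nb A (extender A S)))"

definition link :: "'a set \<Rightarrow> 'a set \<Rightarrow> 'a set" where
  "link A S = nb A (extender A S) ! (hit A S - 1)"

definition follows :: "'a set \<Rightarrow> 'a set \<Rightarrow> bool" where
  "follows A S \<longleftrightarrow>
     take (Suc (prox A S)) (ord (link A S)) = take (Suc (prox A S)) (ord S)"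

definition advance :: "'a set \<Rightarrow> 'a set \<Rightarrow> 'a set" where
  "advance S A = (if follows A S then cmp (target A S) else link A S)"

definition walk :: "'a set \<Rightarrow> nat \<Rightarrow> 'a set" where
  "walk S k = (advance S ^^ k) (cmp {seed F S})"

definition is_root :: "'a set \<Rightarrow> bool" where
  "is_root S \<longleftrightarrow> cmp {seed F S} = S"

definition walk_length :: "'a set \<Rightarrow> nat" where
  "walk_length S = (LEAST k. advance S (walk S k) = S)"

definition parent :: "'a set \<Rightarrow> 'a set" where
  "parent S = walk S (walk_length S)"

text \<open>This does not mention the child: in an order that starts with the prefix ending in
  \<open>w\<close>, the position of \<open>w\<close> recovers the length of that prefix.\<close>

definition candidate :: "'a set \<Rightarrow> 'a \<Rightarrow> nat \<Rightarrow> 'a set" where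
  "candidate P w i =
     cmp (set (take (Suc (position (ord (nb P w ! i)) w)) (ord (nb P w ! i))))"

definition removals :: "'a set \<Rightarrow> 'a \<Rightarrow> 'a set set" where
  "removals = (SOME \<X>. \<forall>S\<in>maximal F. \<forall>v\<in>U - S. \<X> S v \<subseteq> Pow S \<and>
        (\<forall>X\<in>\<X> S v. (S - X) \<union> {v} \<in> F) \<and>
        (\<forall>T\<in>maximal F. T \<noteq> S \<and> canonical_extender ord S T = v \<longrightarrow>
           (\<exists>X\<in>\<X> S v. X \<inter> proximity ord S T = {})) \<and>
        neighbors S v = (\<lambda>X. cmp ((S - X) \<union> {v})) ` \<X> S v)"

lemma removals:
  assumes "S \<in> maximal F" "v \<in> U - S"
  shows "X \<in> removals S v \<Longrightarrow> (S - X) \<union> {v} \<in> F"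
    "T \<in> maximal F \<Longrightarrow> T \<noteq> S \<Longrightarrow> canonical_extender ord S T = v \<Longrightarrow>
      \<exists>X\<in>removals S v. X \<inter> proximity ord S T = {}"
    "neighbors S v = (\<lambda>X. cmp ((S - X) \<union> {v})) ` removals S v"
proof -
  have "\<exists>\<X>. \<forall>S\<in>maximal F. \<forall>v\<in>U - S. \<X> S v \<subseteq> Pow S \<and>
        (\<forall>X\<in>\<X> S v. (S - X) \<union> {v} \<in> F) \<and>
        (\<forall>T\<in>maximal F. T \<noteq> S \<and> canonical_extender ord S T = v \<longrightarrow>
           (\<exists>X\<in>\<X> S v. X \<inter> proximity ord S T = {})) \<and>
        neighbors S v = (\<lambda>X. cmp ((S - X) \<union> {v})) ` \<X> S v"
    using canonical unfolding canonical_reconstruction_def by (elim conjE)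
  from someI_ex[OF this, folded removals_def, THEN bspec, OF assms(1), THEN bspec, OF assms(2)]
  show "X \<in> removals S v \<Longrightarrow> (S - X) \<union> {v} \<in> F"
    "T \<in> maximal F \<Longrightarrow> T \<noteq> S \<Longrightarrow> canonical_extender ord S T = v \<Longrightarrow>
      \<exists>X\<in>removals S v. X \<inter> proximity ord S T = {}"
    "neighbors S v = (\<lambda>X. cmp ((S - X) \<union> {v})) ` removals S v"
    by simp_all
qed

lemma neighbors_of_member: "P \<in> maximal F \<Longrightarrow> w \<in> P \<Longrightarrow> neighbors P w = {P}"
  using canonical unfolding canonical_reconstruction_def by (elim conjE) simp

lemma nb_maximal:
  assumes "P \<in> maximal F" "w \<in> U" "D \<in> set (nb P w)"
  shows "D \<in> maximal F" "w \<in> D"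
proof -
  have D: "D \<in> neighbors P w" using assms nb by simp
  have "D \<in> maximal F \<and> w \<in> D"
  proof (cases "w \<in> P")
    case True
    then have "neighbors P w = {P}"
      using neighbors_of_member assms(1) by blast
    then show ?thesis using D True assms by auto
  next
    case False
    then have w: "w \<in> U - P" using assms by simp
    then obtain X where "X \<in> removals P w" "D = cmp ((P - X) \<union> {w})"
      using D removals(3)[OF assms(1) w] by auto
    then show ?thesis
      using comp_maximal[OF removals(1)[OF assms(1) w]] by auto
  qed
  then show "D \<in> maximal F" "w \<in> D" by auto
qed

section \<open>A single step of a walk\<close>

context
  fixes A S :: "'a set"
  assumes A: "A \<in> maximal F" and S: "S \<in> maximal F" and AS: "A \<noteq> S"
begin

lemma SF: "S \<in> F" "S \<noteq> {}" and AF: "A \<in> F" "A \<noteq> {}"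
  using A S maximal_sol maximal_nonempty by auto

lemma prox_less: "prox A S < length (ord S)"
proof (rule ccontr)
  assume "\<not> ?thesis"
  then have "length (takeWhile (\<lambda>x. x \<in> A) (ord S)) = length (ord S)"
    using length_takeWhile_le[of "\<lambda>x. x \<in> A" "ord S"] by (simp add: prox_def)
  then have "takeWhile (\<lambda>x. x \<in> A) (ord S) = ord S"
    by (metis takeWhile_eq_take take_all_iff le_refl)
  then have "S \<subseteq> A"
    using set_ord[OF SF] by (metis set_takeWhileD subsetI)
  then show False
    using maximal_subset_eq[OF S AF(1)] AS by simp
qed

lemma extender_in: "extender A S \<in> S" "extender A S \<notin> A" "extender A S \<in> U"
proof -
  show "extender A S \<in> S"
    using nth_mem[OF prox_less] set_ord[OF SF] by (simp add: extender_def)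
  then show "extender A S \<in> U" using sol_subset[OF SF(1)] by auto
  show "extender A S \<notin> A"
    using nth_length_takeWhile[of "\<lambda>x. x \<in> A" "ord S"] prox_less
    by (simp add: extender_def prox_def)
qed

lemma target_eq: "target A S = insert (extender A S) (proximity ord A S)"
proof -
  have "proximity ord A S = set (take (prox A S) (ord S))"
    unfolding proximity_def prox_def by (subst takeWhile_eq_take) (rule refl)
  then show ?thesis
    using prox_less by (simp add: target_def extender_def take_Suc_conv_app_nth)
qed

lemma target_sol: "target A S \<in> F" "target A S \<subseteq> S" "target A S \<noteq> {}" "seed F S \<in> target A S"
proof -
  show "target A S \<in> F" "target A S \<subseteq> S"
    using prefix_sol[OF SF] set_take_subset[of "Suc (prox A S)" "ord S"] set_ord[OF SF]
    by (simp_all add: target_def)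
  show "seed F S \<in> target A S"
    using prefix_seed(1)[OF SF, of "Suc (prox A S)"] by (simp add: target_def)
  then show "target A S \<noteq> {}" by blast
qed

text \<open>The set removed from \<open>A\<close> for the sake of \<open>S\<close> avoids the
  proximity, so the proximity and the extender belong to the set that is completed.\<close>

lemma neighbor_contains_target:
  "\<exists>D\<in>set (nb A (extender A S)). target A S \<subseteq> D"
proof -
  let ?w = "extender A S"
  have w: "?w \<in> U - A" using extender_in by simp
  have "canonical_extender ord A S = ?w"
    using prox_less
    unfolding canonical_extender_def extender_def prox_def
    by (subst dropWhile_eq_drop) (simp add: hd_drop_conv_nth)
  then obtain X where "X \<in> removals A ?w" and X: "X \<inter> proximity ord A S = {}"
    using removals(2)[OF A w S] AS by blast
  then have **: "(A - X) \<union> {?w} \<in> F" "cmp ((A - X) \<union> {?w}) \<in> neighbors A ?w"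
    using removals(1,3)[OF A w] by auto
  moreover have "target A S \<subseteq> cmp ((A - X) \<union> {?w})"
  proof -
    have "proximity ord A S \<subseteq> A - X"
      using X by (auto simp: proximity_def dest: set_takeWhileD)
    then show ?thesis
      using comp_maximal[OF **(1)] target_eq by auto
  qed
  ultimately show ?thesis
    using nb[OF A, of ?w] w by auto
qed

lemma hit_props: "hit A S \<noteq> 0" "hit A S \<le> length (nb A (extender A S))" "target A S \<subseteq> link A S"
  and link_in: "link A S \<in> set (nb A (extender A S))"
proof -
  obtain j where j: "j < length (nb A (extender A S))" "target A S \<subseteq> nb A (extender A S) ! j"
    using neighbor_contains_target by (metis in_set_conv_nth)
  show *: "hit A S \<noteq> 0" "target A S \<subseteq> link A S"
    using last_hit_hits[OF j(1), of "\<lambda>j. target A S \<subseteq> nb A (extender A S) ! j"] j(2)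
    by (auto simp: hit_def link_def)
  show **: "hit A S \<le> length (nb A (extender A S))"
    by (simp add: hit_def last_hit_le)
  show "link A S \<in> set (nb A (extender A S))"
    using * ** by (auto simp: link_def)
qed

lemma link_maximal: "link A S \<in> maximal F"
  using nb_maximal[OF A extender_in(3) link_in] by simp

lemma follows_position:
  assumes "follows A S"
  shows "position (ord (link A S)) (extender A S) = prox A S"
proof -
  have D: "link A S \<in> F" "link A S \<noteq> {}"
    using link_maximal maximal_sol maximal_nonempty by auto
  have "prox A S < length (ord (link A S))"
    using arg_cong[OF assms[unfolded follows_def], of length] prox_less by (simp split: if_splits
        add: min_def)
  moreover have "ord (link A S) ! prox A S = extender A S"
    using assms unfolding follows_def extender_def by (metis lessI nth_take)
  ultimately show ?thesis
    using position_nth[OF distinct_ord[OF D], of "prox A S"] by simp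
qed

text \<open>Connects walks with the search for children: what a completion step reaches is the
  candidate of the slot used by that step.\<close>

lemma follows_candidate:
  assumes "follows A S"
  shows "candidate A (extender A S) (hit A S - 1) = cmp (target A S)"
  using assms follows_position
  unfolding candidate_def link_def[symmetric] by (simp add: follows_def target_def)

text \<open>Either outcome contains the target, so the proximity gains at least the extender. An
  item whose order deviates precedes \<open>S\<close> and hence differs from it; therefore a step
  that arrives at \<open>S\<close> is a completion step.\<close>

lemma advance_props:
  shows "advance S A \<in> maximal F" "prox A S < prox (advance S A) S"
    and advance_precedes: "advance S A \<noteq> S \<Longrightarrow> precedes (advance S A) S"
    and advance_follows: "advance S A = S \<Longrightarrow> follows A S"
proof -
  have E: "advance S A \<in> maximal F" "target A S \<subseteq> advance S A"
    using link_maximal hit_props(3) comp_maximal[OF target_sol(1,3)] by (auto simp: advance_def)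
  then show "advance S A \<in> maximal F" by simp
  have "takeWhile (\<lambda>x. x \<in> advance S A) (ord S) =
      take (Suc (prox A S)) (ord S) @
      takeWhile (\<lambda>x. x \<in> advance S A) (drop (Suc (prox A S)) (ord S))"
    using E(2) unfolding target_def
    by (subst append_take_drop_id[of "Suc (prox A S)" "ord S", symmetric], subst
        takeWhile_append2) auto
  then have "prox (advance S A) S = Suc (prox A S) +
      length (takeWhile (\<lambda>x. x \<in> advance S A) (drop (Suc (prox A S)) (ord S)))"
    using prox_less by (simp add: prox_def)
  then show "prox A S < prox (advance S A) S" by simp
  have nf: "precedes (link A S) S" if "\<not> follows A S"
    using that link_maximal hit_props(3) prox_less SF maximal_sol
    unfolding target_def follows_def
    by (intro precedes_if_prefix_subset[where h = "Suc (prox A S)"]) auto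
  show "precedes (advance S A) S" if "advance S A \<noteq> S"
  proof (cases "follows A S")
    case True
    then show ?thesis
      using that comp_prefix_precedes[OF S SF(2), of "Suc (prox A S)"] prox_less
      by (simp add: advance_def target_def)
  qed (use nf in \<open>simp add: advance_def\<close>)
  show "follows A S" if "advance S A = S"
    using nf that precedes_irrefl[of S] by (auto simp: advance_def split: if_splits)
qed

end

section \<open>The walk to a solution that is not a root\<close>

context
  fixes S :: "'a set"
  assumes S: "S \<in> maximal F" and not_root: "\<not> is_root S"
begin

text \<open>The proximity is at least 1 at the start, which contains the seed, and grows with every
  step; the resulting \<open>k < prox (walk S k) S\<close> bounds the number of steps by the size of
  \<open>S\<close>.\<close>

lemma walk_props:
  "(\<forall>j<k. advance S (walk S j) \<noteq> S) \<Longrightarrow>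
   walk S k \<in> maximal F \<and> walk S k \<noteq> S \<and> precedes (walk S k) S \<and> k < prox (walk S k) S"
proof (induction k)
  case 0
  have SF: "S \<in> F" "S \<noteq> {}" using S maximal_sol maximal_nonempty by auto
  have v: "{seed F S} \<in> F" "seed F S \<in> Z" using seed_in[OF SF] by (auto simp: singletons_def)
  \<comment> \<open>The walk starts at the completion of the prefix of length 1, so
    \<open>comp_prefix_precedes\<close> covers the start as well.\<close>
  have one: "set (take 1 (ord S)) = {seed F S}"
    using ord_0[OF SF] ord_nonempty[OF SF] by (cases "ord S") auto
  have "0 < prox (walk S 0) S"
    using comp_singleton_maximal[OF v(2)] ord_0[OF SF] ord_nonempty[OF SF]
    by (cases "ord S") (auto simp: prox_def walk_def)
  moreover have "precedes (cmp {seed F S}) S"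
    using comp_prefix_precedes[OF S SF(2), of 1] not_root one ord_nonempty[OF SF]
    by (simp add: is_root_def Suc_le_eq)
  ultimately show ?case
    using comp_singleton_maximal[OF v(2)] not_root by (simp add: walk_def is_root_def)
next
  case (Suc k)
  then have IH: "walk S k \<in> maximal F" "walk S k \<noteq> S" "k < prox (walk S k) S"
    and ne: "advance S (walk S k) \<noteq> S"
    by auto
  have "walk S (Suc k) = advance S (walk S k)" by (simp add: walk_def)
  then show ?case
    using advance_props(1,2)[OF IH(1) S IH(2)] advance_precedes[OF IH(1) S IH(2) ne] IH(3) ne
    by simp
qed

lemma walk_ends: "\<exists>k. advance S (walk S k) = S"
proof (rule ccontr)
  assume "\<not> ?thesis"
  then have "length (ord S) < prox (walk S (length (ord S))) S"
    using walk_props[of "length (ord S)"] by simp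
  then show False
    using length_takeWhile_le[of "\<lambda>x. x \<in> walk S (length (ord S))" "ord S"] by (simp add: prox_def)
qed

lemma walk_length_end: "advance S (walk S (walk_length S)) = S"
  unfolding walk_length_def using walk_ends by (rule LeastI_ex)

lemma walk_length_less: "k < walk_length S \<Longrightarrow> advance S (walk S k) \<noteq> S"
  unfolding walk_length_def by (rule not_less_Least[of k "\<lambda>k. advance S (walk S k) = S"])

lemma walk_before:
  assumes "k \<le> walk_length S"
  shows "walk S k \<in> maximal F" "walk S k \<noteq> S" "precedes (walk S k) S" "k < prox (walk S k) S"
proof -
  have "\<forall>j<k. advance S (walk S j) \<noteq> S"
    using walk_length_less assms by simp
  from walk_props[OF this]
  show "walk S k \<in> maximal F" "walk S k \<noteq> S" "precedes (walk S k) S" "k < prox (walk S k) S"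
    by simp_all
qed

lemma walk_length_card: "walk_length S < card S"
proof -
  have "walk_length S < prox (walk S (walk_length S)) S"
    by (rule walk_before) simp
  also have "\<dots> \<le> length (ord S)"
    by (simp add: prox_def length_takeWhile_le)
  finally show ?thesis
    using length_ord S maximal_sol maximal_nonempty by simp
qed

lemma parent_props: "parent S \<in> maximal F" "parent S \<noteq> S" "precedes (parent S) S"
  using walk_before[of "walk_length S"] by (auto simp: parent_def)

lemma parent_advance: "advance S (parent S) = S"
  using walk_length_end by (simp add: parent_def)

lemma parent_candidate: "candidate (parent S) (extender (parent S) S) (hit (parent S) S - 1) = S"
proof -
  have f: "follows (parent S) S"
    by (rule advance_follows[OF parent_props(1) S parent_props(2) parent_advance])
  have "candidate (parent S) (extender (parent S) S) (hit (parent S) S - 1) = advance S (parent S)"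
    unfolding follows_candidate[OF parent_props(1) S parent_props(2) f] advance_def if_P[OF f] ..
  then show ?thesis
    unfolding parent_advance .
qed

end

section \<open>The forest formed by the parents\<close>

definition edges :: "('a set \<times> 'a set) set" where
  "edges = {(parent S, S) | S. S \<in> maximal F \<and> \<not> is_root S}"

definition descendants :: "'a set \<Rightarrow> 'a set set" where
  "descendants S = {X. (S, X) \<in> edges\<^sup>*}"

lemma edge_precedes: "(P, S) \<in> edges \<Longrightarrow> P \<in> maximal F \<and> S \<in> maximal F \<and> precedes P S"
  using parent_props by (auto simp: edges_def)

lemma edges_trancl_precedes: "(P, S) \<in> edges\<^sup>+ \<Longrightarrow> precedes P S"
  by (induction rule: trancl_induct) (use edge_precedes precedes_trans in blast)+

lemma edges_unique: "(P, S) \<in> edges \<Longrightarrow> (P', S) \<in> edges \<Longrightarrow> P = P'"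
  by (auto simp: edges_def)

lemma common_descendant:
  assumes "(Y, X) \<in> edges\<^sup>*" "(Y', X) \<in> edges\<^sup>*"
  shows "(Y, Y') \<in> edges\<^sup>* \<or> (Y', Y) \<in> edges\<^sup>*"
proof -
  have "single_valued (edges\<inverse>)"
    unfolding single_valued_def using edges_unique by blast
  from single_valued_confluent[OF this, of X Y Y'] show ?thesis
    using assms by (auto simp: rtrancl_converse)
qed

lemma descendants_unfold: "descendants P = insert P (\<Union>(descendants ` {S. (P, S) \<in> edges}))"
  unfolding descendants_def by (blast intro: converse_rtrancl_into_rtrancl elim: converse_rtranclE)

lemma not_descendant_of_child: "(P, S) \<in> edges \<Longrightarrow> P \<notin> descendants S"
proof
  assume "(P, S) \<in> edges" "P \<in> descendants S"
  then have "(P, P) \<in> edges\<^sup>+"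
    by (auto simp: descendants_def intro: rtrancl_into_trancl2)
  then show False using edges_trancl_precedes precedes_irrefl by blast
qed

text \<open>Two ancestors of one node are comparable, so overlapping subtrees would put one sibling
  \<open>Y\<close> above another. The path between them enters the second sibling through the common
  parent \<open>P\<close>, which would then be a descendant of its child \<open>Y\<close>.\<close>

lemma siblings_disjoint:
  assumes "(P, S) \<in> edges" "(P, S') \<in> edges" "S \<noteq> S'"
  shows "descendants S \<inter> descendants S' = {}"
proof -
  have "False" if Y: "(Y, Y') \<in> edges\<^sup>*" "(P, Y) \<in> edges" "(P, Y') \<in> edges" "Y \<noteq> Y'" for Y Y'
  proof -
    obtain Q where "(Y, Q) \<in> edges\<^sup>*" "(Q, Y') \<in> edges"
      using Y(1) by (cases rule: rtranclE) (use Y(4) in auto)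
    then have "(Y, P) \<in> edges\<^sup>*"
      using Y(3) edges_unique by blast
    then show False
      using not_descendant_of_child[OF Y(2)] by (simp add: descendants_def)
  qed
  then show ?thesis
    using common_descendant assms unfolding descendants_def by blast
qed

lemma roots_disjoint:
  assumes "is_root S" "is_root S'" "S \<noteq> S'"
  shows "descendants S \<inter> descendants S' = {}"
proof -
  have "Y = Y'" if "(Y, Y') \<in> edges\<^sup>*" "is_root Y'" for Y Y'
    using that(1) by (cases rule: rtranclE) (use that(2) in \<open>auto simp: edges_def\<close>)
  then show ?thesis
    using common_descendant assms unfolding descendants_def by blast
qed

lemma descendants_maximal: "S \<in> maximal F \<Longrightarrow> descendants S \<subseteq> maximal F"
  unfolding descendants_def by (blast elim: rtranclE dest: edge_precedes)

text \<open>The decreasing measure for the induction over subtrees in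
  \<open>explored_node\<close>.\<close>

lemma successors_decrease:
  assumes "(P, S) \<in> edges"
  shows "card {X \<in> maximal F. precedes S X} < card {X \<in> maximal F. precedes P X}"
proof (rule psubset_card_mono)
  show "finite {X \<in> maximal F. precedes P X}"
    by (rule finite_subset[OF _ finite_F]) (auto simp: maximal_def)
  show "{X \<in> maximal F. precedes S X} \<subset> {X \<in> maximal F. precedes P X}"
    using edge_precedes[OF assms] precedes_trans precedes_irrefl by blast
qed

lemma roots_cover: "\<Union>(descendants ` {S \<in> maximal F. is_root S}) = maximal F"
proof
  show "\<Union>(descendants ` {S \<in> maximal F. is_root S}) \<subseteq> maximal F"
    using descendants_maximal by blast
  have "\<exists>R\<in>maximal F. is_root R \<and> (R, S) \<in> edges\<^sup>*" if "S \<in> maximal F" for S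
    using that
  \<comment> \<open>Upwards the number of predecessors decreases, so the chain of parents ends in a
    root.\<close>
  proof (induction "card {X \<in> maximal F. precedes X S}" arbitrary: S rule: less_induct)
    case less
    show ?case
    proof (cases "is_root S")
      case False
      then have e: "(parent S, S) \<in> edges" using less by (auto simp: edges_def)
      have "card {X \<in> maximal F. precedes X (parent S)} < card {X \<in> maximal F. precedes X S}"
      proof (rule psubset_card_mono)
        show "finite {X \<in> maximal F. precedes X S}"
          by (rule finite_subset[OF _ finite_F]) (auto simp: maximal_def)
        show "{X \<in> maximal F. precedes X (parent S)} \<subset> {X \<in> maximal F. precedes X S}"
          using edge_precedes[OF e] precedes_trans precedes_irrefl by blast
      qed
      then show ?thesis
        using less edge_precedes[OF e] e by (meson rtrancl.rtrancl_into_rtrancl)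
    qed (use less in blast)
  qed
  then show "maximal F \<subseteq> \<Union>(descendants ` {S \<in> maximal F. is_root S})"
    by (fastforce simp: descendants_def)
qed

end

section \<open>Cost semantics on arrays\<close>

fun elapsed :: "event list \<Rightarrow> nat" where
  "elapsed [] = 0"
| "elapsed (Tick t # es) = t + elapsed es"
| "elapsed (Emit xs # es) = elapsed es"

lemma elapsed_append [simp]: "elapsed (es @ fs) = elapsed es + elapsed fs"
  by (induction es rule: elapsed.induct) auto

lemma outputs_append [simp]: "outputs (es @ fs) = outputs es @ outputs fs"
  by (induction es rule: outputs.induct) auto

text \<open>Amortisation: time is paid from a credit, which every output resets to \<open>G\<close>. The run starts
  with credit \<open>a\<close> and ends with at least \<open>b\<close>.\<close>

fun paid :: "nat \<Rightarrow> nat \<Rightarrow> event list \<Rightarrow> nat \<Rightarrow> bool" where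
  "paid G a [] b \<longleftrightarrow> b \<le> a"
| "paid G a (Tick t # es) b \<longleftrightarrow> t \<le> a \<and> paid G (a - t) es b"
| "paid G a (Emit xs # es) b \<longleftrightarrow> paid G G es b"

lemma paid_mono: "paid G a es b \<Longrightarrow> a \<le> a' \<Longrightarrow> b' \<le> b \<Longrightarrow> paid G a' es b'"
  by (induction G a es b arbitrary: a' rule: paid.induct) (auto simp: diff_le_mono)

lemma paid_append: "paid G a es b \<Longrightarrow> paid G b fs c \<Longrightarrow> paid G a (es @ fs) c"
  by (induction G a es b rule: paid.induct) (auto intro: paid_mono)

lemma paid_silent: "outputs es = [] \<Longrightarrow> elapsed es + b \<le> a \<Longrightarrow> paid G a es b"
  by (induction G a es b rule: paid.induct) auto

lemma gaps_nonempty: "gaps es \<noteq> []"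
  by (induction es rule: gaps.induct) auto

text \<open>The time before the first output comes out of the initial credit \<open>a\<close>, every
  later gap out of a fresh credit \<open>G\<close>.\<close>

lemma paid_gaps: "paid G a es b \<Longrightarrow> a \<le> G \<Longrightarrow> hd (gaps es) \<le> a \<and> (\<forall>g\<in>set (gaps es). g \<le> G)"
proof (induction G a es b rule: paid.induct)
  case (2 G a t es b)
  then have "t \<le> a" "hd (gaps es) \<le> a - t" "\<forall>g\<in>set (gaps es). g \<le> G" by auto
  then show ?case
    using gaps_nonempty[of es] \<open>a \<le> G\<close> by (cases "gaps es") auto
qed auto

lemma paid_delay: "paid G G es b \<Longrightarrow> delay es \<le> G"
  using paid_gaps[of G G es b] gaps_nonempty[of es] by (auto simp: delay_def)

section \<open>Arrays and lists in memory\<close>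

definition array :: "nat list \<Rightarrow> nat \<Rightarrow> nat" where
  "array xs i = (if i = 0 then length xs else if i \<le> length xs then xs ! (i - 1) else 0)"

lemma array_0 [simp]: "array xs 0 = length xs"
  by (simp add: array_def)

lemma array_Suc [simp]: "i < length xs \<Longrightarrow> array xs (Suc i) = xs ! i"
  by (simp add: array_def)

abbreviation seq_com :: "com \<Rightarrow> com \<Rightarrow> com" (infixl ";;" 60) where
  "c ;; d \<equiv> Seq c d"

definition Arr :: "nat \<Rightarrow> expr \<Rightarrow> expr" where
  "Arr k e = Mem (Plus (Reg k) e)"

lemma cost_Arr [simp]: "cost (Arr k e) = cost e + 3"
  by (simp add: Arr_def)

definition Push :: "nat \<Rightarrow> expr \<Rightarrow> com" where
  "Push k e = Seq (SetMem (Plus (Reg k) (Plus (Arr k (Num 0)) (Num 1))) e)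
                  (SetMem (Reg k) (Plus (Arr k (Num 0)) (Num 1)))"

definition Clear :: "nat \<Rightarrow> com" where
  "Clear k = Loop (Arr k (Num 0))
     (Seq (SetMem (Plus (Reg k) (Arr k (Num 0))) (Num 0))
          (SetMem (Reg k) (Minus (Arr k (Num 0)) (Num 1))))"

text \<open>Truncated subtraction serves as the test \<open>i < e\<close>. The counter ends at 0, so
  it does not show in the final state.\<close>

definition For :: "nat \<Rightarrow> expr \<Rightarrow> com \<Rightarrow> com" where
  "For i e c = Seq (SetReg i (Num 0)) (Seq
     (Loop (Minus e (Reg i)) (Seq c (SetReg i (Plus (Reg i) (Num 1)))))
     (SetReg i (Num 0)))"

text \<open>The memory is divided into arrays, array \<open>k\<close> starting at address \<open>k * (n + 2)\<close>, which is
  held in register \<open>k\<close>. Arrays 0 to 2 are characteristic vectors, array 0 being the input;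
  arrays 3 to 12 store lists, and only the last one is not limited to \<open>n + 2\<close> words. Cells that
  are not used by a list are kept at 0, so a state is given by its variables, lists and sets.\<close>

type_synonym store = "(nat \<Rightarrow> nat) \<times> (nat \<Rightarrow> nat list) \<times> (nat \<Rightarrow> nat set)"

locale machine =
  fixes sub :: subroutines and n W :: nat
  assumes W: "n + 2 \<le> W"
begin

text \<open>One cell for the length and \<open>n + 1\<close> for entries: the longest argument is an
  element followed by a solution.\<close>

definition L :: nat where "L = n + 2"

lemma L_pos [simp]: "0 < L"
  by (simp add: L_def)

text \<open>The arrays 0 to 11 occupy \<open>12 * L\<close> cells, the last one at most
  \<open>W + 1\<close>. The same number bounds the array bases, which are at most
  \<open>12 * L\<close>, and all values, which are at most \<open>W\<close>.\<close>

definition B :: nat where "B = 12 * L + W + 2"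

text \<open>Cells are arbitrary here, because after the first write of \<open>Push\<close> the new
  entry lies beyond the recorded length and the memory represents no list.\<close>

definition raw :: "(nat \<Rightarrow> nat) \<Rightarrow> (nat \<Rightarrow> nat \<Rightarrow> nat) \<Rightarrow> state" where
  "raw v M = (\<lambda>r. if r = 0 then n else if r \<le> 12 then r * L else v r,
              \<lambda>a. if a < 12 * L then M (a div L) (a mod L)
                  else M 12 (a - 12 * L))"

fun cells :: "(nat \<Rightarrow> nat list) \<Rightarrow> (nat \<Rightarrow> nat set) \<Rightarrow> nat \<Rightarrow> nat \<Rightarrow> nat" where
  "cells N X k i = (if k < 3 then (if i \<in> X k then 1 else 0) else array (N k) i)"

declare cells.simps [simp del]

fun conc :: "store \<Rightarrow> state" where
  "conc (v, N, X) = raw v (cells N X)"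

declare conc.simps [simp del]

fun ok :: "store \<Rightarrow> bool" where
  "ok (v, N, X) \<longleftrightarrow> (\<forall>r. v r \<le> W) \<and> (\<forall>k\<in>{3..<12}. length (N k) \<le> n + 1) \<and> length (N 12) \<le> W \<and>
     (\<forall>k\<in>{3..12}. \<forall>x\<in>set (N k). x \<le> W)"

declare ok.simps [simp del]

definition tame :: "(nat \<Rightarrow> nat) \<Rightarrow> (nat \<Rightarrow> nat \<Rightarrow> nat) \<Rightarrow> bool" where
  "tame v M \<longleftrightarrow> (\<forall>r. v r \<le> W) \<and> (\<forall>k\<le>12. \<forall>i. M k i \<le> W) \<and> (\<forall>i. M 12 i \<noteq> 0 \<longrightarrow> i \<le> W)"

lemma tame_fits: "tame v M \<Longrightarrow> fits B (raw v M)"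
proof -
  assume t: "tame v M"
  have "fst (raw v M) r \<le> B" for r
  proof -
    have "r * L \<le> Suc (Suc (12 * L + W))" if "r \<le> 12"
      using mult_le_mono1[OF that, of L] by linarith
    then show ?thesis
      using t W unfolding raw_def B_def tame_def by (auto intro: le_trans[of _ W] trans_le_add1)
  qed
  moreover have "a < B \<and> snd (raw v M) a \<le> B" if nz: "snd (raw v M) a \<noteq> 0" for a
  proof (cases "a < 12 * L")
    case True
    then have "a div L \<le> 12"
      by (metis less_imp_le less_mult_imp_div_less)
    then show ?thesis
      using True t unfolding raw_def B_def tame_def by (auto intro: le_trans[of _ W] trans_le_add2)
  next
    case False
    then have "a - 12 * L \<le> W" "M 12 (a - 12 * L) \<le> W"
      using nz t unfolding raw_def tame_def by auto
    then show ?thesis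
      using False by (auto simp: raw_def B_def)
  qed
  ultimately show ?thesis
    by (simp add: fits_def)
qed

lemma array_le: "length xs \<le> W \<Longrightarrow> \<forall>x\<in>set xs. x \<le> W \<Longrightarrow> array xs i \<le> W"
  by (auto simp: array_def)

lemma ok_length: "ok (v, N, X) \<Longrightarrow> 3 \<le> k \<Longrightarrow> k < 12 \<Longrightarrow> length (N k) \<le> n + 1"
  and ok_last: "ok (v, N, X) \<Longrightarrow> length (N 12) \<le> W"
  and ok_entry: "ok (v, N, X) \<Longrightarrow> 3 \<le> k \<Longrightarrow> k \<le> 12 \<Longrightarrow> \<forall>x\<in>set (N k). x \<le> W"
  by (auto simp: ok.simps)

lemma ok_length_le: "ok (v, N, X) \<Longrightarrow> 3 \<le> k \<Longrightarrow> k \<le> 12 \<Longrightarrow> length (N k) \<le> W"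
  using ok_length[of v N X k] ok_last[of v N X] W by (cases "k = 12") auto

lemma ok_tame: "ok (v, N, X) \<Longrightarrow> tame v (cells N X)"
proof -
  assume o: "ok (v, N, X)"
  have "cells N X k i \<le> W" if "k \<le> 12" for k i
    using array_le[OF ok_length_le[OF o] ok_entry[OF o], of k i] that W by (auto simp: cells.simps)
  moreover have "i \<le> W" if "cells N X 12 i \<noteq> 0" for i
    using that ok_last[OF o] by (auto simp: cells.simps array_def split: if_splits)
  ultimately show ?thesis
    using o by (simp add: tame_def ok.simps)
qed

lemma ok_fits: "ok \<sigma> \<Longrightarrow> fits B (conc \<sigma>)"
  by (cases \<sigma>) (auto simp: conc.simps intro: tame_fits ok_tame)

lemma raw_var: "12 < r \<Longrightarrow> fst (raw v M) r = v r" "fst (raw v M) 0 = n"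
  "1 \<le> k \<Longrightarrow> k \<le> 12 \<Longrightarrow> fst (raw v M) k = k * L"
  by (auto simp: raw_def)

lemma address_div: "i < L \<Longrightarrow> (k * L + i) div L = k" "i < L \<Longrightarrow> (k * L + i) mod L = i"
  by auto

lemma address_less: "k < 12 \<Longrightarrow> i < L \<Longrightarrow> k * L + i < 12 * L"
proof -
  assume "k < 12" "i < L"
  then have "k * L + i < Suc k * L" by simp
  also have "\<dots> \<le> 12 * L" using \<open>k < 12\<close> by (intro mult_le_mono1) simp
  finally show ?thesis .
qed

lemma raw_mem:
  assumes "k \<le> 12" "i < L \<or> k = 12"
  shows "snd (raw v M) (k * L + i) = M k i"
proof (cases "k = 12")
  case False
  then show ?thesis
    using address_less[of k i] address_div[of i k] assms by (simp add: raw_def)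
qed (simp add: raw_def)

lemma raw_reg_upd: "12 < r \<Longrightarrow> ((fst (raw v M))(r := x), snd (raw v M)) = raw (v(r := x)) M"
  by (auto simp: raw_def)

lemma raw_mem_upd:
  assumes "k \<le> 12" "i < L \<or> k = 12"
  shows "(fst (raw v M), (snd (raw v M))(k * L + i := x)) = raw v (M(k := (M k)(i := x)))"
proof -
  have "((snd (raw v M))(k * L + i := x)) a = snd (raw v (M(k := (M k)(i := x)))) a" for a
  proof (cases "a < 12 * L")
    case True
    then have "a div L < 12" by (metis less_mult_imp_div_less)
    moreover have "a = k * L + i \<longleftrightarrow> a div L = k \<and> a mod L = i" if "k \<noteq> 12"
      using that assms address_div[of i k] by (metis div_mult_mod_eq)
    ultimately show ?thesis
      using True by (cases "k = 12") (auto simp: raw_def)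
  next
    case False
    then show ?thesis
      using address_less[of k i] assms by (cases "k = 12") (auto simp: raw_def)
  qed
  then show ?thesis by (auto simp: raw_def)
qed

text \<open>The array must be empty beforehand, since \<open>write_list\<close> leaves the cells
  behind the new list alone and these have to be 0. The induction writes the list entry by entry,
  which reduces it to updates of single cells.\<close>

lemma write_list_raw:
  assumes "k \<le> 12" "length xs < L \<or> k = 12" "M k = array []"
  shows "(fst (raw v M), write_list (snd (raw v M)) (k * L) xs) = raw v (M(k := array xs))"
proof -
  have "i \<le> length xs \<Longrightarrow>
    write_list (snd (raw v M)) (k * L) (take i xs) = (snd (raw v (M(k := array (take i xs)))))"
        for i
  proof (induction i)
    case 0
    have "write_list (snd (raw v M)) (k * L) [] = (snd (raw v M))(k * L := 0)"
      by (auto simp: write_list_def fun_eq_iff)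
    also have "\<dots> = snd (raw v (M(k := (M k)(0 := 0))))"
      using raw_mem_upd[of k 0 v M 0] assms by (simp add: prod_eq_iff)
    also have "M(k := (M k)(0 := 0)) = M(k := array [])"
      using assms(3) by (auto simp: fun_eq_iff array_def)
    finally show ?case by simp
  next
    case (Suc i)
    have *: "write_list m a (ys @ [y]) = (write_list m a ys)(a + Suc (length ys) := y, a + 0 :=
        Suc (length ys))"
      for m :: "nat \<Rightarrow> nat" and a ys y
      by (auto simp: write_list_def fun_eq_iff nth_append)
    have l: "Suc i < L \<or> k = 12" "0 < L \<or> k = 12"
      using Suc.prems assms(2) by auto
    let ?y = "xs ! i" and ?ys = "take i xs"
    let ?M = "M(k := array ?ys)"
    let ?M1 = "?M(k := (?M k)(Suc i := ?y))"
    have len: "length ?ys = i" and app: "take (Suc i) xs = ?ys @ [?y]"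
      using Suc.prems by (simp_all add: take_Suc_conv_app_nth)
    have "write_list (snd (raw v M)) (k * L) (?ys @ [?y]) =
        (snd (raw v ?M))(k * L + Suc i := ?y, k * L + 0 := Suc i)"
      unfolding * len Suc.IH[OF Suc_leD[OF Suc.prems]] ..
    also have "\<dots> = snd (raw v (?M1(k := (?M1 k)(0 := Suc i))))"
      using raw_mem_upd[OF assms(1) l(1), of v ?M ?y] raw_mem_upd[OF assms(1) l(2), of v ?M1 "Suc
          i"]
      by (simp only: prod_eq_iff fst_conv snd_conv)
    also have "?M1(k := (?M1 k)(0 := Suc i)) = M(k := array (?ys @ [?y]))"
      using Suc.prems by (auto simp: fun_eq_iff array_def nth_append min_def)
    finally show ?case unfolding app .
  qed
  from this[of "length xs"] show ?thesis by (simp add: prod_eq_iff) (simp add: raw_def)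
qed

lemma read_list_raw:
  assumes "k \<le> 12" "length xs < L \<or> k = 12" "M k = array xs"
  shows "read_list (snd (raw v M)) (k * L) = xs"
proof -
  have *: "snd (raw v M) (k * L + 1 + i) = xs ! i" if "i < length xs" for i
  proof -
    have "snd (raw v M) (k * L + Suc i) = M k (Suc i)"
      using assms(1,2) that by (intro raw_mem) auto
    then show ?thesis
      using that by (simp add: assms(3))
  qed
  have **: "snd (raw v M) (k * L) = length xs"
    using raw_mem[of k 0 v M] assms(1) by (simp add: assms(3))
  have "map (\<lambda>i. snd (raw v M) (k * L + 1 + i)) [0..<length xs] = map (\<lambda>i. xs ! i) [0..<length xs]"
    by (intro map_cong refl *) simp
  then show ?thesis
    unfolding read_list_def ** map_nth .
qed

section \<open>Rules for commands without output\<close>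

definition exe :: "com \<Rightarrow> store \<Rightarrow> nat \<Rightarrow> store \<Rightarrow> bool" where
  "exe c \<sigma> t \<sigma>' \<longleftrightarrow> (ok \<sigma> \<longrightarrow> ok \<sigma>' \<and>
     (\<exists>es. exec sub B c (conc \<sigma>) es (conc \<sigma>') \<and> outputs es = [] \<and> elapsed es \<le> t))"

lemma eval_var [simp]: "12 < r \<Longrightarrow> eval (Reg r) (conc (v, N, X)) = v r"
  "eval (Reg 0) (conc (v, N, X)) = n"
  by (auto simp: conc.simps raw_var)

lemma eval_list [simp]:
  assumes "3 \<le> k" "k < 12" "eval e (conc (v, N, X)) < n + 2"
  shows "eval (Arr k e) (conc (v, N, X)) = array (N k) (eval e (conc (v, N, X)))"
  using assms raw_mem[of k "eval e (conc (v, N, X))" v "cells N X"]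
  by (simp add: Arr_def conc.simps raw_var cells.simps L_def)

lemma eval_last [simp]:
  "eval (Arr 12 e) (conc (v, N, X)) = array (N 12) (eval e (conc (v, N, X)))"
  using raw_mem[of 12 "eval e (conc (v, N, X))" v "cells N X"]
  by (simp add: Arr_def conc.simps raw_var cells.simps L_def)

lemma eval_mark [simp]:
  assumes "1 \<le> k" "k < 3" "eval e (conc (v, N, X)) < n + 2"
  shows "eval (Arr k e) (conc (v, N, X)) = (if eval e (conc (v, N, X)) \<in> X k then 1 else 0)"
  using assms raw_mem[of k "eval e (conc (v, N, X))" v "cells N X"]
  by (simp add: Arr_def conc.simps raw_var cells.simps L_def)

lemma eval_input:
  assumes "eval e (conc (v, N, X)) < n + 2"
  shows "eval (Mem e) (conc (v, N, X)) = (if eval e (conc (v, N, X)) \<in> X 0 then 1 else 0)"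
  using assms raw_mem[of 0 "eval e (conc (v, N, X))" v "cells N X"]
  by (simp add: conc.simps cells.simps L_def)

declare eval.simps(2,3) [simp del]

lemma exe_conv: "exe c \<sigma> t \<tau> \<Longrightarrow> \<tau> = \<sigma>' \<Longrightarrow> t \<le> t' \<Longrightarrow> exe c \<sigma> t' \<sigma>'"
  unfolding exe_def by fastforce

lemma exe_Skip: "exe Skip \<sigma> 0 \<sigma>"
  unfolding exe_def by (force intro: exec.Skip ok_fits)

lemma exe_Seq [trans]: "exe c1 \<sigma> t1 \<tau> \<Longrightarrow> exe c2 \<tau> t2 \<sigma>' \<Longrightarrow> exe (Seq c1 c2) \<sigma> (t1 + t2) \<sigma>'"
proof -
  assume 1: "exe c1 \<sigma> t1 \<tau>" and 2: "exe c2 \<tau> t2 \<sigma>'"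
  show ?thesis
    unfolding exe_def
  proof (intro impI)
    assume "ok \<sigma>"
    with 1 2 obtain es fs where "exec sub B c1 (conc \<sigma>) es (conc \<tau>)" "outputs es = []" "elapsed es
        \<le> t1"
      "exec sub B c2 (conc \<tau>) fs (conc \<sigma>')" "outputs fs = []" "elapsed fs \<le> t2" "ok \<sigma>'"
      unfolding exe_def by blast
    then show "ok \<sigma>' \<and> (\<exists>es. exec sub B (Seq c1 c2) (conc \<sigma>) es (conc \<sigma>') \<and>
        outputs es = [] \<and> elapsed es \<le> t1 + t2)"
      by (intro conjI exI[of _ "es @ fs"]) (auto intro: exec.Seq)
  qed
qed

lemma exe_Cond:
  assumes "eval e (conc \<sigma>) \<noteq> 0 \<Longrightarrow> exe c1 \<sigma> t \<sigma>'" "eval e (conc \<sigma>) = 0 \<Longrightarrow> exe c2 \<sigma> t \<sigma>'"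
  shows "exe (Cond e c1 c2) \<sigma> (1 + cost e + t) \<sigma>'"
  unfolding exe_def
proof (intro impI)
  assume o: "ok \<sigma>"
  show "ok \<sigma>' \<and> (\<exists>es. exec sub B (Cond e c1 c2) (conc \<sigma>) es (conc \<sigma>') \<and>
        outputs es = [] \<and> elapsed es \<le> 1 + cost e + t)"
  proof (cases "eval e (conc \<sigma>) = 0")
    case True
    then obtain es where "ok \<sigma>'" "exec sub B c2 (conc \<sigma>) es (conc \<sigma>')" "outputs es = []" "elapsed
        es \<le> t"
      using assms(2) o unfolding exe_def by blast
    then show ?thesis using True
      by (intro conjI exI[of _ "Tick (1 + cost e) # es"] exec.CondFalse) auto
  next
    case False
    then obtain es where "ok \<sigma>'" "exec sub B c1 (conc \<sigma>) es (conc \<sigma>')" "outputs es = []" "elapsed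
        es \<le> t"
      using assms(1) o unfolding exe_def by blast
    then show ?thesis using False
      by (intro conjI exI[of _ "Tick (1 + cost e) # es"] exec.CondTrue) auto
  qed
qed

lemma exe_SetReg:
  assumes "12 < r" "eval e (conc (v, N, X)) \<le> W"
  shows "exe (SetReg r e) (v, N, X) (1 + cost e) (v(r := eval e (conc (v, N, X))), N, X)"
  unfolding exe_def
proof (intro impI conjI)
  let ?x = "eval e (conc (v, N, X))"
  assume o: "ok (v, N, X)"
  then show o': "ok (v(r := ?x), N, X)"
    using assms(2) by (auto simp: ok.simps)
  have "exec sub B (SetReg r e) (conc (v, N, X)) [Tick (1 + cost e)] (conc (v(r := ?x), N, X))"
    using ok_fits[OF o] ok_fits[OF o'] raw_reg_upd[OF assms(1)]
    by (intro exec.SetReg) (auto simp: conc.simps)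
  then show "\<exists>es. exec sub B (SetReg r e) (conc (v, N, X)) es (conc (v(r := ?x), N, X)) \<and>
      outputs es = [] \<and> elapsed es \<le> 1 + cost e"
    by fastforce
qed

lemma exec_SetMem_raw:
  assumes "tame v M" "k \<le> 12" "i < L \<or> k = 12" "i \<le> W \<or> x = 0" "x \<le> W"
    "eval a (raw v M) = k * L + i" "eval e (raw v M) = x"
  shows "exec sub B (SetMem a e) (raw v M) [Tick (1 + cost a + cost e)] (raw v (M(k := (M k)(i :=
      x))))"
    "tame v (M(k := (M k)(i := x)))"
proof -
  show "tame v (M(k := (M k)(i := x)))"
    using assms unfolding tame_def by auto
  then show "exec sub B (SetMem a e) (raw v M) [Tick (1 + cost a + cost e)] (raw v (M(k := (M k)(i
      := x))))"
    using raw_mem_upd[OF assms(2,3), of v M x] assms(1,6,7)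
    by (intro exec.SetMem tame_fits) auto
qed

lemma exe_Mark:
  assumes "1 \<le> k" "k < 3" "eval e (conc (v, N, X)) = x" "x < n"
  shows "exe (SetMem (Plus (Reg k) e) (Num 1)) (v, N, X) (4 + cost e) (v, N, X(k := insert x (X
      k)))"
    and exe_Unmark: "exe (SetMem (Plus (Reg k) e) (Num 0)) (v, N, X) (4 + cost e) (v, N, X(k := X
        k - {x}))"
proof -
  have *: "eval (Plus (Reg k) e) (raw v (cells N X)) = k * L + x"
    using assms by (simp add: eval.simps conc.simps raw_var)
  have 1: "(cells N X)(k := (cells N X k)(x := 1)) = cells N (X(k := insert x (X k)))"
    and 0: "(cells N X)(k := (cells N X k)(x := 0)) = cells N (X(k := X k - {x}))"
    using assms by (auto simp: fun_eq_iff cells.simps)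
  show "exe (SetMem (Plus (Reg k) e) (Num 1)) (v, N, X) (4 + cost e) (v, N, X(k := insert x (X k)))"
    unfolding exe_def
  proof (intro impI conjI)
    assume o: "ok (v, N, X)"
    then show "ok (v, N, X(k := insert x (X k)))" by (simp add: ok.simps)
    show "\<exists>es. exec sub B (SetMem (Plus (Reg k) e) (Num 1)) (conc (v, N, X)) es
        (conc (v, N, X(k := insert x (X k)))) \<and> outputs es = [] \<and> elapsed es \<le> 4 + cost e"
      using exec_SetMem_raw(1)[OF ok_tame[OF o] _ _ _ _ *, of 1 "Num 1"] assms W
      unfolding 1 conc.simps
      by (intro exI[of _ "[Tick (1 + cost (Plus (Reg k) e) + cost (Num 1))]"]) (simp add: L_def)
  qed
  show "exe (SetMem (Plus (Reg k) e) (Num 0)) (v, N, X) (4 + cost e) (v, N, X(k := X k - {x}))"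
    unfolding exe_def
  proof (intro impI conjI)
    assume o: "ok (v, N, X)"
    then show "ok (v, N, X(k := X k - {x}))" by (simp add: ok.simps)
    show "\<exists>es. exec sub B (SetMem (Plus (Reg k) e) (Num 0)) (conc (v, N, X)) es
        (conc (v, N, X(k := X k - {x}))) \<and> outputs es = [] \<and> elapsed es \<le> 4 + cost e"
      using exec_SetMem_raw(1)[OF ok_tame[OF o] _ _ _ _ *, of 0 "Num 0"] assms W
      unfolding 0 conc.simps
      by (intro exI[of _ "[Tick (1 + cost (Plus (Reg k) e) + cost (Num 0))]"]) (simp add: L_def)
  qed
qed

lemma exe_Push:
  assumes k: "3 \<le> k" "k < 12" and x: "eval e (conc (v, N, X)) = x" "x \<le> W" and l: "length (N k) \<le> n"
  shows "exe (Push k e) (v, N, X) (20 + cost e) (v, N(k := N k @ [x]), X)"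
  unfolding exe_def
proof (intro impI conjI)
  assume o: "ok (v, N, X)"
  then show "ok (v, N(k := N k @ [x]), X)"
    using assms by (auto simp: ok.simps)
  let ?m = "length (N k)" and ?M = "cells N X"
  let ?M1 = "?M(k := (?M k)(Suc ?m := x))"
  have Mk: "?M k = array (N k)"
    using k by (auto simp: cells.simps)
  have 1: "eval (Plus (Reg k) (Plus (Arr k (Num 0)) (Num 1))) (raw v ?M) = k * L + Suc ?m"
    using k raw_mem[of k 0 v ?M] by (simp add: Arr_def eval.simps raw_var Mk)
  note s1 = exec_SetMem_raw[OF ok_tame[OF o] _ _ _ x(2) 1 x(1)[unfolded conc.simps]]
  have 2: "eval (Reg k) (raw v ?M1) = k * L + 0"
    using k by (simp add: eval.simps raw_var)
  have 3: "eval (Plus (Arr k (Num 0)) (Num 1)) (raw v ?M1) = Suc ?m"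
    using k raw_mem[of k 0 v ?M1] by (simp add: Arr_def eval.simps raw_var Mk)
  have t: "tame v ?M1" using s1(2) k l W by (simp add: L_def)
  have "?M1(k := (?M1 k)(0 := Suc ?m)) = cells (N(k := N k @ [x])) X"
    using k by (auto simp: fun_eq_iff cells.simps array_def nth_append)
  then have "exec sub B (Push k e) (raw v ?M) ([Tick (1 + 8 + cost e)] @ [Tick (1 + 1 + 6)])
      (raw v (cells (N(k := N k @ [x])) X))"
    using exec.Seq[OF s1(1) exec_SetMem_raw(1)[OF t _ _ _ _ 2 3]] k l W
    by (simp add: Push_def L_def)
  then show "\<exists>es. exec sub B (Push k e) (conc (v, N, X)) es (conc (v, N(k := N k @ [x]), X)) \<and>
      outputs es = [] \<and> elapsed es \<le> 20 + cost e"
    unfolding conc.simps by fastforce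
qed

lemma exe_Clear:
  assumes k: "3 \<le> k" "k \<le> 12"
  shows "exe (Clear k) (v, N, X) (30 * length (N k) + 5) (v, N(k := []), X)"
proof (induction "N k" arbitrary: N rule: rev_induct)
  case Nil
  then have *: "N(k := []) = N" by auto
  have z: "eval (Arr k (Num 0)) (conc (v, N, X)) = 0"
    using k raw_mem[of k 0 v "cells N X"] Nil
    by (simp add: Arr_def eval.simps raw_var conc.simps cells.simps)
  show ?case
    unfolding exe_def *
  proof (intro impI conjI)
    assume o: "ok (v, N, X)"
    then show "ok (v, N, X)" .
    show "\<exists>es. exec sub B (Clear k) (conc (v, N, X)) es (conc (v, N, X)) \<and> outputs es = [] \<and>
         elapsed es \<le> 30 * length (N k) + 5"
      using exec.LoopFalse[OF z ok_fits[OF o]] unfolding Clear_def by fastforce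
  qed
next
  case (snoc x xs)
  show ?case
    unfolding exe_def
  proof (intro impI conjI)
    assume o: "ok (v, N, X)"
    then show "ok (v, N(k := []), X)" by (auto simp: ok.simps)
    let ?m = "length xs" and ?M = "cells N X"
    let ?M1 = "?M(k := (?M k)(Suc ?m := 0))"
    let ?N = "N(k := xs)"
    have Mk: "?M k = array (xs @ [x])"
      using k snoc(2) by (auto simp: cells.simps)
    have sm: "Suc ?m < L \<or> k = 12"
    proof (cases "k = 12")
      case False
      then have "length (N k) \<le> n + 1" using ok_length[OF o] k by simp
      then show ?thesis by (simp add: L_def flip: snoc(2))
    qed simp
    have mW: "?m \<le> W"
    proof (cases "k = 12")
      case True
      then have "length (N k) \<le> W" using ok_length_le[OF o k] by simp
      then show ?thesis by (simp flip: snoc(2))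
    qed (use sm W in \<open>simp add: L_def\<close>)
    have nz: "eval (Arr k (Num 0)) (conc (v, N, X)) \<noteq> 0"
      using k raw_mem[of k 0 v ?M] by (simp add: Arr_def eval.simps raw_var conc.simps Mk)
    have 1: "eval (Plus (Reg k) (Arr k (Num 0))) (raw v ?M) = k * L + Suc ?m"
      using k raw_mem[of k 0 v ?M] by (simp add: Arr_def eval.simps raw_var Mk)
    note s1 = exec_SetMem_raw[OF ok_tame[OF o] k(2) sm _ _ 1, of 0 "Num 0"]
    have 2: "eval (Reg k) (raw v ?M1) = k * L + 0"
      using k by (simp add: eval.simps raw_var)
    have 3: "eval (Minus (Arr k (Num 0)) (Num 1)) (raw v ?M1) = ?m"
      using k raw_mem[of k 0 v ?M1] by (simp add: Arr_def eval.simps raw_var Mk)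
    have t: "tame v ?M1" using s1(2) by simp
    have "?M1(k := (?M1 k)(0 := ?m)) = cells ?N X"
      using k by (auto simp: fun_eq_iff cells.simps Mk array_def nth_append snoc(2)[symmetric])
    then have s: "exec sub B (Seq (SetMem (Plus (Reg k) (Arr k (Num 0))) (Num 0))
          (SetMem (Reg k) (Minus (Arr k (Num 0)) (Num 1)))) (conc (v, N, X))
        ([Tick (1 + (1 + 4 + 1) + 1)] @ [Tick (1 + 1 + (4 + 1 + 1))]) (conc (v, ?N, X))"
      using exec.Seq[OF s1(1) exec_SetMem_raw(1)[OF t k(2) _ _ mW 2 3]]
      by (simp add: conc.simps)
    have o': "ok (v, ?N, X)"
    proof -
      have l: "length xs \<le> length (N k)" and x: "set xs \<subseteq> set (N k)"
        using snoc(2)[symmetric] by auto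
      have "length (?N j) \<le> n + 1" if "j \<in> {3..<12}" for j
        using ok_length[OF o, of j] that l by (cases "j = k") auto
      moreover have "length (?N 12) \<le> W"
        using ok_last[OF o] l by (cases "k = 12") auto
      moreover have "\<forall>x\<in>set (?N j). x \<le> W" if "j \<in> {3..12}" for j
        using ok_entry[OF o, of j] that x by (cases "j = k") auto
      moreover have "\<forall>r. v r \<le> W" using o by (simp add: ok.simps)
      ultimately show ?thesis by (simp only: ok.simps) blast
    qed
    have "exe (Clear k) (v, ?N, X) (30 * length (?N k) + 5) (v, ?N(k := []), X)"
      by (rule snoc(1)) simp
    then obtain es where es: "exec sub B (Clear k) (conc (v, ?N, X)) es (conc (v, N(k := []), X))"
      "outputs es = []" "elapsed es \<le> 30 * ?m + 5"
      using o' unfolding exe_def by auto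
    show "\<exists>es. exec sub B (Clear k) (conc (v, N, X)) es (conc (v, N(k := []), X)) \<and>
        outputs es = [] \<and> elapsed es \<le> 30 * length (N k) + 5"
      by (rule exI, rule conjI, rule exec.LoopTrue[OF nz s es(1)[unfolded Clear_def], folded
          Clear_def])
        (use es(2,3) in \<open>auto simp flip: snoc(2)\<close>)
  qed
qed

lemma exe_Call:
  assumes k: "3 \<le> k" "k < 12" and d: "3 \<le> d" "d \<le> 12" "N d = []"
    and run: "sub f (N k) = (xs, t)" "t \<le> W" "length xs \<le> n + 1 \<or> d = 12 \<and> length xs \<le> W"
    and xs: "\<forall>x\<in>set xs. x \<le> W"
  shows "exe (Call f (Reg k) (Reg d)) (v, N, X) (3 + t) (v, N(d := xs), X)"
  unfolding exe_def
proof (intro impI conjI)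
  assume o: "ok (v, N, X)"
  then show o': "ok (v, N(d := xs), X)"
    using d run xs W by (auto simp: ok.simps)
  have "length (N k) < L" using ok_length[OF o k] by (simp add: L_def)
  then have "read_list (snd (raw v (cells N X))) (k * L) = N k"
    using k by (intro read_list_raw) (auto simp: cells.simps)
  moreover have "(fst (raw v (cells N X)), write_list (snd (raw v (cells N X))) (d * L) xs) =
      raw v ((cells N X)(d := array xs))"
    using d run by (intro write_list_raw) (auto simp: cells.simps L_def)
  moreover have "(cells N X)(d := array xs) = cells (N(d := xs)) X"
    using d by (auto simp: fun_eq_iff cells.simps)
  ultimately have "exec sub B (Call f (Reg k) (Reg d)) (conc (v, N, X))
      [Tick (1 + cost (Reg k) + cost (Reg d) + t)] (conc (v, N(d := xs), X))"
    using k d run ok_fits[OF o] ok_fits[OF o']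
    by (intro exec.Call[where xs = xs]) (auto simp: conc.simps eval.simps raw_var B_def)
  then show "\<exists>es. exec sub B (Call f (Reg k) (Reg d)) (conc (v, N, X)) es
      (conc (v, N(d := xs), X)) \<and> outputs es = [] \<and> elapsed es \<le> 3 + t"
    by fastforce
qed

lemma exe_Loop:
  assumes "\<And>j. j < m \<Longrightarrow> eval e (conc (f j)) \<noteq> 0" "\<And>j. j < m \<Longrightarrow> exe c (f j) (t j) (f (Suc j))"
    "eval e (conc (f m)) = 0"
  shows "exe (Loop e c) (f 0) ((\<Sum>j<m. t j + (1 + cost e)) + (1 + cost e)) (f m)"
  using assms
proof (induction m arbitrary: f t)
  case 0
  have "ok (f 0) \<Longrightarrow> exec sub B (Loop e c) (conc (f 0)) [Tick (1 + cost e)] (conc (f 0))"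
    using 0(3) ok_fits by (intro exec.LoopFalse)
  then show ?case
    unfolding exe_def by fastforce
next
  case (Suc m)
  have IH: "exe (Loop e c) (f (Suc 0)) ((\<Sum>j<m. t (Suc j) + (1 + cost e)) + (1 + cost e)) (f (Suc
      m))"
    using Suc.prems by (intro Suc.IH[of "\<lambda>j. f (Suc j)"]) auto
  show ?case
    unfolding exe_def
  proof (intro impI)
    assume o: "ok (f 0)"
    obtain es where es: "exec sub B c (conc (f 0)) es (conc (f 1))" "outputs es = []" "elapsed es
        \<le> t 0"
      and o1: "ok (f 1)"
      using Suc.prems(2)[of 0] o unfolding exe_def by auto
    obtain fs where fs: "exec sub B (Loop e c) (conc (f 1)) fs (conc (f (Suc m)))" "outputs fs = []"
      "elapsed fs \<le> (\<Sum>j<m. t (Suc j) + (1 + cost e)) + (1 + cost e)" "ok (f (Suc m))"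
      using IH o1 unfolding exe_def by auto
    have "(\<Sum>j<Suc m. t j + (1 + cost e)) = t 0 + (1 + cost e) + (\<Sum>j<m. t (Suc j) + (1 + cost e))"
      by (rule sum.lessThan_Suc_shift)
    then have t: "elapsed (Tick (1 + cost e) # es @ fs) \<le> (\<Sum>j<Suc m. t j + (1 + cost e)) + (1 +
        cost e)"
      using es(3) fs(3) by (simp only: elapsed.simps elapsed_append)
    have "eval e (conc (f 0)) \<noteq> 0" by (rule Suc.prems(1)) simp
    from exec.LoopTrue[OF this es(1) fs(1)]
    show "ok (f (Suc m)) \<and> (\<exists>es. exec sub B (Loop e c) (conc (f 0)) es (conc (f (Suc m))) \<and>
        outputs es = [] \<and> elapsed es \<le> (\<Sum>j<Suc m. t j + (1 + cost e)) + (1 + cost e))"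
      using t es(2) fs(2,4) by (intro conjI exI[of _ "Tick (1 + cost e) # es @ fs"]) simp_all
  qed
qed

definition with_var :: "nat \<Rightarrow> nat \<Rightarrow> store \<Rightarrow> store" where
  "with_var i j \<sigma> = ((fst \<sigma>)(i := j), snd \<sigma>)"

lemma with_var_simp [simp]: "with_var i j (v, N, X) = (v(i := j), N, X)"
  by (simp add: with_var_def)

text \<open>The states \<open>f j\<close> have the counter at 0 at both ends of the loop, and
  \<open>with_var\<close> puts its current value in, so invariants need not mention it. The guard
  evaluates \<open>e\<close> anew in every round; guard and increment account for
  \<open>7 + cost e\<close>, and so do the two resets with the last guard.\<close>

lemma exe_For:
  assumes i: "12 < i" and "m \<le> W" and "fst (f 0) i = 0" "fst (f m) i = 0"
    and e: "\<And>j. j \<le> m \<Longrightarrow> eval e (conc (with_var i j (f j))) = m"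
    and c: "\<And>j. j < m \<Longrightarrow> exe c (with_var i j (f j)) (t j) (with_var i j (f (Suc j)))"
    and \<sigma>: "\<sigma> = f 0" "\<sigma>' = f m"
  shows "exe (For i e c) \<sigma> ((\<Sum>j<m. t j + (7 + cost e)) + (7 + cost e)) \<sigma>'"
proof -
  have set_i: "exe (SetReg i (Num x)) (with_var i y \<sigma>) 2 (with_var i x \<sigma>)" if "x \<le> W" for \<sigma> x y
    using that by (cases \<sigma>, simp only: with_var_simp) (rule exe_conv[OF exe_SetReg[OF i]]; simp)
  have id: "with_var i 0 (f 0) = f 0" "with_var i 0 (f m) = f m"
    using assms(3,4) by (auto simp: with_var_def fun_upd_idem)
  have v: "eval (Reg i) (conc (with_var i j \<sigma>)) = j" for j \<sigma>
    using i by (cases \<sigma>) simp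
  have inc: "exe (SetReg i (Plus (Reg i) (Num 1))) (with_var i j \<sigma>) 4 (with_var i (Suc j) \<sigma>)"
    if "j < m" for j \<sigma>
    using i that \<open>m \<le> W\<close>
    by (cases \<sigma>, simp only: with_var_simp) (rule exe_conv[OF exe_SetReg[OF i]]; simp)
  have "exe (Loop (Minus e (Reg i)) (Seq c (SetReg i (Plus (Reg i) (Num 1))))) (with_var i 0 (f 0))
     ((\<Sum>j<m. t j + 4 + (1 + cost (Minus e (Reg i)))) + (1 + cost (Minus e (Reg i)))) (with_var i m
         (f m))"
  proof (intro exe_Loop exe_Seq)
    fix j assume j: "j < m"
    show "eval (Minus e (Reg i)) (conc (with_var i j (f j))) \<noteq> 0" using e[of j] v[of j "f j"] j by
        simp
    show "exe c (with_var i j (f j)) (t j) (with_var i j (f (Suc j)))" by (rule c[OF j])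
    show "exe (SetReg i (Plus (Reg i) (Num 1))) (with_var i j (f (Suc j))) 4
        (with_var i (Suc j) (f (Suc j)))" by (rule inc[OF j])
  next
    show "eval (Minus e (Reg i)) (conc (with_var i m (f m))) = 0" using e[of m] v[of m "f m"] by
        simp
  qed
  from exe_Seq[OF set_i[OF le0, of 0 "f 0"] exe_Seq[OF this set_i[OF le0, of m "f m"]]]
  show ?thesis
    unfolding For_def id \<sigma> by (rule exe_conv) (auto simp: sum.distrib algebra_simps)
qed

end

section \<open>Array programs\<close>

text \<open>Array \<open>aCUR\<close> holds the current node of the traversal and is empty while the next root is
  searched. A candidate for a child is held by \<open>aCAND\<close>, with its order in \<open>aORD\<close>, and \<open>aWALK\<close>
  and \<open>aNEXT\<close> hold two consecutive solutions on the walk to it. The result of \<open>Neighbors\<close> is in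
  \<open>aNB\<close>, one of its items in \<open>aDD\<close>, with its order in \<open>aDORD\<close>. A walk leaves the slot of the
  child in the last solution's scan in \<open>rEXT\<close> and \<open>rHIT\<close>, where \<open>rHIT\<close> is 1 plus an index, and 0
  for a root. All other registers and arrays are 0 and empty between commands.\<close>

abbreviation (input) "aMARK \<equiv> 1 :: nat"
abbreviation (input) "aPRE \<equiv> 2 :: nat"
abbreviation (input) "aCUR \<equiv> 3 :: nat"
abbreviation (input) "aCAND \<equiv> 4 :: nat"
abbreviation (input) "aORD \<equiv> 5 :: nat"
abbreviation (input) "aWALK \<equiv> 6 :: nat"
abbreviation (input) "aARG \<equiv> 7 :: nat"
abbreviation (input) "aRES \<equiv> 8 :: nat"
abbreviation (input) "aDD \<equiv> 9 :: nat"
abbreviation (input) "aDORD \<equiv> 10 :: nat"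
abbreviation (input) "aNEXT \<equiv> 11 :: nat"
abbreviation (input) "aNB \<equiv> 12 :: nat"

abbreviation (input) "rI \<equiv> 13 :: nat"
abbreviation (input) "rJ \<equiv> 14 :: nat"
abbreviation (input) "rH \<equiv> 15 :: nat"
abbreviation (input) "rPTR \<equiv> 16 :: nat"
abbreviation (input) "rHIT \<equiv> 17 :: nat"
abbreviation (input) "rEXT \<equiv> 18 :: nat"
abbreviation (input) "rSEED \<equiv> 19 :: nat"
abbreviation (input) "rEQ \<equiv> 20 :: nat"
abbreviation (input) "rCNT \<equiv> 21 :: nat"
abbreviation (input) "rDONE \<equiv> 22 :: nat"
abbreviation (input) "rROOT \<equiv> 23 :: nat"
abbreviation (input) "rW \<equiv> 24 :: nat"
abbreviation (input) "rIDX \<equiv> 25 :: nat"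
abbreviation (input) "rPAR \<equiv> 26 :: nat"

definition Elem :: "nat \<Rightarrow> expr" where
  "Elem k = Arr k (Plus (Reg rI) (Num 1))"

definition Differ :: "expr \<Rightarrow> expr \<Rightarrow> expr" where
  "Differ d e = Plus (Minus d e) (Minus e d)"

definition Copy :: "nat \<Rightarrow> nat \<Rightarrow> com" where
  "Copy k l = For rI (Arr k (Num 0)) (Push l (Elem k))"

definition Filter :: "nat \<Rightarrow> nat \<Rightarrow> nat \<Rightarrow> com" where
  "Filter a k l = For rI (Arr k (Num 0)) (Cond (Arr a (Elem k)) (Push l (Elem k)) Skip)"

definition SetMarks :: "nat \<Rightarrow> nat \<Rightarrow> expr \<Rightarrow> nat \<Rightarrow> com" where
  "SetMarks a k e b = For rI e (SetMem (Plus (Reg a) (Elem k)) (Num b))"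

definition EqUpto :: "expr \<Rightarrow> nat \<Rightarrow> nat \<Rightarrow> com" where
  "EqUpto e k l = SetReg rEQ (Num 1) ;;
    For rI e (Cond (Differ (Elem k) (Elem l)) (SetReg rEQ (Num 0)) Skip)"

definition Eq :: "nat \<Rightarrow> nat \<Rightarrow> com" where
  "Eq k l = Cond (Differ (Arr k (Num 0)) (Arr l (Num 0))) Skip (EqUpto (Arr k (Num 0)) k l)"

text \<open>\<open>Mem (Elem k)\<close> looks an element up in the input vector, which starts at
  address 0. On an increasing list the first member of \<open>Z\<close> is the seed; stored plus
  one, it leaves 0 to mean that none has been met.\<close>

definition Find_Seed :: "nat \<Rightarrow> com" where
  "Find_Seed k = For rI (Arr k (Num 0)) (Cond (Reg rSEED) Skip
     (Cond (Mem (Elem k)) (SetReg rSEED (Plus (Elem k) (Num 1))) Skip))"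

text \<open>\<open>rH\<close> equals \<open>rI\<close> until an element outside \<open>aWALK\<close>
  occurs and lags behind afterwards, which the outer condition detects; this replaces leaving the
  loop early. The last increment turns the proximity into the size of the target.\<close>

definition Prox :: com where
  "Prox = SetMarks aMARK aWALK (Arr aWALK (Num 0)) 1 ;;
    For rI (Arr aORD (Num 0)) (Cond (Minus (Reg rI) (Reg rH)) Skip
             (Cond (Arr aMARK (Elem aORD)) (SetReg rH (Plus (Reg rH) (Num 1))) Skip)) ;;
               SetMarks aMARK aWALK (Arr aWALK (Num 0)) 0 ;; SetReg rH (Plus (Reg rH) (Num 1))"

definition Locate :: com where
  "Locate = For rI (Arr aDORD (Num 0))
     (Cond (Differ (Elem aDORD) (Reg rW)) Skip (SetReg rH (Plus (Reg rI) (Num 1))))"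

definition Fetch :: "nat \<Rightarrow> expr \<Rightarrow> com" where
  "Fetch a e = Push aARG e ;; Copy a aARG ;; Call Neighbors (Reg aARG) (Reg aNB) ;; Clear aARG"

definition Item :: expr where
  "Item = Arr aNB (Plus (Reg rPTR) (Plus (Reg rI) (Num 1)))"

definition Next_Item :: com where
  "Next_Item = SetReg rPTR (Plus (Reg rPTR) (Plus (Arr aNB (Reg rPTR)) (Num 1)))"

text \<open>Cell 0 of \<open>aNB\<close> holds the length of the result and cell 1 the number of
  items, so the first size is in cell 2. Clearing \<open>aNB\<close> frees it for the next call of
  \<open>Neighbors\<close>.\<close>

definition Extract :: "expr \<Rightarrow> com" where
  "Extract e = SetReg rPTR (Num 2) ;; For rI e Next_Item ;;
    For rI (Arr aNB (Reg rPTR)) (Push aDD Item) ;; SetReg rPTR (Num 0) ;; Clear aNB"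

text \<open>An item contains the target iff it has \<open>rH\<close> elements in common with it, so
  counting marked elements decides inclusion. Overwriting \<open>rHIT\<close> yields the last such
  item.\<close>

definition Scan :: com where
  "Scan = SetReg rPTR (Num 2) ;; For rJ (Arr aNB (Num 1))
     (For rI (Arr aNB (Reg rPTR)) (Cond (Arr aPRE Item) (SetReg rCNT (Plus (Reg rCNT) (Num 1)))
         Skip) ;;
       Cond (Minus (Reg rH) (Reg rCNT)) Skip (SetReg rHIT (Plus (Reg rJ) (Num 1))) ;; Next_Item ;;
       SetReg rCNT (Num 0)) ;; SetReg rPTR (Num 0)"

lemma costs [simp]: "cost (Elem k) = 6" "cost (Differ d e) = 2 * cost d + 2 * cost e + 3" "cost
    Item = 8"
  by (simp_all add: Elem_def Differ_def Item_def)

lemmas take_Suc_nth = take_Suc_conv_app_nth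

lemma length_takeWhile_take_Suc:
  "j < length xs \<Longrightarrow> length (takeWhile P (take (Suc j) xs)) =
    (if length (takeWhile P (take j xs)) = j \<and> P (xs ! j) then Suc j
     else length (takeWhile P (take j xs)))"
proof -
  assume j: "j < length xs"
  have "length (takeWhile P (take j xs)) = j \<longleftrightarrow> (\<forall>x\<in>set (take j xs). P x)"
    using j by (metis length_take less_imp_le min.absorb2 takeWhile_eq_all_conv takeWhile_eq_take
        take_all_iff
        order_refl)
  then show ?thesis
    using j by (auto simp: take_Suc_nth takeWhile_append)
qed

section \<open>Encoded lists of sets\<close>

abbreviation "sl \<equiv> sorted_list_of_set"

definition enc :: "nat set list \<Rightarrow> nat list" where
  "enc Ds = length Ds # concat (map (\<lambda>D. card D # sl D) Ds)"

text \<open>The cell with the size of item \<open>j\<close>, and the value of \<open>rPTR\<close> on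
  arrival there; the 2 skips the total length and the number of items.\<close>

definition offset :: "nat set list \<Rightarrow> nat \<Rightarrow> nat" where
  "offset Ds j = 2 + sum_list (map (\<lambda>D. Suc (card D)) (take j Ds))"

lemma concat_nth:
  "i < length xss \<Longrightarrow> l < length (xss ! i) \<Longrightarrow>
    sum_list (map length (take i xss)) + l < length (concat xss) \<and>
    concat xss ! (sum_list (map length (take i xss)) + l) = xss ! i ! l"
proof (induction xss arbitrary: i)
  case (Cons xs xss)
  then show ?case by (cases i) (auto simp: nth_append add.assoc)
qed simp

lemma offset_0 [simp]: "offset Ds 0 = 2"
  by (simp add: offset_def)

lemma offset_Suc: "j < length Ds \<Longrightarrow> offset Ds (Suc j) = offset Ds j + Suc (card (Ds ! j))"
  by (simp add: offset_def take_Suc_conv_app_nth)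

lemma enc_1: "array (enc Ds) (Suc 0) = length Ds"
  by (simp add: enc_def)

lemma length_enc: "length (enc Ds) = Suc (sum_list (map (\<lambda>D. Suc (card D)) Ds))"
  by (simp add: enc_def length_concat comp_def)

lemma offset_le: "offset Ds j \<le> length (enc Ds) + 1"
proof -
  have "sum_list (map (\<lambda>D. Suc (card D)) Ds) =
      sum_list (map (\<lambda>D. Suc (card D)) (take j Ds)) + sum_list (map (\<lambda>D. Suc (card D)) (drop j Ds))"
    by (metis append_take_drop_id map_append sum_list.append)
  then show ?thesis by (simp add: length_enc offset_def)
qed

lemma enc_offset:
  assumes "j < length Ds"
  shows "array (enc Ds) (offset Ds j) = card (Ds ! j)"
    and "l < card (Ds ! j) \<Longrightarrow> array (enc Ds) (Suc (offset Ds j + l)) = sl (Ds ! j) ! l"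
proof -
  let ?xss = "map (\<lambda>D. card D # sl D) Ds"
  have o: "offset Ds j = 2 + sum_list (map length (take j ?xss))"
    by (simp add: offset_def comp_def take_map)
  have at: "array (enc Ds) (offset Ds j + i) = ?xss ! j ! i" if "i < Suc (card (Ds ! j))" for i
  proof -
    have "sum_list (map length (take j ?xss)) + i < length (concat ?xss) \<and>
        concat ?xss ! (sum_list (map length (take j ?xss)) + i) = ?xss ! j ! i"
      using assms that by (intro concat_nth) simp_all
    then show ?thesis unfolding o enc_def array_def by simp
  qed
  show "array (enc Ds) (offset Ds j) = card (Ds ! j)"
    using at[of 0] assms by simp
  show "l < card (Ds ! j) \<Longrightarrow> array (enc Ds) (Suc (offset Ds j + l)) = sl (Ds ! j) ! l"
    using at[of "Suc l"] assms by simp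
qed

text \<open>A loop over all items and their elements is linear in the length of the result of
  \<open>Neighbors\<close>, hence in its running time, whatever the sizes of the items.\<close>

lemma sum_card_enc: "(\<Sum>j<length Ds. a * card (Ds ! j) + b) \<le> (a + b) * length (enc Ds)"
proof -
  have "(\<Sum>j<length Ds. a * card (Ds ! j) + b) \<le> (\<Sum>j<length Ds. (a + b) * Suc (card (Ds ! j)))"
    by (intro sum_mono) (simp add: algebra_simps)
  also have "\<dots> = (a + b) * sum_list (map (\<lambda>D. Suc (card D)) Ds)"
    by (simp add: sum_list_sum_nth sum_distrib_left atLeast0LessThan)
  also have "\<dots> \<le> (a + b) * length (enc Ds)"
    by (simp add: length_enc)
  finally show ?thesis .
qed

lemma card_le_enc: "j < length Ds \<Longrightarrow> j + card (Ds ! j) < length (enc Ds)"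
proof -
  assume j: "j < length Ds"
  have "j \<le> sum_list (map (\<lambda>D. Suc (card D)) (take j Ds))"
    using j sum_list_mono[of "take j Ds" "\<lambda>_. 1" "\<lambda>D. Suc (card D)"]
    by (simp add: sum_list_triv)
  then show ?thesis
    using offset_Suc[OF j] offset_le[of Ds "Suc j"] by (simp add: offset_def)
qed

section \<open>Correctness of the array programs\<close>

context machine
begin

text \<open>\<open>exe\<close> carries the invariant \<open>ok\<close> as a guard, so that triples
  compose freely; this rule makes its length bounds available where a proof needs them.\<close>

lemma exe_okI: "(ok \<sigma> \<Longrightarrow> exe c \<sigma> t \<sigma>') \<Longrightarrow> exe c \<sigma> t \<sigma>'"
  by (auto simp: exe_def)

lemma exe_le: "exe c \<sigma> t \<sigma>' \<Longrightarrow> t \<le> t' \<Longrightarrow> exe c \<sigma> t' \<sigma>'"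
  by (rule exe_conv) auto

lemma eval_Elem [simp]:
  "3 \<le> k \<Longrightarrow> k < 12 \<Longrightarrow> v rI < length (N k) \<Longrightarrow> length (N k) \<le> n + 1 \<Longrightarrow>
    eval (Elem k) (conc (v, N, X)) = N k ! v rI"
  by (simp add: Elem_def)

lemma eval_Differ [simp]: "eval (Differ d e) s = 0 \<longleftrightarrow> eval d s = eval e s"
  by (auto simp: Differ_def)

lemma exe_Copy:
  assumes "v rI = 0" "3 \<le> k" "k < 12" "3 \<le> l" "l < 12" "k \<noteq> l" "length (N l) + length (N k) \<le> n + 1"
  shows "exe (Copy k l) (v, N, X) (40 * length (N k) + 20) (v, N(l := N l @ N k), X)"
proof (rule exe_okI)
  assume o: "ok (v, N, X)"
  note len = ok_length[OF o assms(2,3)] and ent = ok_entry[OF o assms(2), simplified]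
  have lW: "length (N k) \<le> W" using len W by simp
  show ?thesis
    unfolding Copy_def
    by (rule exe_conv[OF exe_For[where m = "length (N k)" and
          f = "\<lambda>j. (v, N(l := N l @ take j (N k)), X)" and t = "\<lambda>_. 26"]])
      (use assms len ent lW in \<open>auto simp: take_Suc_nth intro!: exe_conv[OF exe_Push]\<close>)
qed

lemma exe_Filter:
  assumes "v rI = 0" "1 \<le> a" "a < 3" "3 \<le> k" "k < 12" "3 \<le> l" "l < 12" "k \<noteq> l"
    "length (N l) + length (N k) \<le> n + 1" "\<forall>x\<in>set (N k). x < n"
  shows "exe (Filter a k l) (v, N, X) (60 * length (N k) + 20)
    (v, N(l := N l @ filter (\<lambda>x. x \<in> X a) (N k)), X)"
proof (rule exe_okI)
  assume o: "ok (v, N, X)"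
  note len = ok_length[OF o assms(4,5)]
  have lW: "length (N k) \<le> W" using len W by simp
  show ?thesis
    unfolding Filter_def
  proof (rule exe_conv[OF exe_For[where m = "length (N k)" and
          f = "\<lambda>j. (v, N(l := N l @ filter (\<lambda>x. x \<in> X a) (take j (N k))), X)" and t = "\<lambda>_. 40"]])
    fix j assume j: "j < length (N k)"
    then have "N k ! j \<in> set (N k)" by simp
    then have x: "N k ! j < n" using assms(10) by blast
    then have xW: "N k ! j \<le> W" using W by simp
    have l: "length (filter (\<lambda>x. x \<in> X a) (take j (N k))) \<le> j"
      using length_filter_le[of "\<lambda>x. x \<in> X a" "take j (N k)"] j by simp
    show "exe (Cond (Arr a (Elem k)) (Push l (Elem k)) Skip)
      (with_var rI j (v, N(l := N l @ filter (\<lambda>x. x \<in> X a) (take j (N k))), X)) 40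
      (with_var rI j (v, N(l := N l @ filter (\<lambda>x. x \<in> X a) (take (Suc j) (N k))), X))"
      by (rule exe_le[OF exe_Cond[where t = 26]])
        (use j x xW l assms(1-9) len in \<open>auto simp: take_Suc_nth
          intro!: exe_conv[OF exe_Push] exe_conv[OF exe_Skip]\<close>)
  qed (use assms len lW in \<open>auto\<close>)
qed

lemma exe_SetMarks:
  assumes "v rI = 0" "1 \<le> a" "a < 3" "3 \<le> k" "k < 12" "m \<le> length (N k)" "\<forall>x\<in>set (N k). x < n"
    and e: "\<And>j Y. eval e (conc (v(rI := j), N, Y)) = m"
  shows "exe (SetMarks a k e 1) (v, N, X) ((20 + cost e) * (m + 1)) (v, N, X(a := X a \<union> set (take
      m (N k))))"
    and "exe (SetMarks a k e 0) (v, N, X) ((20 + cost e) * (m + 1)) (v, N, X(a := X a - set (take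
        m (N k))))"
proof -
  show "exe (SetMarks a k e 1) (v, N, X) ((20 + cost e) * (m + 1)) (v, N, X(a := X a \<union> set (take m
      (N k))))"
  proof (rule exe_okI)
    assume o: "ok (v, N, X)"
    note len = ok_length[OF o assms(4,5)]
    have mW: "m \<le> W" using len W assms(6) by simp
    show ?thesis
      unfolding SetMarks_def
    proof (rule exe_conv[OF exe_For[where m = m and
            f = "\<lambda>j. (v, N, X(a := X a \<union> set (take j (N k))))" and t = "\<lambda>_. 10"]])
      fix j assume j: "j < m"
      show "exe (SetMem (Plus (Reg a) (Elem k)) (Num 1)) (with_var rI j (v, N, X(a := X a \<union> set
          (take j (N k))))) 10
        (with_var rI j (v, N, X(a := X a \<union> set (take (Suc j) (N k)))))"
        unfolding with_var_simp
        by (rule exe_conv[OF exe_Mark(1)[where x = "N k ! j"]])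
          (use j assms len in \<open>auto simp: take_Suc_nth\<close>)
    qed (use assms mW in \<open>auto simp: algebra_simps\<close>)
  qed
  show "exe (SetMarks a k e 0) (v, N, X) ((20 + cost e) * (m + 1)) (v, N, X(a := X a - set (take m
      (N k))))"
  proof (rule exe_okI)
    assume o: "ok (v, N, X)"
    note len = ok_length[OF o assms(4,5)]
    have mW: "m \<le> W" using len W assms(6) by simp
    show ?thesis
      unfolding SetMarks_def
    proof (rule exe_conv[OF exe_For[where m = m and
            f = "\<lambda>j. (v, N, X(a := X a - set (take j (N k))))" and t = "\<lambda>_. 10"]])
      fix j assume j: "j < m"
      have eq: "X a - set (take (Suc j) (N k)) = X a - set (take j (N k)) - {N k ! j}"
        using j assms(6) by (auto simp: take_Suc_nth)
      show "exe (SetMem (Plus (Reg a) (Elem k)) (Num 0)) (with_var rI j (v, N, X(a := X a - set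
          (take j (N k))))) 10
        (with_var rI j (v, N, X(a := X a - set (take (Suc j) (N k)))))"
        unfolding with_var_simp eq
        by (rule exe_conv[OF exe_Unmark[where x = "N k ! j"]])
          (use j assms len in auto)
    qed (use assms mW in \<open>auto simp: algebra_simps\<close>)
  qed
qed

lemma exe_EqUpto:
  assumes "v rI = 0" "3 \<le> k" "k < 12" "3 \<le> l" "l < 12" "m \<le> length (N k)" "m \<le> length (N l)"
    and e: "\<And>j b. eval e (conc (v(rEQ := b, rI := j), N, X)) = m"
  shows "exe (EqUpto e k l) (v, N, X) ((60 + cost e) * (m + 1))
    (v(rEQ := if take m (N k) = take m (N l) then 1 else 0), N, X)"
proof (rule exe_okI)
  assume o: "ok (v, N, X)"
  note len = ok_length[OF o assms(2,3)] ok_length[OF o assms(4,5)]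
  have m: "m \<le> W" using len W assms(6) by simp
  have "exe (SetReg rEQ (Num 1)) (v, N, X) 2 (v(rEQ := 1), N, X)"
    by (rule exe_conv[OF exe_SetReg]) (use W in auto)
  also have "exe (For rI e (Cond (Differ (Elem k) (Elem l)) (SetReg rEQ (Num 0)) Skip)) \<dots> ((57 +
      cost e) * (m + 1))
      (v(rEQ := if take m (N k) = take m (N l) then 1 else 0), N, X)"
  proof (rule exe_conv[OF exe_For[where m = m and t = "\<lambda>_. 50" and
            f = "\<lambda>j. (v(rEQ := if take j (N k) = take j (N l) then 1 else 0), N, X)"]])
    fix j assume j: "j < m"
    show "exe (Cond (Differ (Elem k) (Elem l)) (SetReg rEQ (Num 0)) Skip)
        (with_var rI j (v(rEQ := if take j (N k) = take j (N l) then 1 else 0), N, X)) 50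
        (with_var rI j (v(rEQ := if take (Suc j) (N k) = take (Suc j) (N l) then 1 else 0), N, X))"
      by (rule exe_le[OF exe_Cond[where t = 2]])
        (use j assms len in \<open>auto simp: take_Suc_nth fun_upd_twist
          intro!: exe_conv[OF exe_SetReg] exe_conv[OF exe_Skip]\<close>)
  qed (use assms m in auto)
  finally show ?thesis
    unfolding EqUpto_def by (rule exe_le) (simp add: algebra_simps)
qed

lemma exe_Eq:
  assumes "v rI = 0" "v rEQ = 0" "3 \<le> k" "k < 12" "3 \<le> l" "l < 12"
  shows "exe (Eq k l) (v, N, X) (80 * length (N k) + 120) (v(rEQ := if N k = N l then 1 else 0),
      N, X)"
proof -
  have "exe (EqUpto (Arr k (Num 0)) k l) (v, N, X) (64 * (length (N k) + 1))
      (v(rEQ := if N k = N l then 1 else 0), N, X)" if "length (N k) = length (N l)"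
    by (rule exe_conv[OF exe_EqUpto[where m = "length (N k)"]]) (use assms that in auto)
  moreover have "exe Skip (v, N, X) (64 * (length (N k) + 1))
      (v(rEQ := if N k = N l then 1 else 0), N, X)" if "length (N k) \<noteq> length (N l)"
    by (rule exe_conv[OF exe_Skip]) (use assms that in auto)
  ultimately show ?thesis
    unfolding Eq_def
    by (intro exe_le[OF exe_Cond[where t = "64 * (length (N k) + 1)"]])
      (use assms in \<open>auto\<close>)
qed

lemma exe_Extract:
  assumes v: "v rI = 0" "v rPTR = 0" and N: "N aNB = enc Ds" "N aDD = []"
    and j: "j < length Ds" and D: "Ds ! j \<subseteq> {..<n}" and l: "length (enc Ds) + 1 \<le> W"
    and e: "\<And>b i. eval e (conc (v(rPTR := b, rI := i), N, X)) = j"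
  shows "exe (Extract e) (v, N, X) ((100 + cost e) * length (enc Ds)) (v, N(aNB := [], aDD := sl
      (Ds ! j)), X)"
proof (rule exe_okI)
  assume o: "ok (v, N, X)"
  have offW: "offset Ds i \<le> W" for i using offset_le[of Ds i] l by linarith
  have jW: "j \<le> W" using card_le_enc[OF j] l by simp
  have fin: "finite (Ds ! j)" using D finite_subset by blast
  have cn: "card (Ds ! j) \<le> n" using D card_mono[of "{..<n}" "Ds ! j"] by simp
  have le: "(20 + cost e) * (j + 1) \<le> (20 + cost e) * length (enc Ds)"
    using card_le_enc[OF j] by (intro mult_le_mono) auto
  have "exe (SetReg rPTR (Num 2)) (v, N, X) 2 (v(rPTR := 2), N, X)"
    by (rule exe_conv[OF exe_SetReg]) (use W in auto)
  also have "exe (For rI e Next_Item) \<dots> ((20 + cost e) * (j + 1))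
      (v(rPTR := offset Ds j), N, X)"
  proof (rule exe_conv[OF exe_For[where m = j and f = "\<lambda>i. (v(rPTR := offset Ds i), N, X)" and t =
      "\<lambda>_. 10"]])
    fix i assume i: "i < j"
    then have "offset Ds i + (array (enc Ds) (offset Ds i) + 1) = offset Ds (Suc i)"
      using j by (simp add: enc_offset offset_Suc)
    then show "exe Next_Item (with_var rI i (v(rPTR := offset Ds i), N, X)) 10
      (with_var rI i (v(rPTR := offset Ds (Suc i)), N, X))"
      unfolding Next_Item_def with_var_simp
      by (intro exe_conv[OF exe_SetReg]) (use offW N in \<open>auto simp: fun_eq_iff\<close>)
  qed (use v e jW in \<open>auto simp: algebra_simps\<close>)
  also have "exe (For rI (Arr aNB (Reg rPTR)) (Push aDD Item)) \<dots> (50 * card (Ds ! j) + 15)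
      (v(rPTR := offset Ds j), N(aDD := sl (Ds ! j)), X)"
  proof (rule exe_conv[OF exe_For[where m = "card (Ds ! j)" and t = "\<lambda>_. 30" and
        f = "\<lambda>i. (v(rPTR := offset Ds j), N(aDD := take i (sl (Ds ! j))), X)"]])
    fix i assume i: "i < card (Ds ! j)"
    have "sl (Ds ! j) ! i \<in> Ds ! j"
      using nth_mem[of i "sl (Ds ! j)"] i fin by simp
    then have "sl (Ds ! j) ! i < n" using D by auto
    then show "exe (Push aDD Item) (with_var rI i (v(rPTR := offset Ds j), N(aDD := take i (sl (Ds
        ! j))), X)) 30
      (with_var rI i (v(rPTR := offset Ds j), N(aDD := take (Suc i) (sl (Ds ! j))), X))"
      unfolding with_var_simp
      by (intro exe_conv[OF exe_Push])
        (use i N j cn W in \<open>auto simp: Item_def enc_offset take_Suc_nth\<close>)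
  qed (use v N j cn W in \<open>auto simp: enc_offset fun_upd_idem\<close>)
  also have "exe (SetReg rPTR (Num 0)) \<dots> 2 (v, N(aDD := sl (Ds ! j)), X)"
    by (rule exe_conv[OF exe_SetReg]) (use v in \<open>auto simp: fun_upd_idem\<close>)
  also have "exe (Clear aNB) \<dots> (30 * length (enc Ds) + 5)
      (v, N(aNB := [], aDD := sl (Ds ! j)), X)"
    by (rule exe_conv[OF exe_Clear]) (use N in \<open>auto simp: fun_upd_twist\<close>)
  finally show ?thesis
    unfolding Extract_def
    by (rule exe_le)
      (use le card_le_enc[OF j] in \<open>simp add: algebra_simps\<close>)
qed

lemma exe_Scan:
  assumes v: "v rI = 0" "v rJ = 0" "v rPTR = 0" "v rCNT = 0" "v rHIT = 0" "v rH = card T"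
    and N: "N aNB = enc Ds" and X: "X aPRE = T" and T: "finite T"
    and D: "\<forall>D\<in>set Ds. D \<subseteq> {..<n}" and l: "length (enc Ds) + 1 \<le> W"
  shows "exe Scan (v, N, X) (150 * length (enc Ds))
    (v(rHIT := last_hit (\<lambda>j. T \<subseteq> Ds ! j) (length Ds)), N, X)"
proof -
  have offW: "offset Ds i \<le> W" for i using offset_le[of Ds i] l by linarith
  have lenW: "length Ds < W"
    using sum_card_enc[of 0 Ds 1] l by simp
  let ?hit = "last_hit (\<lambda>j. T \<subseteq> Ds ! j)"
  let ?v = "\<lambda>j. v(rPTR := offset Ds j, rHIT := ?hit j)"
  have body: "exe (For rI (Arr aNB (Reg rPTR)) (Cond (Arr aPRE Item) (SetReg rCNT (Plus (Reg rCNT)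
      (Num 1))) Skip) ;;
    Cond (Minus (Reg rH) (Reg rCNT)) Skip (SetReg rHIT (Plus (Reg rJ) (Num 1))) ;; Next_Item ;;
    SetReg rCNT (Num 0)) ((?v j)(rJ := j), N, X)
     (40 * card (Ds ! j) + 50) ((?v (Suc j))(rJ := j), N, X)" if j: "j < length Ds" for j
  proof -
    let ?D = "Ds ! j" and ?u = "(?v j)(rJ := j)"
    let ?c = "\<lambda>i. length (filter (\<lambda>x. x \<in> T) (take i (sl ?D)))"
    have Dn: "?D \<subseteq> {..<n}" using D j by simp
    have fin: "finite ?D" using Dn finite_subset by blast
    have cn: "card ?D \<le> n" using Dn card_mono[of "{..<n}" ?D] by simp
    \<comment> \<open>The program compares cardinalities only; for finite sets this decides
      inclusion.\<close>
    have iff: "T \<subseteq> ?D \<longleftrightarrow> card T \<le> card (?D \<inter> T)"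
      by (metis Int_absorb1 Int_lower2 T card_mono card_seteq order_refl finite_Int inf.absorb_iff2)
    have nxt: "offset Ds j + (array (enc Ds) (offset Ds j) + 1) = offset Ds (Suc j)"
      using j by (simp add: enc_offset offset_Suc)
    have "exe (For rI (Arr aNB (Reg rPTR)) (Cond (Arr aPRE Item) (SetReg rCNT (Plus (Reg rCNT)
        (Num 1))) Skip)) (?u, N, X) (30 * card ?D + 15)
        (?u(rCNT := card (?D \<inter> T)), N, X)"
    proof (rule exe_conv[OF exe_For[where m = "card ?D" and t = "\<lambda>_. 18" and f = "\<lambda>i. (?u(rCNT :=
        ?c i), N, X)"]])
      fix i assume i: "i < card ?D"
      have "sl ?D ! i \<in> ?D" using nth_mem[of i "sl ?D"] i fin by simp
      then have x: "sl ?D ! i < n" using Dn by auto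
      have "?c i \<le> i" using length_filter_le[of "\<lambda>x. x \<in> T" "take i (sl ?D)"] i by simp
      then have c: "Suc (?c i) \<le> W" using i cn W by simp
      show "exe (Cond (Arr aPRE Item) (SetReg rCNT (Plus (Reg rCNT) (Num 1))) Skip)
          (with_var rI i (?u(rCNT := ?c i), N, X)) 18 (with_var rI i (?u(rCNT := ?c (Suc i)), N,
              X))"
        unfolding with_var_simp
        by (rule exe_le[OF exe_Cond[where t = 4]])
          (use i x c N X j in \<open>auto simp: Item_def enc_offset take_Suc_nth fun_upd_twist
            intro!: exe_conv[OF exe_SetReg] exe_conv[OF exe_Skip]\<close>)
    next
      have "card (?D \<inter> T) = ?c (card ?D)"
        using distinct_length_filter[of "sl ?D" "\<lambda>x. x \<in> T"] fin by (simp add: Int_def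
            Collect_conj_eq[symmetric] conj_commute)
      then show "(?u(rCNT := card (?D \<inter> T)), N, X) = (?u(rCNT := ?c (card ?D)), N, X)" by simp
    qed (use v N j cn W in \<open>auto simp: enc_offset fun_upd_idem\<close>)
    also have "exe (Cond (Minus (Reg rH) (Reg rCNT)) Skip (SetReg rHIT (Plus (Reg rJ) (Num 1)))) \<dots> 8
        (?u(rCNT := card (?D \<inter> T), rHIT := ?hit (Suc j)), N, X)"
      by (rule exe_le[OF exe_Cond[where t = 4]])
        (use iff v j lenW in \<open>auto simp: fun_upd_twist intro!: exe_conv[OF exe_SetReg] exe_conv[OF
            exe_Skip]\<close>)
    also have "exe Next_Item \<dots> 10
        (?u(rCNT := card (?D \<inter> T), rHIT := ?hit (Suc j), rPTR := offset Ds (Suc j)), N, X)"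
      unfolding Next_Item_def by (rule exe_conv[OF exe_SetReg]) (use nxt offW N in \<open>auto simp:
          fun_eq_iff\<close>)
    also have "exe (SetReg rCNT (Num 0)) \<dots> 2 ((?v (Suc j))(rJ := j), N, X)"
      by (intro exe_conv[OF exe_SetReg]) (use v in \<open>auto simp: fun_eq_iff\<close>)
    finally show ?thesis
      by (rule exe_le) simp
  qed
  have "exe (SetReg rPTR (Num 2)) (v, N, X) 2 (v(rPTR := 2), N, X)"
    by (rule exe_conv[OF exe_SetReg]) (use W in auto)
  also have "exe (For rJ (Arr aNB (Num 1)) (For rI (Arr aNB (Reg rPTR)) (Cond (Arr aPRE Item)
      (SetReg rCNT (Plus (Reg rCNT) (Num 1))) Skip) ;;
    Cond (Minus (Reg rH) (Reg rCNT)) Skip (SetReg rHIT (Plus (Reg rJ) (Num 1))) ;; Next_Item ;;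
    SetReg rCNT (Num 0))) \<dots> (101 * length (enc Ds) + 11)
      (?v (length Ds), N, X)"
  proof (rule exe_conv[OF exe_For[where m = "length Ds" and t = "\<lambda>j. 40 * card (Ds ! j) + 50" and
      f = "\<lambda>j. (?v j, N, X)"]])
    \<comment> \<open>11 is the overhead \<open>7 + cost e\<close> of a round of \<open>For\<close>,
      here with \<open>cost e = 4\<close>.\<close>
    have "(\<Sum>j<length Ds. 40 * card (Ds ! j) + 50 + 11) \<le> (40 + 61) * length (enc Ds)"
      using sum_card_enc[of 40 Ds 61] by (simp add: add.assoc)
    then show "(\<Sum>j<length Ds. 40 * card (Ds ! j) + 50 + (7 + cost (Arr aNB (Num 1)))) + (7 + cost
        (Arr aNB (Num 1)))
        \<le> 101 * length (enc Ds) + 11" by simp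
  qed (use body v N lenW in \<open>auto simp: enc_1 fun_upd_idem fun_upd_twist\<close>)
  also have "exe (SetReg rPTR (Num 0)) \<dots> 2 (v(rHIT := ?hit (length Ds)), N, X)"
    by (rule exe_conv[OF exe_SetReg]) (use v in \<open>auto simp: fun_eq_iff\<close>)
  finally show ?thesis
    unfolding Scan_def
    by (rule exe_le) (simp add: length_enc)
qed

end

section \<open>Calls of the subroutines on solutions\<close>

definition OrderOf :: "nat \<Rightarrow> nat \<Rightarrow> com" where
  "OrderOf k d = Find_Seed k ;; Push aARG (Minus (Reg rSEED) (Num 1)) ;; Copy k aARG ;;
    Call Order (Reg aARG) (Reg aRES) ;; Clear aARG ;; SetMarks aMARK k (Arr k (Num 0)) 1 ;;
    Filter aMARK aRES d ;; SetMarks aMARK k (Arr k (Num 0)) 0 ;; Clear aRES ;;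
    SetReg rSEED (Num 0)"

text \<open>The prefix is given in canonical order, but \<open>Complete\<close> expects an
  increasing list. Filtering the increasing list in \<open>aDD\<close> by marks sorts the prefix
  without a sorting routine.\<close>

definition PreComp :: "nat \<Rightarrow> com" where
  "PreComp d = SetMarks aPRE aDORD (Reg rH) 1 ;; Filter aPRE aDD aARG ;;
    SetMarks aPRE aDORD (Reg rH) 0 ;; Call Complete (Reg aARG) (Reg d) ;; Clear aARG"

lemma filter_sl: "finite A \<Longrightarrow> filter P (sl A) = sl {x \<in> A. P x}"
  by (rule sorted_distinct_set_unique) (auto simp: sorted_wrt_filter)

text \<open>The slack in \<open>bounds\<close> admits a pointer one cell past the result of
  \<open>Neighbors\<close> and indices shifted by one.\<close>

locale enumeration = machine sub n W + reconstruction "{..<n}" F \<Pi> nbrs nb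
  for sub :: subroutines and n W :: nat and F :: "nat set set" and \<Pi> :: "nat set \<Rightarrow> nat \<Rightarrow> nat list"
    and nbrs :: "nat set \<Rightarrow> nat \<Rightarrow> nat set set" and nb :: "nat set \<Rightarrow> nat \<Rightarrow> nat set list" +
  fixes RT RN CT OT :: nat
  assumes bounds: "RT + 2 \<le> W" "RN + 1 \<le> W" "CT \<le> W" "OT \<le> W"
    and run_nb: "P \<in> maximal F \<Longrightarrow> w < n \<Longrightarrow> runs sub Neighbors (w # sl P) (enc (nb P w)) RT"
    and length_nb: "P \<in> maximal F \<Longrightarrow> w < n \<Longrightarrow> length (nb P w) \<le> RN"
    and run_comp: "X \<in> F \<Longrightarrow> X \<noteq> {} \<Longrightarrow> runs sub Complete (sl X) (sl (cmp X)) CT"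
    and run_order: "X \<in> F \<Longrightarrow> v \<in> X \<Longrightarrow> v \<in> Z \<Longrightarrow> runs sub Order (v # sl X) (\<Pi> X v) OT"
begin

text \<open>Up to a constant the cost of a step of a walk: a bounded number of subroutine calls, and
  work linear in lists whose lengths these times bound.\<close>

definition unit :: nat where "unit = RT + OT + CT"

lemma Z_less: "x \<in> Z \<Longrightarrow> x < n"
  using sol_subset[of "{x}"] by (auto simp: singletons_def)

lemma sol_less: "S \<in> F \<Longrightarrow> x \<in> S \<Longrightarrow> x < n"
  using sol_subset by auto

lemma card_sol: "S \<in> F \<Longrightarrow> card S \<le> n"
  using card_mono[of "{..<n}" S] sol_subset by auto

lemma set_sl: "S \<in> F \<Longrightarrow> set (sl S) = S"
  by (simp add: finite_sol)

lemma order_facts: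
  assumes "S \<in> F" "v \<in> S" "v \<in> Z"
  shows "\<forall>x\<in>set (\<Pi> S v). x < n" "length (\<Pi> S v) \<le> n" "card S \<le> length (\<Pi> S v)" "length (\<Pi> S v) \<le> OT"
proof -
  note p = order_props[OF assms]
  show less: "\<forall>x\<in>set (\<Pi> S v). x < n"
    using p(2) sol_less[OF assms(1)] sol_less by (auto simp: ext_def)
  have c: "card (set (\<Pi> S v)) = length (\<Pi> S v)" using p(1) by (rule distinct_card)
  show "length (\<Pi> S v) \<le> n"
    using card_mono[of "{..<n}" "set (\<Pi> S v)"] less c by auto
  show "card S \<le> length (\<Pi> S v)"
    unfolding c[symmetric] by (rule card_mono[OF finite_set]) (use p(2) in auto)
  show "length (\<Pi> S v) \<le> OT"
    using run_order[OF assms] by (auto simp: runs_def)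
qed

lemma card_OT: "S \<in> F \<Longrightarrow> S \<noteq> {} \<Longrightarrow> card S \<le> OT"
  using order_facts(3,4)[of S "seed F S"] seed_in[of S] by fastforce

lemma card_pos: "S \<in> F \<Longrightarrow> S \<noteq> {} \<Longrightarrow> 1 \<le> card S"
  using finite_sol by (simp add: Suc_le_eq card_gt_0_iff)

lemma exe_Find_Seed:
  assumes S: "S \<in> F" "S \<noteq> {}" and k: "3 \<le> k" "k < 12" "N k = sl S" and X: "X 0 = Z"
    and v: "v rI = 0" "v rSEED = 0"
  shows "exe (Find_Seed k) (v, N, X) (50 * OT + 20) (v(rSEED := Suc (seed F S)), N, X)"
proof -
  let ?f = "\<lambda>j. case filter (\<lambda>x. x \<in> Z) (take j (sl S)) of [] \<Rightarrow> 0 | x # _ \<Rightarrow> Suc x"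
  have fin: "finite S" by (rule finite_sol[OF S(1)])
  have c: "card S \<le> n" "card S \<le> OT" using card_sol card_OT S by auto
  have Sn: "\<forall>x\<in>set (sl S). x < n" using sol_less[OF S(1)] fin by auto
  have "filter (\<lambda>x. x \<in> Z) (sl S) = sl (S \<inter> Z)"
    using filter_sl[OF fin, of "\<lambda>x. x \<in> Z"] by (simp add: Int_def)
  also have "\<dots> = seed F S # sl (S \<inter> Z - {seed F S})"
    unfolding seed_def using sorted_list_of_set_nonempty[of "S \<inter> Z"] seeded[OF S] fin by simp
  finally have last: "?f (card S) = Suc (seed F S)" using fin by simp
  have lsl: "length (sl S) = card S" using fin by simp
  show ?thesis
    unfolding Find_Seed_def
  proof (rule exe_conv[OF exe_For[where m = "card S" and t = "\<lambda>_. 30" and f = "\<lambda>j. (v(rSEED := ?f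
      j), N, X)"]])
    fix j assume j: "j < card S"
    have "sl S ! j \<in> set (sl S)" using j lsl by (intro nth_mem) simp
    then have x: "sl S ! j < n" using Sn by blast
    then have xW: "Suc (sl S ! j) \<le> W" "sl S ! j < Suc (Suc n)" using W by simp_all
    have inner: "exe (Cond (Mem (Elem k)) (SetReg rSEED (Plus (Elem k) (Num 1))) Skip)
        (v(rSEED := 0, rI := j), N, X) 20 (v(rSEED := if sl S ! j \<in> Z then Suc (sl S ! j) else 0,
            rI := j), N, X)"
      by (rule exe_le[OF exe_Cond[where t = 9]])
        (use j k X c lsl xW in \<open>auto simp: eval_input fun_upd_twist
            intro!: exe_conv[OF exe_SetReg] exe_conv[OF exe_Skip]\<close>)
    show "exe (Cond (Reg rSEED) Skip (Cond (Mem (Elem k)) (SetReg rSEED (Plus (Elem k) (Num 1)))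
        Skip))
      (with_var rI j (v(rSEED := ?f j), N, X)) 30 (with_var rI j (v(rSEED := ?f (Suc j)), N, X))"
    proof (cases "filter (\<lambda>x. x \<in> Z) (take j (sl S))")
      case Nil
      show ?thesis
        unfolding with_var_simp
        by (rule exe_le[OF exe_Cond[where t = 20]]) (use Nil inner j lsl in \<open>auto simp:
            take_Suc_nth\<close>)
    next
      case (Cons y ys)
      show ?thesis
        unfolding with_var_simp
        by (rule exe_le[OF exe_Cond[where t = 20]])
          (use Cons j lsl in \<open>auto simp: take_Suc_nth intro!: exe_conv[OF exe_Skip]\<close>)
    qed
  next
    show "(v(rSEED := Suc (seed F S)), N, X) = (v(rSEED := ?f (card S)), N, X)"
      unfolding last ..
  qed (use v k c lsl W in \<open>auto simp: fun_upd_idem\<close>)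
qed

lemma exe_OrderOf:
  assumes S: "S \<in> F" "S \<noteq> {}" and k: "3 \<le> k" "k < 12" "k \<noteq> aARG" "k \<noteq> aRES"
    and d: "3 \<le> d" "d < 12" "d \<noteq> aARG" "d \<noteq> aRES" "k \<noteq> d"
    and N: "N k = sl S" "N aARG = []" "N aRES = []" "N d = []" and X: "X 0 = Z" "X aMARK = {}"
    and v: "v rI = 0" "v rSEED = 0"
  shows "exe (OrderOf k d) (v, N, X) (600 * OT) (v, N(d := ord S), X)"
proof -
  let ?s = "seed F S"
  let ?P = "\<Pi> S ?s"
  have s: "?s \<in> S" "?s \<in> Z" "?s < n" using seed_in[OF S] Z_less by auto
  note P = order_facts[OF S(1) s(1,2)]
  have fin: "finite S" by (rule finite_sol[OF S(1)])
  have c: "card S \<le> n" "card S \<le> OT" "1 \<le> card S" using card_sol card_OT card_pos S by auto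
  have Sn: "\<forall>x\<in>set (sl S). x < n" using sol_less[OF S(1)] fin by auto
  have lsl: "length (sl S) = card S" using fin by simp
  obtain t where t: "sub Order (?s # sl S) = (?P, t)" "t \<le> OT"
    using run_order[OF S(1) s(1,2)] by (auto simp: runs_def)
  let ?v = "v(rSEED := Suc ?s)"
  have "exe (Find_Seed k) (v, N, X) (50 * OT + 20) (?v, N, X)"
    by (rule exe_Find_Seed) (use S k N X v in auto)
  also have "exe (Push aARG (Minus (Reg rSEED) (Num 1))) \<dots> 23 (?v, N(aARG := [?s]), X)"
    by (rule exe_conv[OF exe_Push]) (use N s W in auto)
  also have "exe (Copy k aARG) \<dots> (40 * OT + 20) (?v, N(aARG := ?s # sl S), X)"
    by (rule exe_conv[OF exe_Copy]) (use k N v c lsl in auto)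
  also have "exe (Call Order (Reg aARG) (Reg aRES)) \<dots> (3 + OT)
      (?v, N(aARG := ?s # sl S, aRES := ?P), X)"
    by (rule exe_conv[OF exe_Call[where t = t and xs = ?P]])
      (use N t bounds P W in \<open>auto intro: less_imp_le less_le_trans\<close>)
  also have "exe (Clear aARG) \<dots> (30 * OT + 35) (?v, N(aRES := ?P), X)"
    by (rule exe_conv[OF exe_Clear]) (use N c lsl in \<open>auto simp: fun_eq_iff\<close>)
  also have "exe (SetMarks aMARK k (Arr k (Num 0)) 1) \<dots> (24 * OT + 24)
      (?v, N(aRES := ?P), X(aMARK := S))"
    by (rule exe_conv[OF exe_SetMarks(1)[where m = "card S"]]) (use N k v X c lsl Sn fin in auto)
  also have "exe (Filter aMARK aRES d) \<dots> (60 * OT + 20)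
      (?v, N(aRES := ?P, d := ord S), X(aMARK := S))"
    by (rule exe_conv[OF exe_Filter]) (use N d v P in \<open>auto simp: solution_order_def\<close>)
  also have "exe (SetMarks aMARK k (Arr k (Num 0)) 0) \<dots> (24 * OT + 24)
      (?v, N(aRES := ?P, d := ord S), X)"
    by (rule exe_conv[OF exe_SetMarks(2)[where m = "card S"]])
      (use N k d v X c lsl Sn fin in \<open>auto simp: fun_upd_idem\<close>)
  also have "exe (Clear aRES) \<dots> (30 * OT + 5) (?v, N(d := ord S), X)"
    by (rule exe_conv[OF exe_Clear]) (use N d P in \<open>auto simp: fun_eq_iff\<close>)
  also have "exe (SetReg rSEED (Num 0)) \<dots> 2 (v, N(d := ord S), X)"
    by (rule exe_conv[OF exe_SetReg]) (use v in \<open>auto simp: fun_eq_iff\<close>)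
  finally show ?thesis
    unfolding OrderOf_def
    by (rule exe_le) (use c in simp)
qed

lemma exe_Complete:
  assumes T: "T \<in> F" "T \<noteq> {}" and k: "3 \<le> k" "k < 12" and d: "3 \<le> d" "d < 12"
    and N: "N k = sl T" "N d = []"
  shows "exe (Call Complete (Reg k) (Reg d)) (v, N, X) (3 + CT) (v, N(d := sl (cmp T)), X)"
proof -
  obtain t where t: "sub Complete (sl T) = (sl (cmp T), t)" "t \<le> CT"
    using run_comp[OF T] by (auto simp: runs_def)
  have E: "cmp T \<in> F" using comp_maximal[OF T] maximal_sol by auto
  have "length (sl (cmp T)) \<le> n" using card_sol[OF E] by simp
  moreover have "\<forall>x\<in>set (sl (cmp T)). x \<le> W"
    using sol_less[OF E] W finite_sol[OF E] by fastforce
  ultimately show ?thesis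
    using k d N t bounds by (intro exe_conv[OF exe_Call[where t = t and xs = "sl (cmp T)"]]) auto
qed

text \<open>Running times dominate result lengths. \<open>Order\<close> and \<open>Complete\<close>
  list all of \<open>S\<close>, and for \<open>w\<close> in \<open>S\<close> the result of
  \<open>Neighbors\<close> contains \<open>S\<close> behind two counts. Hence linear work on a
  maximal solution is absorbed in any of these times.\<close>

lemma card_maximal:
  assumes "S \<in> maximal F"
  shows "card S \<le> CT" "card S \<le> OT" "card S + 2 \<le> RT" "1 \<le> card S"
proof -
  have S: "S \<in> F" "S \<noteq> {}" using assms maximal_sol maximal_nonempty by auto
  show "card S \<le> OT" "1 \<le> card S" using card_OT card_pos S by auto
  show "card S \<le> CT" using run_comp[OF S] comp_of_maximal[OF assms] by (auto simp: runs_def)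
  obtain w where w: "w \<in> S" using S by auto
  have wn: "w < n" using sol_less[OF S(1) w] .
  have "set (nb S w) = {S}"
    using nb[OF assms, of w] neighbors_of_member[OF assms w] wn by simp
  then have "nb S w \<noteq> []" "\<forall>D\<in>set (nb S w). D = S" by auto
  then have "nb S w ! 0 = S" "0 < length (nb S w)" by auto
  moreover from this have "offset (nb S w) (Suc 0) \<le> length (enc (nb S w)) + 1" "length (enc (nb S
      w)) \<le> RT"
    using offset_le run_nb[OF assms wn] by (auto simp: runs_def)
  ultimately show "card S + 2 \<le> RT"
    using offset_Suc[of 0 "nb S w"] by simp
qed

lemma exe_PreComp:
  assumes D: "D \<in> F" "D \<noteq> {}" and h: "1 \<le> h" "h \<le> length (ord D)" "v rH = h"
    and d: "d = aNEXT \<or> d = aCAND"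
    and N: "N aDD = sl D" "N aDORD = ord D" "N aARG = []" "N d = []" and X: "X aPRE = {}"
    and v: "v rI = 0"
  shows "exe (PreComp d) (v, N, X) (CT + 150 * OT + 100) (v, N(d := sl (cmp (set (take h (ord
      D))))), X)"
proof -
  let ?T = "set (take h (ord D))"
  have T: "?T \<in> F" "?T \<noteq> {}"
    using prefix_sol[OF D] prefix_seed(1)[OF D h(1)] by force+
  have fin: "finite D" "finite ?T" by (rule finite_sol[OF D(1)]) simp
  have c: "card D \<le> n" "card D \<le> OT" using card_sol card_OT D by auto
  have TD: "?T \<subseteq> D" using set_take_subset[of h "ord D"] set_ord[OF D] by simp
  have cT: "card ?T \<le> card D" by (rule card_mono[OF fin(1) TD])
  have Dn: "\<forall>x\<in>set (sl D). x < n" "\<forall>x\<in>set (ord D). x < n"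
    using sol_less[OF D(1)] fin set_ord[OF D] by auto
  have lo: "length (ord D) = card D" by (rule length_ord[OF D])
  have "filter (\<lambda>x. x \<in> ?T) (sl D) = sl {x \<in> D. x \<in> ?T}" by (rule filter_sl[OF fin(1)])
  also have "{x \<in> D. x \<in> ?T} = ?T" using TD by auto
  finally have fil: "filter (\<lambda>x. x \<in> ?T) (sl D) = sl ?T" .
  have "exe (SetMarks aPRE aDORD (Reg rH) 1) (v, N, X) (21 * OT + 21) (v, N, X(aPRE := ?T))"
    by (rule exe_conv[OF exe_SetMarks(1)[where m = h]]) (use N h v X c lo Dn in auto)
  also have "exe (Filter aPRE aDD aARG) \<dots> (60 * OT + 20) (v, N(aARG := sl ?T), X(aPRE := ?T))"
    by (rule exe_conv[OF exe_Filter]) (use N v c fil Dn in auto)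
  also have "exe (SetMarks aPRE aDORD (Reg rH) 0) \<dots> (21 * OT + 21) (v, N(aARG := sl ?T), X)"
    by (rule exe_conv[OF exe_SetMarks(2)[where m = h]]) (use N h v X c lo Dn in \<open>auto simp:
        fun_upd_idem\<close>)
  also have "exe (Call Complete (Reg aARG) (Reg d)) \<dots> (3 + CT)
      (v, N(aARG := sl ?T, d := sl (cmp ?T)), X)"
    by (rule exe_Complete[OF T]) (use d N in auto)
  also have "exe (Clear aARG) \<dots> (30 * OT + 5) (v, N(d := sl (cmp ?T)), X)"
    by (rule exe_conv[OF exe_Clear]) (use N d c cT in \<open>auto simp: fun_eq_iff\<close>)
  finally show ?thesis
    unfolding PreComp_def
    by (rule exe_le) simp
qed

lemma exe_Fetch:
  assumes P: "P \<in> maximal F" and w: "w < n" and k: "3 \<le> k" "k < 12" "k \<noteq> aARG"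
    and N: "N k = sl P" "N aARG = []" "N aNB = []" and v: "v rI = 0"
    and e: "eval e (conc (v, N, X)) = w"
  shows "exe (Fetch k e) (v, N, X) (150 * RT + cost e) (v, N(aNB := enc (nb P w)), X)"
proof -
  obtain t where t: "sub Neighbors (w # sl P) = (enc (nb P w), t)" "t \<le> RT" "length (enc (nb P w))
      \<le> RT"
    using run_nb[OF P w] by (auto simp: runs_def)
  have PF: "P \<in> F" using maximal_sol[OF P] .
  have c: "card P + 2 \<le> RT" "card P \<le> n" using card_maximal[OF P] card_sol[OF PF] by auto
  have lsl: "length (sl P) = card P" by simp
  have "\<forall>x\<in>set (enc (nb P w)). x \<le> W"
  proof
    fix x assume "x \<in> set (enc (nb P w))"
    then consider "x = length (nb P w)" | D where "D \<in> set (nb P w)" "x = card D \<or> x \<in> set (sl D)"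
      by (auto simp: enc_def)
    then show "x \<le> W"
    proof cases
      case 1
      then show ?thesis using length_nb[OF P w] bounds by simp
    next
      case 2
      then have DF: "D \<in> F" using nb_maximal(1)[OF P _ 2(1)] w maximal_sol by auto
      then show ?thesis using 2 card_sol[OF DF] sol_less[OF DF] finite_sol[OF DF] W by fastforce
    qed
  qed
  note xs = this
  have "exe (Push aARG e) (v, N, X) (20 + cost e) (v, N(aARG := [w]), X)"
    by (rule exe_conv[OF exe_Push]) (use N w e W in auto)
  also have "exe (Copy k aARG) \<dots> (40 * RT + 20) (v, N(aARG := w # sl P), X)"
    by (rule exe_conv[OF exe_Copy]) (use k N v c lsl in auto)
  also have "exe (Call Neighbors (Reg aARG) (Reg aNB)) \<dots> (3 + RT)
      (v, N(aARG := w # sl P, aNB := enc (nb P w)), X)"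
    by (rule exe_conv[OF exe_Call[where t = t and xs = "enc (nb P w)"]]) (use N t bounds xs in auto)
  also have "exe (Clear aARG) \<dots> (30 * RT + 5) (v, N(aNB := enc (nb P w)), X)"
    by (rule exe_conv[OF exe_Clear]) (use N c lsl in \<open>auto simp: fun_eq_iff\<close>)
  finally show ?thesis
    unfolding Fetch_def
    by (rule exe_le) (use c in simp)
qed

lemma exe_Prox:
  assumes A: "A \<in> maximal F" and S: "S \<in> maximal F"
    and N: "N aWALK = sl A" "N aORD = ord S" and X: "X aMARK = {}" and v: "v rI = 0" "v rH = 0"
  shows "exe Prox (v, N, X) (100 * OT + 100) (v(rH := Suc (prox A S)), N, X)"
proof -
  have F: "A \<in> F" "A \<noteq> {}" "S \<in> F" "S \<noteq> {}"
    using A S maximal_sol maximal_nonempty by auto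
  have c: "card A \<le> n" "card A \<le> OT" "card S \<le> n" "card S \<le> OT"
    using card_sol F card_maximal A S by auto
  have lo: "length (ord S) = card S" by (rule length_ord[OF F(3,4)])
  have fin: "finite A" by (rule finite_sol[OF F(1)])
  have lsl: "length (sl A) = card A" by simp
  have An: "\<forall>x\<in>set (sl A). x < n" "\<forall>x\<in>set (ord S). x < n"
    using sol_less F fin set_ord[OF F(3,4)] by auto
  let ?f = "\<lambda>j. length (takeWhile (\<lambda>x. x \<in> A) (take j (ord S)))"
  have pn: "prox A S \<le> n"
    using length_takeWhile_le[of "\<lambda>x. x \<in> A" "ord S"] lo c unfolding prox_def by simp
  have "exe (SetMarks aMARK aWALK (Arr aWALK (Num 0)) 1) (v, N, X) (24 * OT + 24)
      (v, N, X(aMARK := A))"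
    by (rule exe_conv[OF exe_SetMarks(1)[where m = "card A"]]) (use N v X c lsl An fin in auto)
  also have "exe (For rI (Arr aORD (Num 0)) (Cond (Minus (Reg rI) (Reg rH)) Skip
             (Cond (Arr aMARK (Elem aORD)) (SetReg rH (Plus (Reg rH) (Num 1))) Skip))) \<dots> (35 * OT
                 + 20)
      (v(rH := prox A S), N, X(aMARK := A))"
  proof (rule exe_conv[OF exe_For[where m = "card S" and t = "\<lambda>_. 24" and f = "\<lambda>j. (v(rH := ?f j),
      N, X(aMARK := A))"]])
    fix j assume j: "j < card S"
    have "ord S ! j \<in> set (ord S)" using j lo by simp
    then have x: "ord S ! j < n" using An by blast
    have fj: "?f j \<le> j" using length_takeWhile_le[of "\<lambda>x. x \<in> A" "take j (ord S)"] by simp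
    have Suc: "?f (Suc j) = (if ?f j = j \<and> ord S ! j \<in> A then Suc j else ?f j)"
      using j lo by (intro length_takeWhile_take_Suc) simp
    have inner: "exe (Cond (Arr aMARK (Elem aORD)) (SetReg rH (Plus (Reg rH) (Num 1))) Skip)
       (v(rH := j, rI := j), N, X(aMARK := A)) 16 (v(rH := if ord S ! j \<in> A then Suc j else j, rI
           := j), N, X(aMARK := A))"
      by (rule exe_le[OF exe_Cond[where t = 4]])
        (use j x N c lo W in \<open>auto simp: fun_upd_twist intro!: exe_conv[OF exe_SetReg] exe_conv[OF
            exe_Skip]\<close>)
    show "exe (Cond (Minus (Reg rI) (Reg rH)) Skip
             (Cond (Arr aMARK (Elem aORD)) (SetReg rH (Plus (Reg rH) (Num 1))) Skip))
      (with_var rI j (v(rH := ?f j), N, X(aMARK := A))) 24 (with_var rI j (v(rH := ?f (Suc j)), N,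
          X(aMARK := A)))"
    proof (cases "?f j = j")
      case True
      show ?thesis
        unfolding with_var_simp Suc True
        by (rule exe_le[OF exe_Cond[where t = 16]]) (use inner in auto)
    next
      case False
      then have f: "?f (Suc j) = ?f j" "?f j < j" using Suc fj by auto
      show ?thesis
        unfolding with_var_simp
        by (rule exe_le[OF exe_Cond[where t = 16]]) (use f in \<open>auto intro!: exe_conv[OF exe_Skip]\<close>)
    qed
  qed (use v N c lo W in \<open>auto simp: prox_def fun_upd_idem\<close>)
  also have "exe (SetMarks aMARK aWALK (Arr aWALK (Num 0)) 0) \<dots> (24 * OT + 24)
      (v(rH := prox A S), N, X)"
    by (rule exe_conv[OF exe_SetMarks(2)[where m = "card A"]]) (use N v X c lsl An fin in \<open>auto
        simp: fun_upd_idem\<close>)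
  also have "exe (SetReg rH (Plus (Reg rH) (Num 1))) \<dots> 4 (v(rH := Suc (prox A S)), N, X)"
    by (rule exe_conv[OF exe_SetReg]) (use pn W in auto)
  finally show ?thesis
    unfolding Prox_def
    by (rule exe_le) simp
qed

lemma exe_Locate:
  assumes D: "D \<in> F" "w \<in> D" and N: "N aDORD = ord D" and v: "v rI = 0" "v rH = 0" "v rW = w"
  shows "exe Locate (v, N, X) (50 * OT + 20) (v(rH := Suc (position (ord D) w)), N, X)"
proof -
  have ne: "D \<noteq> {}" using D by auto
  have c: "card D \<le> n" "card D \<le> OT" using card_sol card_OT D ne by auto
  have lo: "length (ord D) = card D" by (rule length_ord[OF D(1) ne])
  let ?f = "\<lambda>j. if w \<in> set (take j (ord D)) then Suc (position (ord D) w) else 0"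
  have pos: "position (ord D) w = j \<longleftrightarrow> ord D ! j = w" if "j < card D" for j
    using position_nth[OF distinct_ord[OF D(1) ne], of j] that lo nth_position[of w "ord D"]
        set_ord[OF D(1) ne] D
    by auto
  show ?thesis
    unfolding Locate_def
  proof (rule exe_conv[OF exe_For[where m = "card D" and t = "\<lambda>_. 30" and f = "\<lambda>j. (v(rH := ?f j),
      N, X)"]])
    fix j assume j: "j < card D"
    \<comment> \<open>The loop never breaks off, but the order is distinct, so the match is unique
      and is not overwritten.\<close>
    have notin: "w \<notin> set (take j (ord D))" if "ord D ! j = w"
      using that distinct_ord[OF D(1) ne] j lo
      by (auto simp: in_set_conv_nth nth_eq_iff_index_eq)
    show "exe (Cond (Differ (Elem aDORD) (Reg rW)) Skip (SetReg rH (Plus (Reg rI) (Num 1))))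
        (with_var rI j (v(rH := ?f j), N, X)) 30 (with_var rI j (v(rH := ?f (Suc j)), N, X))"
      unfolding with_var_simp
      by (rule exe_le[OF exe_Cond[where t = 4]])
        (use j N c lo v W pos[OF j] notin in \<open>auto simp: take_Suc_nth fun_upd_twist
            intro!: exe_conv[OF exe_SetReg] exe_conv[OF exe_Skip]\<close>)
  next
    show "(v(rH := Suc (position (ord D) w)), N, X) = (v(rH := ?f (card D)), N, X)"
      using lo set_ord[OF D(1) ne] D by simp
  qed (use v N c lo W in \<open>auto simp: fun_upd_idem\<close>)
qed

end

section \<open>Walks\<close>

text \<open>Since cell 0 of \<open>aORD\<close> is the length, cell \<open>rH = Suc prox\<close>
  holds the canonical extender. On arrival the step does not move: \<open>aWALK\<close>,
  \<open>rEXT\<close> and \<open>rHIT\<close> keep the parent and the slot.\<close>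

definition WalkStep :: com where
  "WalkStep = Prox ;; SetReg rEXT (Arr aORD (Reg rH)) ;; Fetch aWALK (Reg rEXT) ;;
    SetMarks aPRE aORD (Reg rH) 1 ;; Scan ;; SetMarks aPRE aORD (Reg rH) 0 ;;
    Extract (Minus (Reg rHIT) (Num 1)) ;; OrderOf aDD aDORD ;; EqUpto (Reg rH) aDORD aORD ;;
    Cond (Reg rEQ) (PreComp aNEXT) (Copy aDD aNEXT) ;; Clear aDD ;; Clear aDORD ;;
    SetReg rH (Num 0) ;; SetReg rEQ (Num 0) ;; Eq aNEXT aCAND ;;
    Cond (Reg rEQ) (SetReg rDONE (Num 1))
             (Clear aWALK ;; Copy aNEXT aWALK ;; SetReg rEXT (Num 0) ;; SetReg rHIT (Num 0)) ;;
               Clear aNEXT ;; SetReg rEQ (Num 0)"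

definition Walk :: com where
  "Walk = OrderOf aCAND aORD ;; Push aARG (Arr aORD (Num 1)) ;;
    Call Complete (Reg aARG) (Reg aWALK) ;; Clear aARG ;; Eq aWALK aCAND ;; SetReg rDONE (Reg rEQ)
        ;;
    SetReg rEQ (Num 0) ;; Loop (Minus (Num 1) (Reg rDONE)) WalkStep ;; SetReg rDONE (Num 0) ;;
    Clear aORD"

definition MakeCand :: com where
  "MakeCand = Extract (Reg rIDX) ;; OrderOf aDD aDORD ;; Locate ;; PreComp aCAND ;;
    SetReg rH (Num 0) ;; Clear aDD ;; Clear aDORD"

section \<open>Correctness and cost of walks\<close>

context enumeration
begin

lemma sl_eq_iff: "A \<in> F \<Longrightarrow> S \<in> F \<Longrightarrow> sl A = sl S \<longleftrightarrow> A = S"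
  using set_sl by metis

lemma unit_ge:
  assumes "S \<in> maximal F"
  shows "1 \<le> unit" "card S \<le> unit" "RT \<le> unit" "OT \<le> unit" "CT \<le> unit" "OT + RT + CT \<le> unit"
  using card_maximal[OF assms] by (auto simp: unit_def)

context
  fixes A S :: "nat set"
  assumes A: "A \<in> maximal F" and S: "S \<in> maximal F" and AS: "A \<noteq> S"
begin

lemma exe_WalkStep:
  assumes N: "N aCAND = sl S" "N aORD = ord S" "N aWALK = sl A"
      "N aARG = []" "N aRES = []" "N aDD = []" "N aDORD = []" "N aNEXT = []" "N aNB = []"
    and X: "X 0 = Z" "X aMARK = {}" "X aPRE = {}"
    and v: "v rI = 0" "v rJ = 0" "v rH = 0" "v rPTR = 0" "v rHIT = 0" "v rEXT = 0" "v rSEED = 0"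
      "v rEQ = 0" "v rCNT = 0"
  shows "exe WalkStep (v, N, X) (3000 * unit)
    (if advance S A = S then (v(rDONE := 1, rEXT := extender A S, rHIT := hit A S), N, X)
     else (v, N(aWALK := sl (advance S A)), X))"
proof -
  let ?w = "extender A S" and ?h = "Suc (prox A S)" and ?T = "target A S"
  let ?Ds = "nb A ?w" and ?D = "link A S" and ?E = "advance S A"
  have F: "A \<in> F" "A \<noteq> {}" "S \<in> F" "S \<noteq> {}"
    using A S maximal_sol maximal_nonempty by auto
  have wn: "?w < n" using extender_in(3)[OF A S AS] by simp
  have Dm: "?D \<in> maximal F" by (rule link_maximal[OF A S AS])
  have Em: "?E \<in> maximal F" by (rule advance_props(1)[OF A S AS])
  have DE: "?D \<in> F" "?D \<noteq> {}" "?E \<in> F" "?E \<noteq> {}"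
    using Dm Em maximal_sol maximal_nonempty by auto
  have lo: "length (ord S) = card S" "length (ord ?D) = card ?D"
    using length_ord F DE by auto
  have px: "prox A S < card S" using prox_less[OF A S AS] lo by simp
  have c: "card S \<le> n" "card ?D \<le> n" "card ?E \<le> n" "card A \<le> n" using card_sol F DE by auto
  have cu: "card S \<le> unit" "card ?D \<le> unit" "card ?E \<le> unit" "card A \<le> unit" "1 \<le> unit"
     "OT \<le> unit" "RT \<le> unit" "CT \<le> unit" "CT + OT \<le> unit"
    using unit_ge A S Dm Em by (auto simp: unit_def)
  have lsl: "length (sl B) = card B" for B by simp
  have tlen: "take ?h (ord S) \<noteq> []" "card ?T = ?h"
    using px lo distinct_card[OF distinct_take[OF distinct_ord[OF F(3,4)], of ?h]]
    by (auto simp: target_def)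
  \<comment> \<open>The item contains the target, so its order is long enough to be compared with
    the prefix.\<close>
  have hD: "?h \<le> card ?D"
    using card_mono[OF finite_sol[OF DE(1)] hit_props(3)[OF A S AS]] tlen by simp
  have len: "length (enc ?Ds) \<le> RT"
    using run_nb[OF A wn] by (auto simp: runs_def)
  have Sn: "\<forall>x\<in>set (ord S). x < n"
    using sol_less[OF F(3)] set_ord[OF F(3,4)] by auto
  have Dsn: "\<forall>B\<in>set ?Ds. B \<subseteq> {..<n}"
    using nb_maximal(1)[OF A] wn maximal_sol sol_subset by blast
  have hit: "hit A S - 1 < length ?Ds" "?Ds ! (hit A S - 1) = ?D"
    using hit_props(1,2)[OF A S AS] by (auto simp: link_def)
  let ?v2 = "v(rH := ?h, rEXT := ?w)" and ?v5 = "v(rH := ?h, rEXT := ?w, rHIT := hit A S)"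
  have fol: "follows A S \<longleftrightarrow> take ?h (ord ?D) = take ?h (ord S)"
    by (simp add: follows_def)
  let ?v9 = "?v5(rEQ := if follows A S then 1 else 0)"
  let ?v14 = "v(rEXT := ?w, rHIT := hit A S)"
  let ?v15 = "?v14(rEQ := if ?E = S then 1 else 0)"
  let ?\<sigma> = "if ?E = S then (v(rDONE := 1, rEXT := ?w, rHIT := hit A S, rEQ := 1), N(aNEXT := sl
      ?E), X)
    else (v, N(aNEXT := sl ?E, aWALK := sl ?E), X)"
  let ?\<tau> = "if ?E = S then (v(rDONE := 1, rEXT := ?w, rHIT := hit A S, rEQ := 1), N, X)
    else (v, N(aWALK := sl ?E), X)"
  have "exe Prox (v, N, X) (200 * unit) (v(rH := ?h), N, X)"
    by (rule exe_le[OF exe_Prox[OF A S]]) (use N X v cu in auto)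
  also have "exe (SetReg rEXT (Arr aORD (Reg rH))) \<dots> (6 * unit) (?v2, N, X)"
    by (rule exe_conv[OF exe_SetReg]) (use N px lo c W wn cu in \<open>auto simp: extender_def\<close>)
  also have "exe (Fetch aWALK (Reg rEXT)) \<dots> (151 * unit) (?v2, N(aNB := enc ?Ds), X)"
    by (rule exe_le[OF exe_Fetch[OF A wn]]) (use N v cu in auto)
  also have "exe (SetMarks aPRE aORD (Reg rH) 1) \<dots> (42 * unit)
      (?v2, N(aNB := enc ?Ds), X(aPRE := ?T))"
    by (rule exe_conv[OF exe_SetMarks(1)[where m = ?h]]) (use N X v px lo Sn cu in \<open>auto simp:
        target_def\<close>)
  also have "exe Scan \<dots> (150 * unit) (?v5, N(aNB := enc ?Ds), X(aPRE := ?T))"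
    by (rule exe_conv[OF exe_Scan[where T = ?T and Ds = ?Ds]])
      (use v tlen(2) Dsn len bounds cu in \<open>auto simp: hit_def target_def\<close>)
  also have "exe (SetMarks aPRE aORD (Reg rH) 0) \<dots> (42 * unit) (?v5, N(aNB := enc ?Ds), X)"
    by (rule exe_conv[OF exe_SetMarks(2)[where m = ?h]])
      (use N X v px lo Sn cu in \<open>auto simp: target_def fun_upd_idem\<close>)
  also have "exe (Extract (Minus (Reg rHIT) (Num 1))) \<dots> (103 * unit) (?v5, N(aDD := sl ?D), X)"
    by (rule exe_conv[OF exe_Extract[where Ds = ?Ds and j = "hit A S - 1"]])
      (use v N hit sol_subset[OF DE(1)] len bounds cu in \<open>auto simp: fun_eq_iff\<close>)
  also have "exe (OrderOf aDD aDORD) \<dots> (600 * unit) (?v5, N(aDD := sl ?D, aDORD := ord ?D), X)"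
    by (rule exe_le[OF exe_OrderOf[OF DE(1,2)]]) (use N X v cu in auto)
  also have "exe (EqUpto (Reg rH) aDORD aORD) \<dots> (122 * unit)
      (?v9, N(aDD := sl ?D, aDORD := ord ?D), X)"
    unfolding fol
    by (rule exe_conv[OF exe_EqUpto[where m = ?h]]) (use N v px hD lo cu in auto)
  also have "exe (Cond (Reg rEQ) (PreComp aNEXT) (Copy aDD aNEXT)) \<dots> (400 * unit)
      (?v9, N(aDD := sl ?D, aDORD := ord ?D, aNEXT := sl ?E), X)"
  proof (rule exe_le[OF exe_Cond[where t = "300 * unit"]])
    assume "eval (Reg rEQ) (conc (?v9, N(aDD := sl ?D, aDORD := ord ?D), X)) \<noteq> 0"
    then have "follows A S" by (simp split: if_splits)
    then have "cmp (set (take ?h (ord ?D))) = ?E"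
      by (simp add: advance_def target_def fol)
    then show "exe (PreComp aNEXT) (?v9, N(aDD := sl ?D, aDORD := ord ?D), X) (300 * unit)
        (?v9, N(aDD := sl ?D, aDORD := ord ?D, aNEXT := sl ?E), X)"
      by (intro exe_conv[OF exe_PreComp[OF DE(1,2), where h = ?h]]) (use N X v hD lo cu in auto)
  next
    assume "eval (Reg rEQ) (conc (?v9, N(aDD := sl ?D, aDORD := ord ?D), X)) = 0"
    then have "\<not> follows A S" by (simp split: if_splits)
    then have "?D = ?E" by (simp add: advance_def)
    then show "exe (Copy aDD aNEXT) (?v9, N(aDD := sl ?D, aDORD := ord ?D), X) (300 * unit)
        (?v9, N(aDD := sl ?D, aDORD := ord ?D, aNEXT := sl ?E), X)"
      by (intro exe_conv[OF exe_Copy]) (use N v lsl c cu in auto)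
  qed (use cu in simp)
  also have "exe (Clear aDD) \<dots> (35 * unit) (?v9, N(aDORD := ord ?D, aNEXT := sl ?E), X)"
    by (rule exe_conv[OF exe_Clear]) (use N lsl cu in \<open>auto simp: fun_eq_iff\<close>)
  also have "exe (Clear aDORD) \<dots> (35 * unit) (?v9, N(aNEXT := sl ?E), X)"
    by (rule exe_conv[OF exe_Clear]) (use N lo cu in \<open>auto simp: fun_eq_iff\<close>)
  also have "exe (SetReg rH (Num 0)) \<dots> (2 * unit) (?v9(rH := 0), N(aNEXT := sl ?E), X)"
    by (rule exe_conv[OF exe_SetReg]) (use cu in auto)
  also have "exe (SetReg rEQ (Num 0)) \<dots> (2 * unit) (?v14, N(aNEXT := sl ?E), X)"
    by (rule exe_conv[OF exe_SetReg]) (use cu v in \<open>auto simp: fun_eq_iff\<close>)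
  also have "exe (Eq aNEXT aCAND) \<dots> (200 * unit) (?v15, N(aNEXT := sl ?E), X)"
    by (rule exe_conv[OF exe_Eq]) (use N v lsl cu sl_eq_iff[OF DE(3) F(3)] in auto)
  also have "exe (Cond (Reg rEQ) (SetReg rDONE (Num 1))
             (Clear aWALK ;; Copy aNEXT aWALK ;; SetReg rEXT (Num 0) ;;
               SetReg rHIT (Num 0))) \<dots> (200 * unit)
      ?\<sigma>"
  proof (rule exe_le[OF exe_Cond[where t = "150 * unit"]])
    assume "eval (Reg rEQ) (conc (?v15, N(aNEXT := sl ?E), X)) \<noteq> 0"
    then have "?E = S" by (simp split: if_splits)
    then show "exe (SetReg rDONE (Num 1)) (?v15, N(aNEXT := sl ?E), X) (150 * unit) ?\<sigma>"
      by (intro exe_conv[OF exe_SetReg]) (use cu W in \<open>auto simp: fun_eq_iff\<close>)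
  next
    assume "eval (Reg rEQ) (conc (?v15, N(aNEXT := sl ?E), X)) = 0"
    then have ne: "?E \<noteq> S" by (simp split: if_splits)
    have "exe (Clear aWALK) (?v15, N(aNEXT := sl ?E), X) (35 * unit)
        (?v14, N(aNEXT := sl ?E, aWALK := []), X)"
      by (rule exe_conv[OF exe_Clear]) (use N v lsl cu ne in \<open>auto simp: fun_eq_iff\<close>)
    also have "exe (Copy aNEXT aWALK) \<dots> (60 * unit)
        (?v14, N(aNEXT := sl ?E, aWALK := sl ?E), X)"
      by (rule exe_conv[OF exe_Copy]) (use N v lsl c cu in auto)
    also have "exe (SetReg rEXT (Num 0)) \<dots> (2 * unit)
        (v(rHIT := hit A S), N(aNEXT := sl ?E, aWALK := sl ?E), X)"
      by (rule exe_conv[OF exe_SetReg]) (use v cu in \<open>auto simp: fun_eq_iff\<close>)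
    also have "exe (SetReg rHIT (Num 0)) \<dots> (2 * unit)
        (v, N(aNEXT := sl ?E, aWALK := sl ?E), X)"
      by (rule exe_conv[OF exe_SetReg]) (use v cu in \<open>auto simp: fun_eq_iff\<close>)
    finally show "exe (Clear aWALK ;; Copy aNEXT aWALK ;; SetReg rEXT (Num 0) ;;
      SetReg rHIT (Num 0))
       (?v15, N(aNEXT := sl ?E), X) (150 * unit) ?\<sigma>"
      by (rule exe_conv) (use ne in auto)
  qed (use cu in simp)
  also have "exe (Clear aNEXT) \<dots> (35 * unit) ?\<tau>"
    by (cases "?E = S"; simp only: if_True if_False simp_thms)
      (rule exe_conv[OF exe_Clear]; use N lsl cu in \<open>auto simp: fun_eq_iff\<close>)+
  also have "exe (SetReg rEQ (Num 0)) \<dots> (2 * unit)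
      (if ?E = S then (v(rDONE := 1, rEXT := ?w, rHIT := hit A S), N, X) else (v, N(aWALK := sl
          ?E), X))"
    by (cases "?E = S"; simp only: if_True if_False simp_thms)
      (rule exe_conv[OF exe_SetReg]; use v cu in \<open>auto simp: fun_eq_iff\<close>)+
  finally show ?thesis
    unfolding WalkStep_def
    by (rule exe_le) simp
qed

end

lemma exe_Walk:
  assumes S: "S \<in> maximal F"
    and N: "N aCAND = sl S" "N aORD = []" "N aWALK = []"
      "N aARG = []" "N aRES = []" "N aDD = []" "N aDORD = []" "N aNEXT = []" "N aNB = []"
    and X: "X 0 = Z" "X aMARK = {}" "X aPRE = {}"
    and v: "v rI = 0" "v rJ = 0" "v rH = 0" "v rPTR = 0" "v rHIT = 0" "v rEXT = 0" "v rSEED = 0"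
      "v rEQ = 0" "v rCNT = 0" "v rDONE = 0"
  shows "exe Walk (v, N, X) (5000 * (card S * unit))
    (if is_root S then (v, N(aWALK := sl S), X)
     else (v(rEXT := extender (parent S) S, rHIT := hit (parent S) S), N(aWALK := sl (parent S)),
         X))"
proof -
  let ?A0 = "cmp {seed F S}"
  have F: "S \<in> F" "S \<noteq> {}" using S maximal_sol maximal_nonempty by auto
  have s: "{seed F S} \<in> F" "seed F S \<in> Z" "seed F S < n" using seed_in[OF F] Z_less by (auto simp:
      singletons_def)
  have A0: "?A0 \<in> maximal F" using comp_singleton_maximal[OF s(2)] by simp
  have A0F: "?A0 \<in> F" using A0 maximal_sol by auto
  have lo: "length (ord S) = card S" by (rule length_ord[OF F])
  have o0: "ord S ! 0 = seed F S" "ord S \<noteq> []" using ord_0[OF F] ord_nonempty[OF F] by auto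
  have c: "card S \<le> n" "card ?A0 \<le> n" "1 \<le> card S" using card_sol F A0F card_pos by auto
  have cu: "card S \<le> unit" "card ?A0 \<le> unit" "1 \<le> unit" "OT \<le> unit" "CT \<le> unit"
    using unit_ge S A0 by auto
  have lsl: "length (sl B) = card B" for B by simp
  let ?N = "N(aORD := ord S)"
  let ?b = "if is_root S then 1 else 0 :: nat"
  let ?\<sigma> = "if is_root S then (v(rDONE := 1), ?N(aWALK := sl S), X)
     else (v(rDONE := 1, rEXT := extender (parent S) S, rHIT := hit (parent S) S), ?N(aWALK := sl
         (parent S)), X)"
  let ?\<tau> = "if is_root S then (v, ?N(aWALK := sl S), X)
     else (v(rEXT := extender (parent S) S, rHIT := hit (parent S) S), ?N(aWALK := sl (parent S)),
         X)"
  have le: "unit \<le> card S * unit" using c by simp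
  have "exe (OrderOf aCAND aORD) (v, N, X) (600 * unit) (v, ?N, X)"
    by (rule exe_le[OF exe_OrderOf[OF F]]) (use N X v cu in auto)
  also have "exe (Push aARG (Arr aORD (Num 1))) \<dots> (24 * unit) (v, ?N(aARG := [seed F S]), X)"
    by (rule exe_conv[OF exe_Push]) (use N o0 s W cu in \<open>auto simp: array_def Suc_le_eq\<close>)
  also have "exe (Call Complete (Reg aARG) (Reg aWALK)) \<dots> (4 * unit)
      (v, ?N(aARG := [seed F S], aWALK := sl ?A0), X)"
    by (rule exe_le[OF exe_Complete[OF s(1)]]) (use N cu in auto)
  also have "exe (Clear aARG) \<dots> (35 * unit) (v, ?N(aWALK := sl ?A0), X)"
    by (rule exe_conv[OF exe_Clear]) (use N cu in \<open>auto simp: fun_eq_iff\<close>)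
  also have "exe (Eq aWALK aCAND) \<dots> (200 * unit) (v(rEQ := ?b), ?N(aWALK := sl ?A0), X)"
    by (rule exe_conv[OF exe_Eq]) (use N v lsl cu sl_eq_iff[OF A0F F(1)] in \<open>auto simp:
        is_root_def\<close>)
  also have "exe (SetReg rDONE (Reg rEQ)) \<dots> (2 * unit)
      (v(rEQ := ?b, rDONE := ?b), ?N(aWALK := sl ?A0), X)"
    by (rule exe_conv[OF exe_SetReg]) (use cu W in auto)
  also have "exe (SetReg rEQ (Num 0)) \<dots> (2 * unit) (v(rDONE := ?b), ?N(aWALK := sl ?A0), X)"
    by (rule exe_conv[OF exe_SetReg]) (use v cu in \<open>auto simp: fun_eq_iff\<close>)
  also have "exe (Loop (Minus (Num 1) (Reg rDONE)) WalkStep) \<dots> (3004 * (card S * unit) + 4 * unit)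
      ?\<sigma>"
  proof (cases "is_root S")
    case True
    have "exe (Loop (Minus (Num 1) (Reg rDONE)) WalkStep) ((\<lambda>j::nat. (v(rDONE := 1), ?N(aWALK :=
        sl S), X)) 0)
      ((\<Sum>j<0::nat. 0 + (1 + cost (Minus (Num 1) (Reg rDONE)))) + (1 + cost (Minus (Num 1) (Reg
          rDONE))))
      (v(rDONE := 1), ?N(aWALK := sl S), X)"
      by (rule exe_Loop[where f = "\<lambda>j. (v(rDONE := 1), ?N(aWALK := sl S), X)"]) auto
    then have L: "exe (Loop (Minus (Num 1) (Reg rDONE)) WalkStep) (v(rDONE := 1), ?N(aWALK := sl
        S), X)
      (3004 * (card S * unit) + 4 * unit) (v(rDONE := 1), ?N(aWALK := sl S), X)"
      by (rule exe_le) (use cu in simp)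
    have "?A0 = S" using True by (simp add: is_root_def)
    then show ?thesis
      unfolding if_P[OF True] using L by simp
  next
    case False
    define l where "l = walk_length S"
    \<comment> \<open>The round that reaches \<open>S\<close> leaves the parent in
      \<open>aWALK\<close> and sets \<open>rDONE\<close> and the slot, so the state beyond index
      \<open>l\<close> is not the next solution of the walk.\<close>
    define f where "f j = (if j \<le> l then (v, ?N(aWALK := sl (walk S j)), X)
      else (v(rDONE := 1, rEXT := extender (parent S) S, rHIT := hit (parent S) S), ?N(aWALK := sl
          (parent S)), X))" for j
    have l: "Suc l \<le> card S" using walk_length_card[OF S False] by (simp add: l_def)
    have loop: "exe (Loop (Minus (Num 1) (Reg rDONE)) WalkStep) (f 0)
      ((\<Sum>j<Suc l. 3000 * unit + (1 + cost (Minus (Num 1) (Reg rDONE)))) + (1 + cost (Minus (Num 1)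
          (Reg rDONE))))
      (f (Suc l))"
    proof (rule exe_Loop)
      show "eval (Minus (Num 1) (Reg rDONE)) (conc (f (Suc l))) = 0" by (simp add: f_def)
      fix j assume j: "j < Suc l"
      then have jl: "j \<le> walk_length S" by (simp add: l_def)
      show "eval (Minus (Num 1) (Reg rDONE)) (conc (f j)) \<noteq> 0" using j v by (simp add: f_def)
      have fj: "f j = (v, ?N(aWALK := sl (walk S j)), X)" using j by (simp add: f_def)
      have fS: "f (Suc j) = (if advance S (walk S j) = S
          then (v(rDONE := 1, rEXT := extender (walk S j) S, rHIT := hit (walk S j) S), ?N(aWALK
              := sl (walk S j)), X)
          else (v, ?N(aWALK := sl (walk S j), aWALK := sl (advance S (walk S j))), X))"
      proof (cases "j = l")
        case True
        then have "walk S j = parent S" "advance S (walk S j) = S"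
          using walk_length_end[OF S False] by (simp_all add: parent_def l_def)
        then show ?thesis using True by (simp add: f_def)
      next
        case ne: False
        then have "advance S (walk S j) \<noteq> S" "Suc j \<le> l"
          using walk_length_less[OF S False] j by (auto simp: l_def)
        then show ?thesis by (simp add: f_def walk_def)
      qed
      show "exe WalkStep (f j) (3000 * unit) (f (Suc j))"
        unfolding fj fS
        by (rule exe_WalkStep[OF walk_before(1)[OF S False jl] S walk_before(2)[OF S False jl]])
            (use N X v in auto)
    qed
    have f0: "f 0 = (v(rDONE := ?b), ?N(aWALK := sl ?A0), X)"
      using False v by (simp add: f_def walk_def fun_upd_idem)
    have time: "(\<Sum>j<Suc l. 3000 * unit + (1 + cost (Minus (Num 1) (Reg rDONE)))) + (1 + cost
        (Minus (Num 1) (Reg rDONE)))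
       \<le> 3004 * (card S * unit) + 4 * unit"
    proof -
      have "Suc l * unit \<le> card S * unit" using l by (rule mult_le_mono1)
      moreover have "Suc l * 1 \<le> Suc l * unit" using cu(3) by (rule mult_le_mono2)
      moreover have "(\<Sum>j<Suc l. 3000 * unit + (1 + cost (Minus (Num 1) (Reg rDONE)))) = 3000 *
          (Suc l * unit) + 4 * Suc l"
        by simp
      ultimately show ?thesis using cu(3) by simp
    qed
    have fl: "f (Suc l) = ?\<sigma>" using False by (simp add: f_def)
    show ?thesis
      using exe_le[OF loop time] unfolding f0 fl .
  qed
  also have "exe (SetReg rDONE (Num 0)) \<dots> (2 * unit) ?\<tau>"
    by (cases "is_root S"; simp only: if_True if_False simp_thms)
      (rule exe_conv[OF exe_SetReg]; use v cu in \<open>auto simp: fun_eq_iff\<close>)+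
  also have "exe (Clear aORD) \<dots> (35 * unit)
      (if is_root S then (v, N(aWALK := sl S), X)
     else (v(rEXT := extender (parent S) S, rHIT := hit (parent S) S), N(aWALK := sl (parent S)),
         X))"
    by (cases "is_root S"; simp only: if_True if_False simp_thms)
      (rule exe_conv[OF exe_Clear]; use N lo cu in \<open>auto simp: fun_eq_iff\<close>)+
  finally show ?thesis
    unfolding Walk_def
    by (rule exe_le) (use le in linarith)
qed

lemma candidate_maximal:
  assumes P: "P \<in> maximal F" and w: "w < n" and i: "i < length (nb P w)"
  shows "candidate P w i \<in> maximal F"
proof -
  let ?D = "nb P w ! i"
  have D: "?D \<in> F" "w \<in> ?D" using nb_maximal[OF P, of w ?D] w i maximal_sol by auto
  then have ne: "?D \<noteq> {}" by auto
  have "set (take (Suc (position (ord ?D) w)) (ord ?D)) \<noteq> {}"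
    using prefix_seed(1)[OF D(1) ne, of "Suc (position (ord ?D) w)"] by force
  from comp_maximal[OF prefix_sol[OF D(1) ne] this] show ?thesis
    unfolding candidate_def by (rule conjunct1)
qed

lemma exe_MakeCand:
  assumes P: "P \<in> maximal F" and w: "w < n" and i: "i < length (nb P w)"
    and N: "N aNB = enc (nb P w)" "N aARG = []" "N aRES = []" "N aDD = []" "N aDORD = []" "N aCAND
        = []"
    and X: "X 0 = Z" "X aMARK = {}" "X aPRE = {}"
    and v: "v rI = 0" "v rH = 0" "v rPTR = 0" "v rSEED = 0" "v rW = w" "v rIDX = i"
  shows "exe MakeCand (v, N, X) (1300 * unit) (v, N(aNB := [], aCAND := sl (candidate P w i)), X)"
proof -
  let ?D = "nb P w ! i"
  let ?h = "Suc (position (ord ?D) w)"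
  have Dm: "?D \<in> maximal F" and wD: "w \<in> ?D" using nb_maximal[OF P, of w ?D] w i by auto
  then have D: "?D \<in> F" "?D \<noteq> {}" using maximal_sol by auto
  have lo: "length (ord ?D) = card ?D" by (rule length_ord[OF D])
  have h: "1 \<le> ?h" "?h \<le> length (ord ?D)"
    using position_less[of w "ord ?D"] set_ord[OF D] wD by auto
  have cu: "card ?D \<le> unit" "1 \<le> unit" "OT \<le> unit" "RT \<le> unit" "CT \<le> unit" "CT + OT \<le> unit"
    using unit_ge[OF Dm] by (auto simp: unit_def)
  have len: "length (enc (nb P w)) \<le> RT" using run_nb[OF P w] by (auto simp: runs_def)
  have lsl: "length (sl B) = card B" for B by simp
  let ?N = "N(aNB := [])"
  have "exe (Extract (Reg rIDX)) (v, N, X) (101 * unit) (v, ?N(aDD := sl ?D), X)"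
    by (rule exe_conv[OF exe_Extract[where Ds = "nb P w" and j = i]])
      (use v N i len bounds cu sol_subset[OF D(1)] in auto)
  also have "exe (OrderOf aDD aDORD) \<dots> (600 * unit) (v, ?N(aDD := sl ?D, aDORD := ord ?D), X)"
    by (rule exe_le[OF exe_OrderOf[OF D]]) (use N X v cu in auto)
  also have "exe Locate \<dots> (70 * unit) (v(rH := ?h), ?N(aDD := sl ?D, aDORD := ord ?D), X)"
    by (rule exe_le[OF exe_Locate[OF D(1) wD]]) (use v cu in auto)
  also have "exe (PreComp aCAND) \<dots> (300 * unit)
      (v(rH := ?h), ?N(aDD := sl ?D, aDORD := ord ?D, aCAND := sl (candidate P w i)), X)"
    by (rule exe_conv[OF exe_PreComp[OF D h]]) (use N X v cu in \<open>auto simp: candidate_def\<close>)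
  also have "exe (SetReg rH (Num 0)) \<dots> (2 * unit)
      (v, ?N(aDD := sl ?D, aDORD := ord ?D, aCAND := sl (candidate P w i)), X)"
    by (rule exe_conv[OF exe_SetReg]) (use v cu in \<open>auto simp: fun_eq_iff\<close>)
  also have "exe (Clear aDD) \<dots> (35 * unit)
      (v, ?N(aDORD := ord ?D, aCAND := sl (candidate P w i)), X)"
    by (rule exe_conv[OF exe_Clear]) (use N lsl cu in \<open>auto simp: fun_eq_iff\<close>)
  also have "exe (Clear aDORD) \<dots> (35 * unit) (v, ?N(aCAND := sl (candidate P w i)), X)"
    by (rule exe_conv[OF exe_Clear]) (use N lo cu in \<open>auto simp: fun_eq_iff\<close>)
  finally show ?thesis
    unfolding MakeCand_def
    by (rule exe_le) (use cu in simp)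
qed

end

section \<open>Traversal\<close>

text \<open>The same child may arise as a candidate in several slots; comparing node, index and
  element singles out the one at which its walk ends. A root fails since its walk leaves 0 in
  \<open>rHIT\<close>.\<close>

definition Test_Child :: com where
  "Test_Child = MakeCand ;; Walk ;; Eq aWALK aCUR ;;
    Cond (Differ (Reg rHIT) (Plus (Reg rIDX) (Num 1))) (SetReg rEQ (Num 0)) Skip ;;
    Cond (Differ (Reg rEXT) (Reg rW)) (SetReg rEQ (Num 0)) Skip ;; SetReg rEXT (Num 0) ;;
    SetReg rHIT (Num 0) ;; Clear aWALK"

definition Next_Cand :: com where
  "Next_Cand = Clear aCAND ;; SetReg rIDX (Plus (Reg rIDX) (Num 1))"

definition Down :: com where
  "Down = SetReg rEQ (Num 0) ;; Clear aCUR ;; Copy aCAND aCUR ;; Clear aCAND ;; SetReg rW (Num 0) ;;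
    SetReg rIDX (Num 0) ;; SetReg rPAR (Minus (Num 1) (Reg rPAR))"

text \<open>\<open>rHIT\<close> is one more than the index of the child's slot, so as the new
  \<open>rIDX\<close> it resumes the scan of the parent right behind the child. For a root it is 0
  and \<open>aCUR\<close> stays empty, which returns control to the search for roots.\<close>

definition Up :: com where
  "Up = Copy aCUR aCAND ;; Walk ;; Clear aCUR ;; Clear aCAND ;;
    Cond (Reg rHIT) (Copy aWALK aCUR) Skip ;; Clear aWALK ;; SetReg rW (Reg rEXT) ;;
    SetReg rIDX (Reg rHIT) ;; SetReg rEXT (Num 0) ;; SetReg rHIT (Num 0) ;;
    SetReg rPAR (Minus (Num 1) (Reg rPAR))"

definition Next_Slot :: com where
  "Next_Slot = Clear aNB ;; SetReg rIDX (Num 0) ;; SetReg rW (Plus (Reg rW) (Num 1))"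

definition Pre :: com where
  "Pre = Cond (Reg rPAR) Skip (Output (Reg aCUR))"

definition Post :: com where
  "Post = Cond (Reg rPAR) (Output (Reg aCUR)) Skip"

definition Branch :: com where
  "Branch = Cond (Reg rEQ) (Down ;; Pre) Next_Cand"

text \<open>Every iteration fetches the list for \<open>rW\<close> again, as testing a candidate
  uses up \<open>aNB\<close>. This costs one more \<open>RT\<close> per candidate and is dominated
  by the bound for the walk.\<close>

definition Node :: com where
  "Node = Cond (Minus (Reg 0) (Reg rW))
     (Fetch aCUR (Reg rW) ;; Cond (Minus (Arr aNB (Num 1)) (Reg rIDX))
        (Test_Child ;; Branch) Next_Slot)
     (Post ;; Up)"

text \<open>A root is the completion of its own seed. So an element of \<open>Z\<close> yields a
  root exactly if it is the seed of its completion, and no root is met twice.\<close>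

definition Try_Root :: com where
  "Try_Root = Push aARG (Reg rROOT) ;; Call Complete (Reg aARG) (Reg aCAND) ;; Clear aARG ;;
    Find_Seed aCAND ;; Cond (Differ (Reg rSEED) (Plus (Reg rROOT) (Num 1))) Skip (Copy aCAND aCUR)
        ;;
    Clear aCAND ;; SetReg rSEED (Num 0)"

text \<open>Roots have even depth, but leaving a tree flips the parity, hence the reset.\<close>

definition Next_Root :: com where
  "Next_Root = SetReg rPAR (Num 0) ;; Cond (Mem (Reg rROOT)) Try_Root Skip ;;
     SetReg rROOT (Plus (Reg rROOT) (Num 1))"

definition Root :: com where
  "Root = Next_Root ;; Cond (Arr aCUR (Num 0)) (Output (Reg aCUR)) Skip"

text \<open>The sum in the guard is a disjunction: ids are left to try, or a node is
  current.\<close>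

definition Traverse :: com where
  "Traverse = Loop (Plus (Minus (Reg 0) (Reg rROOT)) (Arr aCUR (Num 0))) (Cond (Arr aCUR (Num 0))
      Node Root)"

section \<open>Runs with outputs\<close>

context machine
begin

definition exo :: "nat \<Rightarrow> com \<Rightarrow> store \<Rightarrow> nat \<Rightarrow> nat list list \<Rightarrow> nat \<Rightarrow> store \<Rightarrow> bool" where
  "exo G c \<sigma> a out b \<sigma>' \<longleftrightarrow> (ok \<sigma> \<longrightarrow> ok \<sigma>' \<and>
     (\<exists>es. exec sub B c (conc \<sigma>) es (conc \<sigma>') \<and> paid G a es b \<and> outputs es = out))"

lemma exo_exe: "exe c \<sigma> t \<sigma>' \<Longrightarrow> t + b \<le> a \<Longrightarrow> exo G c \<sigma> a [] b \<sigma>'"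
  unfolding exe_def exo_def using paid_silent by (meson add_le_mono1 le_trans)

lemma exo_Seq:
  assumes "exo G c1 \<sigma> a out1 b \<tau>" "exo G c2 \<tau> b out2 d \<sigma>'"
  shows "exo G (Seq c1 c2) \<sigma> a (out1 @ out2) d \<sigma>'"
  unfolding exo_def
proof (intro impI)
  assume "ok \<sigma>"
  then obtain es fs where "exec sub B c1 (conc \<sigma>) es (conc \<tau>)" "paid G a es b" "outputs es = out1"
    "exec sub B c2 (conc \<tau>) fs (conc \<sigma>')" "paid G b fs d" "outputs fs = out2" "ok \<sigma>'"
    using assms unfolding exo_def by blast
  then show "ok \<sigma>' \<and> (\<exists>es. exec sub B (Seq c1 c2) (conc \<sigma>) es (conc \<sigma>') \<and> paid G a es d \<and>
      outputs es = out1 @ out2)"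
    by (intro conjI exI[of _ "es @ fs"]) (auto intro: exec.Seq paid_append)
qed

lemma exo_Cond:
  assumes "eval e (conc \<sigma>) \<noteq> 0 \<Longrightarrow> exo G c1 \<sigma> a out b \<sigma>'" "eval e (conc \<sigma>) = 0 \<Longrightarrow> exo G c2 \<sigma> a out b
      \<sigma>'"
    and "1 + cost e + a \<le> a'"
  shows "exo G (Cond e c1 c2) \<sigma> a' out b \<sigma>'"
  unfolding exo_def
proof (intro impI)
  assume o: "ok \<sigma>"
  obtain es where es: "if eval e (conc \<sigma>) \<noteq> 0 then exec sub B c1 (conc \<sigma>) es (conc \<sigma>') else exec
      sub B c2 (conc \<sigma>) es (conc \<sigma>')"
    "paid G a es b" "outputs es = out" and o': "ok \<sigma>'"
    using assms(1,2) o unfolding exo_def by (cases "eval e (conc \<sigma>) = 0") auto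
  have "exec sub B (Cond e c1 c2) (conc \<sigma>) (Tick (1 + cost e) # es) (conc \<sigma>')"
    using es(1) by (cases "eval e (conc \<sigma>) = 0") (auto simp del: plus_nat.add_Suc simp only:
        if_True if_False
      simp_thms intro: exec.CondTrue exec.CondFalse)
  moreover have "paid G a' (Tick (1 + cost e) # es) b"
    using es(2) assms(3) by (auto intro: paid_mono)
  ultimately show "ok \<sigma>' \<and> (\<exists>es. exec sub B (Cond e c1 c2) (conc \<sigma>) es (conc \<sigma>') \<and> paid G a' es b
      \<and> outputs es = out)"
    using o' es(3) by (intro conjI exI[of _ "Tick (1 + cost e) # es"]) auto
qed

lemma exo_Output:
  assumes "3 \<le> k" "k < 12" "2 + length (N k) \<le> a" "b \<le> G"
  shows "exo G (Output (Reg k)) (v, N, X) a [N k] b (v, N, X)"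
  unfolding exo_def
proof (intro impI conjI)
  assume o: "ok (v, N, X)"
  then show "ok (v, N, X)" .
  have "length (N k) < L" using ok_length[OF o assms(1,2)] by (simp add: L_def)
  moreover have "cells N X k = array (N k)" using assms by (simp add: fun_eq_iff cells.simps)
  ultimately have "read_list (snd (conc (v, N, X))) (eval (Reg k) (conc (v, N, X))) = N k"
    using assms read_list_raw[of k "N k" "cells N X" v]
    by (simp add: conc.simps eval.simps raw_var)
  from exec.Output[OF ok_fits[OF o] this[symmetric]] assms(3,4)
  show "\<exists>es. exec sub B (Output (Reg k)) (conc (v, N, X)) es (conc (v, N, X)) \<and> paid G a es b \<and>
      outputs es = [N k]"
    by (intro exI conjI) auto
qed

text \<open>A piece of a loop's run that need not reach its end. Such pieces can be chained along
  the forest; \<open>tour_Loop\<close> turns them into a complete run once the guard fails.\<close>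

inductive tour :: "nat \<Rightarrow> expr \<Rightarrow> com \<Rightarrow> store \<Rightarrow> nat \<Rightarrow> nat list list \<Rightarrow> nat \<Rightarrow> store \<Rightarrow> bool"
  for G :: nat and e :: expr and c :: com where
  stop: "b \<le> a \<Longrightarrow> tour G e c \<sigma> a [] b \<sigma>"
| step: "eval e (conc \<sigma>) \<noteq> 0 \<Longrightarrow> exo G c \<sigma> a' out1 d \<tau> \<Longrightarrow> 1 + cost e + a' \<le> a \<Longrightarrow>
    tour G e c \<tau> d out2 b \<sigma>' \<Longrightarrow> tour G e c \<sigma> a (out1 @ out2) b \<sigma>'"

lemma tour_mono: "tour G e c \<sigma> a out b \<sigma>' \<Longrightarrow> a \<le> a' \<Longrightarrow> tour G e c \<sigma> a' out b \<sigma>'"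
  by (induction arbitrary: a' rule: tour.induct) (auto intro: tour.intros le_trans)

lemma tour_trans: "tour G e c \<sigma> a out1 b \<tau> \<Longrightarrow> tour G e c \<tau> b out2 d \<sigma>' \<Longrightarrow> tour G e c \<sigma> a (out1 @
    out2) d \<sigma>'"
proof (induction rule: tour.induct)
  case (stop b a \<sigma>)
  then show ?case by (auto intro: tour_mono)
next
  case (step \<sigma> a' o1 d' \<tau>' a o2 b \<sigma>'')
  then show ?case by (simp only: append_assoc) (blast intro: tour.step)
qed

lemma tour_step:
  assumes "eval e (conc \<sigma>) \<noteq> 0" "exo G c \<sigma> a' out b \<sigma>'" "1 + cost e + a' \<le> a"
  shows "tour G e c \<sigma> a out b \<sigma>'"
  using tour.step[OF assms tour.stop[OF order_refl]] by simp

lemma tour_Loop: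
  "tour G e c \<sigma> a out b \<sigma>' \<Longrightarrow> eval e (conc \<sigma>') = 0 \<Longrightarrow> 1 + cost e + d \<le> b \<Longrightarrow> exo G (Loop e c) \<sigma> a out
      d \<sigma>'"
proof (induction rule: tour.induct)
  case (stop b a \<sigma>)
  have "ok \<sigma> \<Longrightarrow> exec sub B (Loop e c) (conc \<sigma>) [Tick (1 + cost e)] (conc \<sigma>)"
    using stop ok_fits by (intro exec.LoopFalse)
  moreover have "paid G a [Tick (1 + cost e)] d" using stop by simp
  ultimately show ?case
    unfolding exo_def by (intro impI conjI exI[of _ "[Tick (1 + cost e)]"]) simp_all
next
  case (step \<sigma> a' out1 d' \<tau> a out2 b \<sigma>')
  show ?case
    unfolding exo_def
  proof (intro impI)
    assume "ok \<sigma>"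
    then obtain es fs where es: "exec sub B c (conc \<sigma>) es (conc \<tau>)" "paid G a' es d'" "outputs es
        = out1"
      "exec sub B (Loop e c) (conc \<tau>) fs (conc \<sigma>')" "paid G d' fs d" "outputs fs = out2" "ok \<sigma>'"
      using step.hyps(2) step.IH[OF step.prems] unfolding exo_def by blast
    have "paid G a (Tick (1 + cost e) # es @ fs) d"
      using paid_append[OF es(2,5)] step.hyps(3) by (auto intro: paid_mono)
    then show "ok \<sigma>' \<and> (\<exists>es. exec sub B (Loop e c) (conc \<sigma>) es (conc \<sigma>') \<and> paid G a es d \<and> outputs
        es = out1 @ out2)"
      using exec.LoopTrue[OF step.hyps(1) es(1,4)] es(3,6,7)
      by (intro conjI exI[of _ "Tick (1 + cost e) # es @ fs"]) simp_all
  qed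
qed

end

section \<open>Cost of the parts of an iteration\<close>

context enumeration
begin

definition q :: nat where "q = Max (card ` F)"

lemma card_le_q: "S \<in> F \<Longrightarrow> card S \<le> q"
  unfolding q_def using finite_F by simp

definition unit_q :: nat where "unit_q = q * unit"

definition vars :: "nat \<Rightarrow> nat \<Rightarrow> nat \<Rightarrow> nat \<Rightarrow> nat \<Rightarrow> nat" where
  "vars x w i p = (\<lambda>_. 0)(rROOT := x, rW := w, rIDX := i, rPAR := p)"

definition lists :: "nat list \<Rightarrow> nat \<Rightarrow> nat list" where
  "lists C = (\<lambda>_. [])(aCUR := C)"

definition marks :: "nat \<Rightarrow> nat set" where
  "marks = (\<lambda>_. {})(0 := Z)"

text \<open>Everything that persists between iterations: the current node, the next id for a root,
  the next slot and the parity of the depth. No part of it grows with the depth.\<close>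

definition cfg :: "nat list \<Rightarrow> nat \<Rightarrow> nat \<Rightarrow> nat \<Rightarrow> nat \<Rightarrow> store" where
  "cfg C x w i p = (vars x w i p, lists C, marks)"

abbreviation fetched :: "nat set \<Rightarrow> nat \<Rightarrow> nat \<Rightarrow> nat \<Rightarrow> nat \<Rightarrow> store" where
  "fetched P x w i p \<equiv> (vars x w i p, (lists (sl P))(aNB := enc (nb P w)), marks)"

lemma vars_simps [simp]: "r < 23 \<Longrightarrow> vars x w i p r = 0" "vars x w i p 23 = x" "vars x w i p 24 = w"
  "vars x w i p 25 = i" "vars x w i p 26 = p"
  by (auto simp: vars_def)

lemma vars_upd [simp]: "(vars x w i p)(23 := y) = vars y w i p" "(vars x w i p)(24 := y) = vars x
    y i p"
  "(vars x w i p)(25 := y) = vars x w y p" "(vars x w i p)(26 := y) = vars x w i y"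
  "r < 23 \<Longrightarrow> (vars x w i p)(r := 0) = vars x w i p"
  by (auto simp: vars_def fun_eq_iff)

lemma lists_simps [simp]: "lists C 3 = C" "k \<noteq> 3 \<Longrightarrow> lists C k = []"
  "(lists C)(3 := D) = lists D" "k \<noteq> 3 \<Longrightarrow> (lists C)(k := []) = lists C"
  by (auto simp: lists_def fun_eq_iff)

lemma marks_simps [simp]: "marks 0 = Z" "k \<noteq> 0 \<Longrightarrow> marks k = {}"
  by (auto simp: marks_def)

definition is_child :: "nat set \<Rightarrow> nat \<Rightarrow> nat \<Rightarrow> bool" where
  "is_child P w i \<longleftrightarrow> (let S = candidate P w i in
     \<not> is_root S \<and> parent S = P \<and> extender P S = w \<and> hit P S = Suc i)"

context
  fixes P :: "nat set"
  assumes P: "P \<in> maximal F"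
begin

lemma node_facts: "P \<in> F" "P \<noteq> {}" "card P \<le> n" "card P \<le> unit" "1 \<le> unit" "1 \<le> card P" "unit \<le>
    unit_q"
    "card P + 2 \<le> RT" "RT \<le> unit" "card P * unit \<le> unit_q"
proof -
  show F: "P \<in> F" "P \<noteq> {}" using P maximal_sol maximal_nonempty by auto
  show "card P \<le> n" "card P \<le> unit" "1 \<le> unit" "card P + 2 \<le> RT" "RT \<le> unit" and c: "1 \<le> card P"
    using card_sol[OF F(1)] unit_ge[OF P] card_maximal[OF P] by auto
  have "card P \<le> q" by (rule card_le_q[OF F(1)])
  then show "card P * unit \<le> unit_q" unfolding unit_q_def by (rule mult_le_mono1)
  have "1 * unit \<le> card P * unit" using c by (rule mult_le_mono1)
  from this[simplified mult_1] show "unit \<le> unit_q" using \<open>card P * unit \<le> unit_q\<close> by (rule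
      le_trans)
qed

lemma exe_fetch_node:
  assumes "w < n"
  shows "exe (Fetch aCUR (Reg rW)) (cfg (sl P) x w i p) (151 * RT)
    (fetched P x w i p)"
  unfolding cfg_def by (rule exe_le[OF exe_Fetch[OF P assms]]) (use node_facts in auto)

lemma exe_no_more:
  assumes w: "w < n"
  shows "exe Next_Slot
    (fetched P x w i p) (50 * RT) (cfg (sl P) x (Suc w) 0 p)"
proof -
  have len: "length (enc (nb P w)) \<le> RT" using run_nb[OF P w] by (auto simp: runs_def)
  have "exe (Clear aNB) (fetched P x w i p) (30 * RT + 5)
      (vars x w i p, lists (sl P), marks)"
    by (rule exe_conv[OF exe_Clear]) (use len in auto)
  also have "exe (SetReg rIDX (Num 0)) \<dots> 2 (vars x w 0 p, lists (sl P), marks)"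
    by (rule exe_conv[OF exe_SetReg]) auto
  also have "exe (SetReg rW (Plus (Reg rW) (Num 1))) \<dots> 4
      (vars x (Suc w) 0 p, lists (sl P), marks)"
    by (rule exe_conv[OF exe_SetReg]) (use w W in auto)
  finally show ?thesis
    unfolding cfg_def Next_Slot_def by (rule exe_le) (use node_facts in simp)
qed

lemma exe_test_candidate:
  assumes w: "w < n" and i: "i < length (nb P w)"
  shows "exe Test_Child (fetched P x w i p)
    (7000 * unit_q) ((vars x w i p)(rEQ := if is_child P w i then 1 else 0),
      (lists (sl P))(aCAND := sl (candidate P w i)), marks)"
proof -
  let ?S = "candidate P w i"
  have S: "?S \<in> maximal F" by (rule candidate_maximal[OF P w i])
  then have SF: "?S \<in> F" using maximal_sol by auto
  let ?u = "vars x w i p" and ?N = "(lists (sl P))(aCAND := sl ?S)"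
  define Q where "Q = (if is_root ?S then ?S else parent ?S)"
  define g where "g = (if is_root ?S then 0 else extender (parent ?S) ?S)"
  define h where "h = (if is_root ?S then 0 else hit (parent ?S) ?S)"
  have QF: "Q \<in> maximal F" using parent_props(1)[OF S] S by (auto simp: Q_def)
  have Q: "Q \<in> F" "card Q \<le> unit" using QF maximal_sol unit_ge[OF QF] by auto
  have lsl: "length (sl B) = card B" for B by simp
  have cS: "card ?S * unit \<le> unit_q"
    using card_le_q[OF SF] unfolding unit_q_def by (rule mult_le_mono1)
  note pf = node_facts
  have iW: "Suc i \<le> W" using i length_nb[OF P w] bounds by simp
  let ?b1 = "if Q = P then 1 else 0 :: nat" and ?b2 = "if Q = P \<and> h = Suc i then 1 else 0 :: nat"
    and ?b3 = "if Q = P \<and> h = Suc i \<and> g = w then 1 else 0 :: nat"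
  \<comment> \<open>For a root \<open>h\<close> is 0 and equals no \<open>Suc i\<close>, so the test
    fails even if \<open>Q = P\<close>.\<close>
  have b3: "(Q = P \<and> h = Suc i \<and> g = w) \<longleftrightarrow> is_child P w i"
    by (auto simp: is_child_def Let_def Q_def h_def g_def)
  have "exe MakeCand (?u, (lists (sl P))(aNB := enc (nb P w)), marks) (1300 * unit) (?u, ?N, marks)"
    by (rule exe_conv[OF exe_MakeCand[OF P w i]]) (auto simp: fun_eq_iff)
  also have "exe Walk \<dots> (5000 * unit_q) (?u(rEXT := g, rHIT := h), ?N(aWALK := sl Q), marks)"
    by (rule exe_conv[OF exe_Walk[OF S]]) (use cS in \<open>auto simp: Q_def g_def h_def fun_eq_iff\<close>)
  also have "exe (Eq aWALK aCUR) \<dots> (200 * unit)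
      (?u(rEXT := g, rHIT := h, rEQ := ?b1), ?N(aWALK := sl Q), marks)"
    by (rule exe_conv[OF exe_Eq]) (use Q pf lsl sl_eq_iff[OF Q(1) pf(1)] in auto)
  also have "exe (Cond (Differ (Reg rHIT) (Plus (Reg rIDX) (Num 1))) (SetReg rEQ (Num 0)) Skip) \<dots>
      (14 * unit)
      (?u(rEXT := g, rHIT := h, rEQ := ?b2), ?N(aWALK := sl Q), marks)"
    by (rule exe_le[OF exe_Cond[where t = 2]])
      (use pf iW in \<open>auto simp: fun_eq_iff intro!: exe_conv[OF exe_SetReg] exe_conv[OF exe_Skip]\<close>)
  also have "exe (Cond (Differ (Reg rEXT) (Reg rW)) (SetReg rEQ (Num 0)) Skip) \<dots> (14 * unit)
      (?u(rEXT := g, rHIT := h, rEQ := ?b3), ?N(aWALK := sl Q), marks)"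
    by (rule exe_le[OF exe_Cond[where t = 2]])
      (use pf iW in \<open>auto simp: fun_eq_iff intro!: exe_conv[OF exe_SetReg] exe_conv[OF exe_Skip]\<close>)
  also have "exe (SetReg rEXT (Num 0)) \<dots> (2 * unit)
      (?u(rHIT := h, rEQ := ?b3), ?N(aWALK := sl Q), marks)"
    by (rule exe_conv[OF exe_SetReg]) (use pf in \<open>auto simp: fun_eq_iff\<close>)
  also have "exe (SetReg rHIT (Num 0)) \<dots> (2 * unit) (?u(rEQ := ?b3), ?N(aWALK := sl Q), marks)"
    by (rule exe_conv[OF exe_SetReg]) (use pf in \<open>auto simp: fun_eq_iff\<close>)
  also have "exe (Clear aWALK) \<dots> (35 * unit) (?u(rEQ := ?b3), ?N, marks)"
    by (rule exe_conv[OF exe_Clear]) (use pf Q lsl in \<open>auto simp: fun_eq_iff\<close>)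
  finally show ?thesis
    unfolding Test_Child_def b3[symmetric]
    by (rule exe_le)
      (use pf in simp)
qed

lemma exe_next:
  assumes w: "w < n" and i: "i < length (nb P w)"
  shows "exe Next_Cand (vars x w i p, (lists (sl P))(aCAND := sl (candidate P w i)), marks) (50 *
      unit)
    (cfg (sl P) x w (Suc i) p)"
proof -
  have S: "candidate P w i \<in> maximal F" by (rule candidate_maximal[OF P w i])
  have iW: "Suc i \<le> W" using i length_nb[OF P w] bounds by simp
  have "exe (Clear aCAND) (vars x w i p, (lists (sl P))(aCAND := sl (candidate P w i)), marks) (35
      * unit)
      (vars x w i p, lists (sl P), marks)"
    by (rule exe_conv[OF exe_Clear]) (use unit_ge[OF S] in auto)
  also have "exe (SetReg rIDX (Plus (Reg rIDX) (Num 1))) \<dots> 4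
      (vars x w (Suc i) p, lists (sl P), marks)"
    by (rule exe_conv[OF exe_SetReg]) (use iW in auto)
  finally show ?thesis
    unfolding Next_Cand_def cfg_def by (rule exe_le) (use node_facts in simp)
qed

lemma exe_Down:
  assumes S: "S \<in> maximal F" and p: "p \<le> 1"
  shows "exe Down ((vars x w i p)(rEQ := 1), (lists (sl P))(aCAND := sl S), marks) (200 * unit)
    (cfg (sl S) x 0 0 (1 - p))"
proof -
  have c: "card S \<le> n" using card_sol S maximal_sol by auto
  have lsl: "length (sl B) = card B" for B by simp
  note cu = node_facts(4,5) unit_ge[OF S]
  let ?u = "vars x w i p"
  have "exe (SetReg rEQ (Num 0)) (?u(rEQ := 1), (lists (sl P))(aCAND := sl S), marks) (2 * unit)
      (?u, (lists (sl P))(aCAND := sl S), marks)"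
    by (rule exe_conv[OF exe_SetReg]) (use cu in auto)
  also have "exe (Clear aCUR) \<dots> (35 * unit) (?u, (lists [])(aCAND := sl S), marks)"
    by (rule exe_conv[OF exe_Clear]) (use cu lsl in \<open>auto simp: fun_eq_iff\<close>)
  also have "exe (Copy aCAND aCUR) \<dots> (60 * unit) (?u, (lists (sl S))(aCAND := sl S), marks)"
    by (rule exe_conv[OF exe_Copy]) (use cu c lsl in \<open>auto simp: fun_eq_iff\<close>)
  also have "exe (Clear aCAND) \<dots> (35 * unit) (?u, lists (sl S), marks)"
    by (rule exe_conv[OF exe_Clear]) (use cu lsl in auto)
  also have "exe (SetReg rW (Num 0)) \<dots> (2 * unit) (vars x 0 i p, lists (sl S), marks)"
    by (rule exe_conv[OF exe_SetReg]) (use cu in auto)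
  also have "exe (SetReg rIDX (Num 0)) \<dots> (2 * unit) (vars x 0 0 p, lists (sl S), marks)"
    by (rule exe_conv[OF exe_SetReg]) (use cu in auto)
  also have "exe (SetReg rPAR (Minus (Num 1) (Reg rPAR))) \<dots> (4 * unit)
      (vars x 0 0 (1 - p), lists (sl S), marks)"
    by (rule exe_conv[OF exe_SetReg]) (use cu W in auto)
  finally show ?thesis
    unfolding Down_def cfg_def
    by (rule exe_le) simp
qed

lemma exe_Up:
  assumes p: "p \<le> 1"
  shows "exe Up (cfg (sl P) x w i p) (6000 * unit_q)
    (if is_root P then cfg [] x 0 0 (1 - p)
     else cfg (sl (parent P)) x (extender (parent P) P) (hit (parent P) P) (1 - p))"
proof -
  define Q where "Q = (if is_root P then P else parent P)"
  define C where "C = (if is_root P then [] else sl (parent P))"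
  define g where "g = (if is_root P then 0 else extender (parent P) P)"
  define h where "h = (if is_root P then 0 else hit (parent P) P)"
  \<comment> \<open>The slot of a non-root has a nonzero \<open>hit\<close>, so \<open>rHIT\<close>
    alone tells whether there is a parent to return to.\<close>
  have gh: "g \<le> W" "h \<le> W" "h = 0 \<longleftrightarrow> is_root P"
  proof -
    have "extender (parent P) P < n \<and> hit (parent P) P \<le> W \<and> hit (parent P) P \<noteq> 0" if "\<not> is_root P"
    proof -
      note pp = parent_props[OF P that]
      have w: "extender (parent P) P < n" using extender_in(3)[OF pp(1) P pp(2)] by simp
      show ?thesis
        using w hit_props(1,2)[OF pp(1) P pp(2)] length_nb[OF pp(1) w] bounds by simp
    qed
    then show "g \<le> W" "h \<le> W" "h = 0 \<longleftrightarrow> is_root P" using W by (auto simp: g_def h_def)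
  qed
  have QF: "Q \<in> maximal F" using parent_props(1)[OF P] P by (auto simp: Q_def)
  have Q: "Q \<in> F" "card Q \<le> unit" "card Q \<le> n" using QF maximal_sol unit_ge[OF QF] card_sol by auto
  have lsl: "length (sl B) = card B" for B by simp
  note pf = node_facts
  let ?u = "vars x w i p"
  let ?u2 = "?u(rEXT := g, rHIT := h)"
  let ?u7 = "(vars x g h p)(rEXT := g, rHIT := h)"
  have e: "cfg C x g h (1 - p) = (if is_root P then cfg [] x 0 0 (1 - p)
     else cfg (sl (parent P)) x (extender (parent P) P) (hit (parent P) P) (1 - p))"
    by (simp add: C_def g_def h_def)
  have "exe (Copy aCUR aCAND) (?u, lists (sl P), marks) (60 * unit)
      (?u, (lists (sl P))(aCAND := sl P), marks)"
    by (rule exe_conv[OF exe_Copy]) (use pf lsl in auto)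
  also have "exe Walk \<dots> (5000 * unit_q)
      (?u(rEXT := g, rHIT := h), (lists (sl P))(aCAND := sl P, aWALK := sl Q), marks)"
    by (rule exe_conv[OF exe_Walk[OF P]]) (use pf in \<open>auto simp: Q_def g_def h_def fun_eq_iff\<close>)
  also have "exe (Clear aCUR) \<dots> (35 * unit)
      (?u2, (lists [])(aCAND := sl P, aWALK := sl Q), marks)"
    by (rule exe_conv[OF exe_Clear]) (use pf lsl in \<open>auto simp: fun_eq_iff\<close>)
  also have "exe (Clear aCAND) \<dots> (35 * unit) (?u2, (lists [])(aWALK := sl Q), marks)"
    by (rule exe_conv[OF exe_Clear]) (use pf lsl in \<open>auto simp: fun_eq_iff\<close>)
  also have "exe (Cond (Reg rHIT) (Copy aWALK aCUR) Skip) \<dots> (70 * unit)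
      (?u2, (lists C)(aWALK := sl Q), marks)"
    by (rule exe_le[OF exe_Cond[where t = "60 * unit"]])
      (use pf Q lsl gh in \<open>auto simp: fun_eq_iff C_def Q_def split: if_splits
        intro!: exe_conv[OF exe_Copy] exe_conv[OF exe_Skip]\<close>)
  also have "exe (Clear aWALK) \<dots> (35 * unit) (?u2, lists C, marks)"
    by (rule exe_conv[OF exe_Clear]) (use pf Q lsl in \<open>auto simp: fun_eq_iff\<close>)
  also have "exe (SetReg rW (Reg rEXT)) \<dots> (2 * unit)
      ((vars x g i p)(rEXT := g, rHIT := h), lists C, marks)"
    by (rule exe_conv[OF exe_SetReg]) (use pf gh in \<open>auto simp: fun_eq_iff vars_def\<close>)
  also have "exe (SetReg rIDX (Reg rHIT)) \<dots> (2 * unit) (?u7, lists C, marks)"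
    by (rule exe_conv[OF exe_SetReg]) (use pf gh in \<open>auto simp: fun_eq_iff vars_def\<close>)
  also have "exe (SetReg rEXT (Num 0)) \<dots> (2 * unit)
      ((vars x g h p)(rHIT := h), lists C, marks)"
    by (rule exe_conv[OF exe_SetReg]) (use pf in \<open>auto simp: fun_eq_iff vars_def\<close>)
  also have "exe (SetReg rHIT (Num 0)) \<dots> (2 * unit) (vars x g h p, lists C, marks)"
    by (rule exe_conv[OF exe_SetReg]) (use pf in \<open>auto simp: fun_eq_iff vars_def\<close>)
  also have "exe (SetReg rPAR (Minus (Num 1) (Reg rPAR))) \<dots> (4 * unit) (cfg C x g h (1 - p))"
    unfolding cfg_def by (rule exe_conv[OF exe_SetReg]) (use pf W in auto)
  finally show ?thesis
    unfolding e[symmetric] cfg_def[of "sl P"] Up_def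
    by (rule exe_le)
      (use pf in simp)
qed

end

lemma exe_Root:
  assumes x: "x < n" and p: "p \<le> 1"
  shows "exe Next_Root (cfg [] x 0 0 p) (400 * unit)
    (cfg (if x \<in> Z \<and> seed F (cmp {x}) = x then sl (cmp {x}) else []) (Suc x) 0 0 0)"
proof -
  let ?C = "if x \<in> Z \<and> seed F (cmp {x}) = x then sl (cmp {x}) else []"
  obtain z where "z \<in> Z" using singleton by auto
  then have u1: "1 \<le> unit" using unit_ge(1) comp_singleton_maximal by blast
  have try_root: "exe Try_Root (cfg [] x 0 0 0) (350 * unit) (cfg ?C x 0 0 0)" if xZ: "x \<in> Z"
  proof -
    let ?S = "cmp {x}"
    have S: "?S \<in> maximal F" using comp_singleton_maximal[OF xZ] by simp
    have SF: "?S \<in> F" "?S \<noteq> {}" using S maximal_sol maximal_nonempty by auto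
    have xF: "{x} \<in> F" "{x} \<noteq> {}" using xZ by (auto simp: singletons_def)
    have c: "card ?S \<le> n" using card_sol SF by auto
    note cu = unit_ge[OF S]
    have lsl: "length (sl B) = card B" for B by simp
    let ?u = "vars x 0 0 0"
    have "exe (Push aARG (Reg rROOT)) (?u, lists [], marks) (21 * unit)
        (?u, (lists [])(aARG := [x]), marks)"
      by (rule exe_conv[OF exe_Push]) (use x W cu in auto)
    also have "exe (Call Complete (Reg aARG) (Reg aCAND)) \<dots> (4 * unit)
        (?u, (lists [])(aARG := [x], aCAND := sl ?S), marks)"
      by (rule exe_le[OF exe_Complete[OF xF]]) (use cu in auto)
    also have "exe (Clear aARG) \<dots> (35 * unit) (?u, (lists [])(aCAND := sl ?S), marks)"
      by (rule exe_conv[OF exe_Clear]) (use cu in \<open>auto simp: fun_eq_iff\<close>)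
    also have "exe (Find_Seed aCAND) \<dots> (70 * unit)
        (?u(rSEED := Suc (seed F ?S)), (lists [])(aCAND := sl ?S), marks)"
      by (rule exe_le[OF exe_Find_Seed[OF SF]]) (use cu in auto)
    also have "exe (Cond (Differ (Reg rSEED) (Plus (Reg rROOT) (Num 1))) Skip (Copy aCAND aCUR)) \<dots>
        (80 * unit)
        (?u(rSEED := Suc (seed F ?S)), (lists ?C)(aCAND := sl ?S), marks)"
      by (rule exe_le[OF exe_Cond[where t = "60 * unit"]])
        (use cu xZ lsl c in \<open>auto simp: fun_eq_iff intro!: exe_conv[OF exe_Copy] exe_conv[OF
            exe_Skip]\<close>)
    also have "exe (Clear aCAND) \<dots> (35 * unit) (?u(rSEED := Suc (seed F ?S)), lists ?C, marks)"
      by (rule exe_conv[OF exe_Clear]) (use cu lsl in \<open>auto simp: fun_eq_iff\<close>)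
    also have "exe (SetReg rSEED (Num 0)) \<dots> (2 * unit) (cfg ?C x 0 0 0)"
      unfolding cfg_def by (rule exe_conv[OF exe_SetReg]) (use cu in auto)
    finally show ?thesis
      unfolding Try_Root_def cfg_def[of "[]"]
      by (rule exe_le) simp
  qed
  have m: "eval (Mem (Reg rROOT)) (conc (cfg [] x 0 0 0)) = (if x \<in> Z then 1 else 0)"
    unfolding cfg_def by (subst eval_input) (use x in auto)
  have "exe (SetReg rPAR (Num 0)) (cfg [] x 0 0 p) (2 * unit) (cfg [] x 0 0 0)"
    unfolding cfg_def by (rule exe_conv[OF exe_SetReg]) (use u1 in auto)
  also have "exe (Cond (Mem (Reg rROOT)) Try_Root Skip) \<dots> (360 * unit) (cfg ?C x 0 0 0)"
    by (rule exe_le[OF exe_Cond[where t = "350 * unit"]])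
      (use try_root m u1 in \<open>auto intro!: exe_conv[OF exe_Skip] split: if_splits\<close>)
  also have "exe (SetReg rROOT (Plus (Reg rROOT) (Num 1))) \<dots> (4 * unit) (cfg ?C (Suc x) 0 0 0)"
    unfolding cfg_def by (rule exe_conv[OF exe_SetReg]) (use x W u1 in auto)
  finally show ?thesis
    unfolding Next_Root_def by (rule exe_le) simp
qed

end

section \<open>Credits of the traversal\<close>

context enumeration
begin

text \<open>Pays for one iteration that tests a candidate, at most \<open>7000 * unit_q\<close> and
  a fetch with small overhead, and also for one that leaves a node.\<close>

definition \<kappa> :: nat where "\<kappa> = 8000 * unit_q"

text \<open>The slots of one element \<open>w\<close>: at most \<open>RN\<close> tests, and one
  iteration that only finds the fetched list exhausted.\<close>

definition slot_cost :: nat where "slot_cost = 300 * RT + RN * \<kappa>"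

text \<open>At a node of even depth (\<open>p = 0\<close>), whose scan ends without an output, the reserve pays for
  leaving the node and scanning a node of odd depth, or else for the remaining search for a
  root.\<close>

definition reserve :: "nat \<Rightarrow> nat" where
  "reserve p = (if p = 1 then \<kappa> else n * slot_cost + (n + 4) * \<kappa>)"

text \<open>The potential at a slot. Each silent step to the next slot lowers it by at least the
  cost of that step, and at the end of the scan the reserve is left.\<close>

definition credit :: "nat \<Rightarrow> nat \<Rightarrow> nat \<Rightarrow> nat" where
  "credit w i p = n * slot_cost + reserve p - (w * slot_cost + i * \<kappa>)"

definition root_credit :: "nat \<Rightarrow> nat" where "root_credit x = (n - x) * \<kappa> + \<kappa>"

text \<open>A silent stretch covers at most two node scans and the moves between them, or one scan
  and the search for a root among at most \<open>n\<close> ids. The bound adds both cases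
  up.\<close>

definition gap_bound :: nat where "gap_bound = 2 * (n * slot_cost) + (n + 5) * \<kappa>"

abbreviation guard :: expr where
  "guard \<equiv> Plus (Minus (Reg 0) (Reg rROOT)) (Arr aCUR (Num 0))"

abbreviation body :: com where
  "body \<equiv> Cond (Arr aCUR (Num 0)) Node Root"

abbreviation "trav \<equiv> tour gap_bound guard body"
abbreviation "exob \<equiv> exo gap_bound"

lemma slot_le: "w < n \<Longrightarrow> i \<le> RN \<Longrightarrow> w * slot_cost + i * \<kappa> + 300 * RT \<le> Suc w * slot_cost"
  "w < n \<Longrightarrow> Suc w * slot_cost \<le> n * slot_cost"
proof -
  assume "i \<le> RN"
  then have "i * \<kappa> \<le> RN * \<kappa>" by (rule mult_le_mono1)
  then show "w * slot_cost + i * \<kappa> + 300 * RT \<le> Suc w * slot_cost"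
    by (simp add: slot_cost_def)
next
  assume "w < n"
  then show "Suc w * slot_cost \<le> n * slot_cost" by (intro mult_le_mono1) simp
qed

lemma credit_next: "w < n \<Longrightarrow> i < RN \<Longrightarrow> \<kappa> + credit w (Suc i) p \<le> credit w i p"
  using slot_le(1)[of w "Suc i"] slot_le(2)[of w] unfolding credit_def by simp

lemma credit_no_more: "w < n \<Longrightarrow> i \<le> RN \<Longrightarrow> 300 * RT + credit (Suc w) 0 p \<le> credit w i p"
  using slot_le(1)[of w i] slot_le(2)[of w] unfolding credit_def by simp

lemma credit_end: "credit n 0 p = reserve p"
  and credit_le: "credit w i p \<le> n * slot_cost + reserve p"
  by (simp_all add: credit_def)

lemma credit_reserve: "w < n \<Longrightarrow> i < RN \<Longrightarrow> \<kappa> + reserve p \<le> credit w i p"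
  using slot_le(1)[of w "Suc i"] slot_le(2)[of w] unfolding credit_def by simp

text \<open>The moves of the traversal as inequalities: the reserve of an even node covers the
  transition to an odd node with its full credit, or to the search for roots; after an output
  \<open>gap_bound\<close> covers the credit at any slot.\<close>

lemma reserves: "reserve 1 = \<kappa>" "reserve 0 = n * slot_cost + (n + 4) * \<kappa>"
  "gap_bound = n * slot_cost + reserve 0 + \<kappa>" "\<kappa> + credit w i 1 \<le> reserve 0"
  "\<kappa> + credit w i 0 \<le> gap_bound" "credit w i p \<le> gap_bound"
  "\<kappa> + root_credit x \<le> reserve 0" "root_credit x \<le> gap_bound"
proof -
  show r: "reserve 1 = \<kappa>" "reserve 0 = n * slot_cost + (n + 4) * \<kappa>"
    by (simp_all add: reserve_def)
  show g: "gap_bound = n * slot_cost + reserve 0 + \<kappa>"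
    by (simp add: gap_bound_def r algebra_simps)
  show "\<kappa> + credit w i 1 \<le> reserve 0"
    using credit_le[of w i 1] unfolding r by (simp add: algebra_simps)
  show "\<kappa> + credit w i 0 \<le> gap_bound"
    using credit_le[of w i 0] unfolding g by simp
  have "reserve p \<le> reserve 0" by (simp add: reserve_def algebra_simps)
  then show "credit w i p \<le> gap_bound"
    using credit_le[of w i p] unfolding g by simp
  have "(n - x) * \<kappa> \<le> n * \<kappa>" by (rule mult_le_mono1) simp
  then show "\<kappa> + root_credit x \<le> reserve 0" "root_credit x \<le> gap_bound"
    unfolding g r root_credit_def by (simp_all add: algebra_simps)
qed

lemma root_credit_Suc: "x < n \<Longrightarrow> \<kappa> + root_credit (Suc x) = root_credit x"
proof -
  assume "x < n"
  then have "n - x = Suc (n - Suc x)" by simp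
  then show ?thesis by (simp add: root_credit_def)
qed

lemma eval_guard: "eval guard (conc (cfg C x w i p)) = (n - x) + length C"
  by (simp add: cfg_def)

lemma eval_cur: "eval (Arr aCUR (Num 0)) (conc (cfg C x w i p)) = length C"
  by (simp add: cfg_def)

section \<open>Iterations at a node\<close>

context
  fixes P :: "nat set"
  assumes P: "P \<in> maximal F"
begin

lemma \<kappa>_node: "7500 * unit_q + 500 \<le> \<kappa>" "unit \<le> unit_q" "RT \<le> unit_q" "1 \<le> unit" "1 \<le> unit_q"
    "card P \<le> unit_q"
  using node_facts[OF P] by (auto simp: \<kappa>_def)

lemma trav_node:
  assumes "exob Node (cfg (sl P) x w i p) a out b \<tau>" "14 + a \<le> a'"
  shows "trav (cfg (sl P) x w i p) a' out b \<tau>"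
proof (rule tour_step)
  show "eval guard (conc (cfg (sl P) x w i p)) \<noteq> 0"
    unfolding eval_guard using node_facts(6)[OF P] by simp
  show "exob body (cfg (sl P) x w i p) (5 + a) out b \<tau>"
    by (rule exo_Cond[where a = a]) (use assms(1) node_facts(6)[OF P] in \<open>simp_all add: eval_cur\<close>)
  show "1 + cost guard + (5 + a) \<le> a'" using assms(2) by simp
qed

lemma exo_scan:
  assumes w: "w < n"
    and more: "i < length (nb P w) \<Longrightarrow> exob (Test_Child ;; Branch)
      (fetched P x w i p) a out b \<tau>"
    and no_more: "length (nb P w) \<le> i \<Longrightarrow> exob Next_Slot
      (fetched P x w i p) a out b \<tau>"
    and a': "151 * RT + a + 11 \<le> a'"
  shows "exob Node (cfg (sl P) x w i p) a' out b \<tau>"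
  unfolding Node_def
proof (rule exo_Cond)
  assume "eval (Minus (Reg 0) (Reg rW)) (conc (cfg (sl P) x w i p)) = 0"
  then show "exob (Post ;; Up) (cfg (sl P) x w i p) (151 * RT + (a + 7)) out b \<tau>"
    using w by (simp add: cfg_def)
next
  have "exob (Cond (Minus (Arr aNB (Num 1)) (Reg rIDX)) (Test_Child ;; Branch)
        Next_Slot)
     (fetched P x w i p) (a + 7) out b \<tau>"
    by (rule exo_Cond[where a = a]) (use more no_more in \<open>simp_all add: enc_1\<close>)
  from exo_Seq[OF exo_exe[OF exe_fetch_node[OF P w] order_refl] this]
  show "exob (Fetch aCUR (Reg rW) ;; Cond (Minus (Arr aNB (Num 1)) (Reg rIDX))
        (Test_Child ;; Branch)
        Next_Slot)
     (cfg (sl P) x w i p) (151 * RT + (a + 7)) out b \<tau>" by simp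
qed (use a' in simp)

lemma trav_no_more:
  assumes w: "w < n" and i: "length (nb P w) \<le> i" and a: "300 * RT + b \<le> a"
  shows "trav (cfg (sl P) x w i p) a [] b (cfg (sl P) x (Suc w) 0 p)"
proof -
  have RT: "3 \<le> RT" using node_facts[OF P] by simp
  have main: "exob Next_Slot
      (fetched P x w i p) (50 * RT + b) [] b (cfg (sl P) x (Suc w) 0 p)"
    by (rule exo_exe[OF exe_no_more[OF P w] order_refl])
  have "exob Node (cfg (sl P) x w i p) (151 * RT + (50 * RT + b) + 11) [] b (cfg (sl P) x (Suc w)
      0 p)"
    by (rule exo_scan[OF w], use i in simp, rule main, rule order_refl)
  then show ?thesis
    by (rule trav_node) (use a RT in simp)
qed

lemma trav_next:
  assumes w: "w < n" and i: "i < length (nb P w)" and nc: "\<not> is_child P w i" and a: "\<kappa> + b \<le> a"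
  shows "trav (cfg (sl P) x w i p) a [] b (cfg (sl P) x w (Suc i) p)"
proof -
  have "exe Branch
     ((vars x w i p)(rEQ := if is_child P w i then 1 else 0), (lists (sl P))(aCAND := sl
         (candidate P w i)), marks)
     (2 + 50 * unit) (cfg (sl P) x w (Suc i) p)"
    unfolding Branch_def by (rule exe_le[OF exe_Cond[where t = "50 * unit"]]) (use exe_next[OF P w
        i] nc in auto)
  from exe_Seq[OF exe_test_candidate[OF P w i] this]
  have main: "exob (Test_Child ;; Branch)
      (fetched P x w i p) (7000 * unit_q + (2 + 50 * unit) + b) [] b
      (cfg (sl P) x w (Suc i) p)"
    by (rule exo_exe) simp
  have "exob Node (cfg (sl P) x w i p) (151 * RT + (7000 * unit_q + (2 + 50 * unit) + b) + 11) [] b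
      (cfg (sl P) x w (Suc i) p)"
    by (rule exo_scan[OF w], rule main, use i in simp, rule order_refl)
  then show ?thesis
    by (rule trav_node) (use a \<kappa>_node in simp)
qed

lemma trav_down:
  assumes w: "w < n" and i: "i < length (nb P w)" and c: "is_child P w i" and p: "p \<le> 1"
    and a: "p = 0 \<Longrightarrow> \<kappa> + b \<le> a" "p = 1 \<Longrightarrow> \<kappa> \<le> a \<and> b \<le> gap_bound"
  shows "trav (cfg (sl P) x w i p) a (if p = 1 then [sl (candidate P w i)] else []) b
    (cfg (sl (candidate P w i)) x 0 0 (1 - p))"
proof -
  let ?S = "candidate P w i"
  let ?out = "if p = 1 then [sl ?S] else []"
  \<comment> \<open>For \<open>p = 1\<close> the child has even depth and is output at once, so the
    credit has to last only until this output; \<open>b\<close> is then taken from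
    \<open>gap_bound\<close>.\<close>
  let ?d = "if p = 0 then 2 + b else 4 + unit"
  have S: "?S \<in> maximal F" by (rule candidate_maximal[OF P w i])
  have cS: "card ?S \<le> unit" using unit_ge[OF S] by simp
  have out: "exob Pre (cfg (sl ?S) x 0 0 (1 - p)) ?d ?out b
      (cfg (sl ?S) x 0 0 (1 - p))"
    unfolding Pre_def
  proof (rule exo_Cond[where a = "if p = 0 then b else 2 + unit"])
    assume "eval (Reg rPAR) (conc (cfg (sl ?S) x 0 0 (1 - p))) \<noteq> 0"
    then have "p = 0" using p by (simp add: cfg_def)
    then show "exob Skip (cfg (sl ?S) x 0 0 (1 - p)) (if p = 0 then b else 2 + unit) ?out b (cfg
        (sl ?S) x 0 0 (1 - p))"
      using exo_exe[OF exe_Skip] by simp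
  next
    assume "eval (Reg rPAR) (conc (cfg (sl ?S) x 0 0 (1 - p))) = 0"
    then have "p = 1" using p by (simp add: cfg_def)
    then show "exob (Output (Reg aCUR)) (cfg (sl ?S) x 0 0 (1 - p)) (if p = 0 then b else 2 +
        unit) ?out b (cfg (sl ?S) x 0 0 (1 - p))"
      using exo_Output[of aCUR "lists (sl ?S)" "2 + unit" b gap_bound "vars x 0 0 (1 - p)" marks]
          a(2) cS
      by (simp add: cfg_def)
  qed simp
  let ?\<sigma> = "((vars x w i p)(rEQ := if is_child P w i then 1 else 0), (lists (sl P))(aCAND := sl
      ?S), marks)"
  have "exob (Down ;;
    Pre) ?\<sigma> (200 * unit + ?d) ?out b (cfg (sl ?S) x 0 0 (1 - p))"
    using exo_Seq[OF exo_exe[OF exe_Down[OF P S p] order_refl] out] c by simp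
  then have "exob Branch ?\<sigma>
     (2 + 200 * unit + ?d) ?out b (cfg (sl ?S) x 0 0 (1 - p))"
    unfolding Branch_def by (rule exo_Cond) (use c in simp_all)
  from exo_Seq[OF exo_exe[OF exe_test_candidate[OF P w i] order_refl] this]
  have main: "exob (Test_Child ;; Branch)
      (fetched P x w i p) (7000 * unit_q + (2 + 200 * unit + ?d)) ?out b
      (cfg (sl ?S) x 0 0 (1 - p))" by simp
  have time: "7000 * unit_q + (2 + 200 * unit + ?d) + 151 * RT + 25 \<le> a"
    using a \<kappa>_node p by (cases "p = 0") auto
  have node: "exob Node (cfg (sl P) x w i p) (151 * RT + (7000 * unit_q + (2 + 200 * unit + ?d)) +
      11) ?out b
      (cfg (sl ?S) x 0 0 (1 - p))"
    by (rule exo_scan[OF w], rule main, use i in simp, rule order_refl)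
  show ?thesis
    by (rule trav_node[OF node]) (use time in linarith)
qed

lemma trav_leave:
  assumes p: "p \<le> 1"
    and a: "p = 0 \<Longrightarrow> \<kappa> + b \<le> a" "p = 1 \<Longrightarrow> \<kappa> \<le> a \<and> \<kappa> + b \<le> gap_bound"
  shows "trav (cfg (sl P) x n 0 p) a (if p = 1 then [sl P] else []) b
    (if is_root P then cfg [] x 0 0 (1 - p)
     else cfg (sl (parent P)) x (extender (parent P) P) (hit (parent P) P) (1 - p))"
    (is "trav _ _ _ _ ?\<tau>")
proof -
  let ?out = "if p = 1 then [sl P] else []"
  let ?d = "6000 * unit_q + b"
  \<comment> \<open>For \<open>p = 1\<close> the output comes first and resets the credit, so the
    walk upwards, bounded by \<open>6000 * unit_q\<close>, is paid after the reset.\<close>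
  let ?c = "if p = 0 then ?d else 2 + unit"
  have out: "exob Post (cfg (sl P) x n 0 p) (2 + ?c) ?out ?d (cfg (sl P) x n 0 p)"
    unfolding Post_def
  proof (rule exo_Cond[where a = ?c])
    assume "eval (Reg rPAR) (conc (cfg (sl P) x n 0 p)) \<noteq> 0"
    then have "p = 1" using p by (simp add: cfg_def)
    then show "exob (Output (Reg aCUR)) (cfg (sl P) x n 0 p) ?c ?out ?d (cfg (sl P) x n 0 p)"
      using exo_Output[of aCUR "lists (sl P)" "2 + unit" ?d gap_bound "vars x n 0 p" marks] a(2)
          node_facts[OF P] \<kappa>_node
      by (simp add: cfg_def)
  next
    assume "eval (Reg rPAR) (conc (cfg (sl P) x n 0 p)) = 0"
    then have "p = 0" using p by (simp add: cfg_def)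
    then show "exob Skip (cfg (sl P) x n 0 p) ?c ?out ?d (cfg (sl P) x n 0 p)"
      using exo_exe[OF exe_Skip] by simp
  qed simp
  have "exob (Post ;; Up) (cfg (sl P) x n 0 p) (2 + ?c) ?out b ?\<tau>"
    using exo_Seq[OF out exo_exe[OF exe_Up[OF P p] order_refl]] by simp
  then have "exob Node (cfg (sl P) x n 0 p) (6 + ?c) ?out b ?\<tau>"
    unfolding Node_def by (intro exo_Cond[where a = "2 + ?c"]) (simp_all add: cfg_def)
  moreover have "14 + (6 + ?c) \<le> a"
    using a \<kappa>_node p by (cases "p = 0") auto
  ultimately show ?thesis by (rule trav_node)
qed

end

text \<open>What remains to be enumerated below \<open>P\<close> when its scan stands at index
  \<open>i\<close> of \<open>w\<close>. As \<open>hit\<close> is 1 plus an index,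
  \<open>i < hit P S\<close> means index at least \<open>i\<close>.\<close>

definition rest :: "nat set \<Rightarrow> nat \<Rightarrow> nat \<Rightarrow> nat set set" where
  "rest P w i = \<Union>(descendants ` {S. (P, S) \<in> edges \<and>
     (w < extender P S \<or> w = extender P S \<and> i < hit P S)})"

lemma edge_facts:
  assumes "(P, S) \<in> edges"
  shows "P \<in> maximal F" "S \<in> maximal F" "\<not> is_root S" "parent S = P" "extender P S < n"
    "hit P S \<noteq> 0" "hit P S \<le> length (nb P (extender P S))" "candidate P (extender P S) (hit P S -
        1) = S"
proof -
  show S: "S \<in> maximal F" "\<not> is_root S" and P: "parent S = P" using assms by (auto simp: edges_def)
  note pp = parent_props[OF S, unfolded P]
  show "P \<in> maximal F" by (rule pp(1))
  show "extender P S < n" using extender_in(3)[OF pp(1) S(1) pp(2)] by simp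
  show "hit P S \<noteq> 0" "hit P S \<le> length (nb P (extender P S))" using hit_props(1,2)[OF pp(1) S(1)
      pp(2)] by auto
  show "candidate P (extender P S) (hit P S - 1) = S" using parent_candidate[OF S] by (simp add: P)
qed

lemma is_child_edge:
  assumes "P \<in> maximal F" "w < n" "i < length (nb P w)"
  shows "is_child P w i \<longleftrightarrow> (\<exists>S. (P, S) \<in> edges \<and> extender P S = w \<and> hit P S = Suc i)"
proof
  assume "is_child P w i"
  then show "\<exists>S. (P, S) \<in> edges \<and> extender P S = w \<and> hit P S = Suc i"
    using candidate_maximal[OF assms] by (auto simp: is_child_def Let_def edges_def)
next
  assume "\<exists>S. (P, S) \<in> edges \<and> extender P S = w \<and> hit P S = Suc i"
  then obtain S where S: "(P, S) \<in> edges" "extender P S = w" "hit P S = Suc i" by blast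
  then have "candidate P w i = S" using edge_facts(8)[OF S(1)] by simp
  then show "is_child P w i"
    using S edge_facts[OF S(1)] by (simp add: is_child_def)
qed

lemma rest_end: "rest P n 0 = {}"
  using edge_facts(5) by (force simp: rest_def)

lemma rest_no_more: "rest P w (length (nb P w)) = rest P (Suc w) 0"
proof -
  have "(w < extender P S \<or> w = extender P S \<and> length (nb P w) < hit P S) \<longleftrightarrow>
      (Suc w < extender P S \<or> Suc w = extender P S \<and> 0 < hit P S)" if "(P, S) \<in> edges" for S
    using edge_facts(6,7)[OF that] by auto
  then have "{S. (P, S) \<in> edges \<and> (w < extender P S \<or> w = extender P S \<and> length (nb P w) < hit P
      S)} =
      {S. (P, S) \<in> edges \<and> (Suc w < extender P S \<or> Suc w = extender P S \<and> 0 < hit P S)}" by blast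
  then show ?thesis by (simp only: rest_def)
qed

text \<open>A slot determines its candidate, so at most one child has it, and advancing by one slot
  removes exactly the subtree of this child.\<close>

lemma rest_Suc:
  assumes "P \<in> maximal F" "w < n" "i < length (nb P w)"
  shows "\<not> is_child P w i \<Longrightarrow> rest P w i = rest P w (Suc i)"
    and "is_child P w i \<Longrightarrow> rest P w i = descendants (candidate P w i) \<union> rest P w (Suc i)"
    and "is_child P w i \<Longrightarrow> descendants (candidate P w i) \<inter> rest P w (Suc i) = {}"
    and "is_child P w i \<Longrightarrow> (P, candidate P w i) \<in> edges"
proof -
  let ?I = "\<lambda>i. {S. (P, S) \<in> edges \<and> (w < extender P S \<or> w = extender P S \<and> i < hit P S)}"
  have rest: "rest P w i = \<Union>(descendants ` ?I i)" for i by (simp add: rest_def)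
  have "?I i = {S. (P, S) \<in> edges \<and> extender P S = w \<and> hit P S = Suc i} \<union> ?I (Suc i)"
    by (auto simp: Suc_lessI)
  moreover have none: "{S. (P, S) \<in> edges \<and> extender P S = w \<and> hit P S = Suc i} = {}" if "\<not>
      is_child P w i"
    using that is_child_edge[OF assms] by blast
  moreover have one: "{S. (P, S) \<in> edges \<and> extender P S = w \<and> hit P S = Suc i} = {candidate P w i}"
    if c: "is_child P w i"
  proof -
    obtain S where S: "(P, S) \<in> edges" "extender P S = w" "hit P S = Suc i"
      using c is_child_edge[OF assms] by blast
    have u: "S' = candidate P w i" if "(P, S') \<in> edges" "extender P S' = w" "hit P S' = Suc i" for
        S'
      using edge_facts(8)[OF that(1)] that(2,3) by simp
    show ?thesis
    proof (intro equalityI subsetI)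
      show "S' \<in> {candidate P w i}" if "S' \<in> {S. (P, S) \<in> edges \<and> extender P S = w \<and> hit P S = Suc
          i}" for S'
        using that u[of S'] by simp
      show "S' \<in> {S. (P, S) \<in> edges \<and> extender P S = w \<and> hit P S = Suc i}" if "S' \<in> {candidate P w
          i}" for S'
        using that S u[OF S] by simp
    qed
  qed
  ultimately show "\<not> is_child P w i \<Longrightarrow> rest P w i = rest P w (Suc i)"
    "is_child P w i \<Longrightarrow> rest P w i = descendants (candidate P w i) \<union> rest P w (Suc i)"
    unfolding rest by auto
  show e: "(P, candidate P w i) \<in> edges" if "is_child P w i"
    using one[OF that] by blast
  show "descendants (candidate P w i) \<inter> rest P w (Suc i) = {}" if c: "is_child P w i"
  proof -
    have "candidate P w i \<notin> ?I (Suc i)" using c by (simp add: is_child_def Let_def)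
    then have "descendants (candidate P w i) \<inter> descendants S = {}" if "S \<in> ?I (Suc i)" for S
      using siblings_disjoint[OF e[OF c], of S] that by blast
    then show ?thesis unfolding rest by blast
  qed
qed

lemma rest_start: "descendants P = insert P (rest P 0 0)" "P \<notin> rest P 0 0"
proof -
  have "{S. (P, S) \<in> edges \<and> (0 < extender P S \<or> 0 = extender P S \<and> 0 < hit P S)} = {S. (P, S) \<in>
      edges}"
    using edge_facts(6) by auto
  then have r: "rest P 0 0 = \<Union>(descendants ` {S. (P, S) \<in> edges})" by (simp only: rest_def)
  show "descendants P = insert P (rest P 0 0)" unfolding r by (rule descendants_unfold)
  show "P \<notin> rest P 0 0" unfolding r using not_descendant_of_child by blast
qed

lemma rest_maximal: "rest P w i \<subseteq> maximal F"
  unfolding rest_def using edge_facts(2) descendants_maximal by blast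

lemma inj_sl: "inj_on sl (maximal F)"
  using sl_eq_iff maximal_sol by (auto simp: inj_on_def)

lemma sl_disjoint: "A \<subseteq> maximal F \<Longrightarrow> A' \<subseteq> maximal F \<Longrightarrow> A \<inter> A' = {} \<Longrightarrow> sl ` A \<inter> sl ` A' = {}"
  using inj_on_image_Int[OF inj_sl, of A A'] by simp

section \<open>Enumeration of a tree\<close>

definition explored :: "store \<Rightarrow> nat \<Rightarrow> nat set set \<Rightarrow> nat \<Rightarrow> store \<Rightarrow> bool" where
  "explored \<sigma> a A b \<tau> \<longleftrightarrow> (\<exists>out. trav \<sigma> a out b \<tau> \<and> distinct out \<and> set out = sl ` A)"

lemma explored_trans:
  assumes "explored \<sigma> a A b \<tau>" "explored \<tau> b A' d \<upsilon>" "A \<subseteq> maximal F" "A' \<subseteq> maximal F" "A \<inter> A' = {}"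
  shows "explored \<sigma> a (A \<union> A') d \<upsilon>"
proof -
  obtain o1 o2 where "trav \<sigma> a o1 b \<tau>" "distinct o1" "set o1 = sl ` A"
    "trav \<tau> b o2 d \<upsilon>" "distinct o2" "set o2 = sl ` A'"
    using assms(1,2) unfolding explored_def by blast
  then show ?thesis
    unfolding explored_def using sl_disjoint[OF assms(3-5)]
    by (intro exI[of _ "o1 @ o2"]) (auto intro: tour_trans)
qed

lemma explored_silent: "trav \<sigma> a [] b \<tau> \<Longrightarrow> explored \<sigma> a {} b \<tau>"
  unfolding explored_def by (intro exI[of _ "[]"]) simp

lemma explored_emit: "trav \<sigma> a [sl S] b \<tau> \<Longrightarrow> explored \<sigma> a {S} b \<tau>"
  unfolding explored_def by (intro exI[of _ "[sl S]"]) simp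

text \<open>The output of \<open>S\<close> itself is left out, because its place relative to the
  subtrees depends on the parity. \<open>visit\<close> includes the output of a child and returns to
  the next slot; slots and then elements are treated backwards from the end of the scan.\<close>

lemma explored_node:
  "S \<in> maximal F \<Longrightarrow> p \<le> 1 \<Longrightarrow> explored (cfg (sl S) x 0 0 p) (credit 0 0 p) (rest S 0 0) (reserve p)
      (cfg (sl S) x n 0 p)"
proof (induction "card {X \<in> maximal F. precedes S X}" arbitrary: S p rule: less_induct)
  case less
  note P = less.prems(1)
  note p = less.prems(2)
  have visit: "explored (cfg (sl S) x w i p) (credit w i p) (descendants (candidate S w i))
      (credit w (Suc i) p)
      (cfg (sl S) x w (Suc i) p)" if w: "w < n" and i: "i < length (nb S w)" and c: "is_child S w
          i" for w i
  proof -
    let ?C = "candidate S w i"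
    have e: "(S, ?C) \<in> edges" by (rule rest_Suc(4)[OF P w i c])
    note ef = edge_facts[OF e]
    have iRN: "i < RN" using i length_nb[OF P w] by simp
    have slot: "extender S ?C = w" "hit S ?C = Suc i" using c by (simp_all add: is_child_def
        Let_def)
    have "1 - p \<le> 1" by simp
    from less.hyps[OF successors_decrease[OF e] ef(2) this]
    have inner: "explored (cfg (sl ?C) x 0 0 (1 - p)) (credit 0 0 (1 - p)) (rest ?C 0 0) (reserve
        (1 - p))
        (cfg (sl ?C) x n 0 (1 - p))" .
    \<comment> \<open>Returning flips the parity back, and \<open>hit S ?C = Suc i\<close> is the
      index after the child.\<close>
    have \<tau>: "(if is_root ?C then cfg [] x 0 0 (1 - (1 - p))
     else cfg (sl (parent ?C)) x (extender (parent ?C) ?C) (hit (parent ?C) ?C) (1 - (1 - p))) =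
         cfg (sl S) x w (Suc i) p"
      using ef(3,4) slot p by simp
    have sub: "rest ?C 0 0 \<subseteq> maximal F" "{?C} \<subseteq> maximal F" using rest_maximal ef(2) by auto
    note rs = rest_start[of ?C]
    show ?thesis
    proof (cases "p = 0")
      case True
      \<comment> \<open>An even node passes its credit down to an odd child, whose output on leaving
        provides the credit for the remaining slots.\<close>
      have "\<kappa> + credit 0 0 1 \<le> credit w i 0"
        using credit_reserve[OF w iRN, of 0] reserves(4)[of 0 0] by simp
      then have 1: "explored (cfg (sl S) x w i p) (credit w i p) {} (credit 0 0 (1 - p)) (cfg (sl
          ?C) x 0 0 (1 - p))"
        using trav_down[OF P w i c p, of "credit 0 0 (1 - p)" "credit w i p" x] True by (intro
            explored_silent) simp
      have 2: "explored (cfg (sl ?C) x n 0 (1 - p)) (reserve (1 - p)) {?C} (credit w (Suc i) p)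
          (cfg (sl S) x w (Suc i) p)"
        using trav_leave[OF ef(2), of "1 - p" "credit w (Suc i) p" "reserve (1 - p)" x] \<tau> True
          reserves(1) reserves(5)[of w "Suc i"] by (intro explored_emit) simp
      from explored_trans[OF 1 explored_trans[OF inner 2 sub]] show ?thesis
        using rs sub by auto
    next
      case False
      then have p1: "p = 1" using p by simp
      \<comment> \<open>An odd node needs only \<open>\<kappa>\<close> for the way down, since the
        even child is output on arrival; the reserve left at the end of the child pays for the
        return.\<close>
      have "\<kappa> \<le> credit w i 1" using credit_reserve[OF w iRN, of 1] by simp
      then have 1: "explored (cfg (sl S) x w i p) (credit w i p) {?C} (credit 0 0 (1 - p)) (cfg
          (sl ?C) x 0 0 (1 - p))"
        using trav_down[OF P w i c p, of "credit 0 0 (1 - p)" "credit w i p" x] p1 reserves(6)[of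
            0 0 0]
        by (intro explored_emit) simp
      have 2: "explored (cfg (sl ?C) x n 0 (1 - p)) (reserve (1 - p)) {} (credit w (Suc i) p) (cfg
          (sl S) x w (Suc i) p)"
        using trav_leave[OF ef(2), of "1 - p" "credit w (Suc i) p" "reserve (1 - p)" x] \<tau> p1
          reserves(4)[of w "Suc i"] by (intro explored_silent) simp
      from explored_trans[OF 1 explored_trans[OF inner 2 sub(1)]] show ?thesis
        using rs sub by auto
    qed
  qed
  have row: "explored (cfg (sl S) x w i p) (credit w i p) (rest S w i) (reserve p) (cfg (sl S) x n
      0 p)"
    if w: "w < n" and i: "i \<le> length (nb S w)"
      and later: "explored (cfg (sl S) x (Suc w) 0 p) (credit (Suc w) 0 p) (rest S (Suc w) 0)
          (reserve p) (cfg (sl S) x n 0 p)"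
    for w i
    using i
  proof (induction rule: inc_induct)
    case base
    have "length (nb S w) \<le> RN" by (rule length_nb[OF P w])
    from explored_silent[OF trav_no_more[OF P w order_refl credit_no_more[OF w this]]]
    have "explored (cfg (sl S) x w (length (nb S w)) p) (credit w (length (nb S w)) p) {} (credit
        (Suc w) 0 p)
        (cfg (sl S) x (Suc w) 0 p)" .
    from explored_trans[OF this later] show ?case
      using rest_maximal by (simp add: rest_no_more)
  next
    case (step j)
    have j: "j < length (nb S w)" using step by simp
    have jRN: "j < RN" using j length_nb[OF P w] by simp
    show ?case
    proof (cases "is_child S w j")
      case True
      have "descendants (candidate S w j) \<subseteq> maximal F"
        by (rule descendants_maximal[OF candidate_maximal[OF P w j]])
      from explored_trans[OF visit[OF w j True] step.IH this rest_maximal rest_Suc(3)[OF P w j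
          True]]
      show ?thesis by (simp add: rest_Suc(2)[OF P w j True])
    next
      case False
      from explored_trans[OF explored_silent[OF trav_next[OF P w j False credit_next[OF w jRN]]]
          step.IH]
      show ?thesis using rest_maximal by (simp add: rest_Suc(1)[OF P w j False])
    qed
  qed
  have "explored (cfg (sl S) x w 0 p) (credit w 0 p) (rest S w 0) (reserve p) (cfg (sl S) x n 0
      p)" if "w \<le> n" for w
    using that
  proof (induction rule: inc_induct)
    case base
    show ?case
      unfolding rest_end credit_end by (intro explored_silent tour.stop) simp
  next
    case (step w)
    show ?case by (rule row[OF step(2) le0 step.IH])
  qed
  from this[of 0] show ?case by simp
qed

section \<open>Enumeration of all trees\<close>

definition roots_from :: "nat \<Rightarrow> nat set set" where
  "roots_from x = \<Union>(descendants ` {S \<in> maximal F. is_root S \<and> x \<le> seed F S})"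

lemma roots_from_maximal: "roots_from x \<subseteq> maximal F"
  using descendants_maximal by (auto simp: roots_from_def)

lemma seed_less: "S \<in> maximal F \<Longrightarrow> seed F S < n"
  using seed_in[of S] Z_less maximal_sol maximal_nonempty by blast

lemma roots_from_end: "roots_from n = {}"
  using seed_less by (force simp: roots_from_def)

lemma roots_from_Suc:
  assumes "x \<in> Z" "seed F (cmp {x}) = x"
  shows "roots_from x = descendants (cmp {x}) \<union> roots_from (Suc x)"
    "descendants (cmp {x}) \<inter> roots_from (Suc x) = {}"
proof -
  let ?S = "cmp {x}"
  have S: "?S \<in> maximal F" "is_root ?S"
    using comp_singleton_maximal[OF assms(1)] assms(2) by (auto simp: is_root_def)
  have "S = ?S" if "is_root S" "seed F S = x" for S
    using that(1) unfolding is_root_def that(2) by (rule sym)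
  moreover have "x \<le> seed F S \<longleftrightarrow> seed F S = x \<or> Suc x \<le> seed F S" for S
    by arith
  ultimately have "{S \<in> maximal F. is_root S \<and> x \<le> seed F S} = insert ?S {S \<in> maximal F. is_root S
      \<and> Suc x \<le> seed F S}"
    using S assms(2) by blast
  then show "roots_from x = descendants ?S \<union> roots_from (Suc x)" by (simp add: roots_from_def)
  have "descendants ?S \<inter> descendants S = {}" if "is_root S" "Suc x \<le> seed F S" for S
    using roots_disjoint[OF S(2) that(1)] that(2) assms(2) by fastforce
  then show "descendants ?S \<inter> roots_from (Suc x) = {}" by (auto simp: roots_from_def)
qed

lemma roots_from_skip:
  assumes "\<not> (x \<in> Z \<and> seed F (cmp {x}) = x)"
  shows "roots_from x = roots_from (Suc x)"
proof -
  have ne: "seed F S \<noteq> x" if S: "S \<in> maximal F" "is_root S" for S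
  proof
    assume x: "seed F S = x"
    have "cmp {x} = S" using S(2) unfolding is_root_def x .
    moreover have "x \<in> Z" using seed_in[of S] S(1) maximal_sol maximal_nonempty x by blast
    ultimately show False using assms x by blast
  qed
  have "x \<le> seed F S \<longleftrightarrow> seed F S = x \<or> Suc x \<le> seed F S" for S
    by arith
  then have "{S \<in> maximal F. is_root S \<and> x \<le> seed F S} = {S \<in> maximal F. is_root S \<and> Suc x \<le> seed
      F S}"
    using ne by blast
  then show ?thesis by (simp only: roots_from_def)
qed

lemma \<kappa>_pos: "7500 * unit_q + 500 \<le> \<kappa>" "unit \<le> unit_q" "1 \<le> unit"
proof -
  obtain z where "z \<in> Z" using singleton by auto
  then have z: "cmp {z} \<in> maximal F" using comp_singleton_maximal by blast
  show "7500 * unit_q + 500 \<le> \<kappa>" "unit \<le> unit_q" "1 \<le> unit" using \<kappa>_node[OF z] by auto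
qed

lemma trav_root:
  assumes x: "x < n" and p: "p \<le> 1"
    and C: "C = (if x \<in> Z \<and> seed F (cmp {x}) = x then sl (cmp {x}) else [])"
    and a: "C = [] \<Longrightarrow> \<kappa> + b \<le> a" "C \<noteq> [] \<Longrightarrow> \<kappa> \<le> a \<and> b \<le> gap_bound"
  shows "trav (cfg [] x 0 0 p) a (if C = [] then [] else [C]) b (cfg C (Suc x) 0 0 0)"
proof (rule tour_step)
  let ?out = "if C = [] then [] else [C]"
  let ?c = "if C = [] then b else 2 + unit"
  show "eval guard (conc (cfg [] x 0 0 p)) \<noteq> 0"
    unfolding eval_guard using x by simp
  have len: "length C \<le> unit"
    using C unit_ge[of "cmp {x}"] comp_singleton_maximal[of x] by (auto split: if_splits)
  have out: "exob (Cond (Arr aCUR (Num 0)) (Output (Reg aCUR)) Skip) (cfg C (Suc x) 0 0 0) (5 +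
      ?c) ?out b (cfg C (Suc x) 0 0 0)"
  proof (rule exo_Cond[where a = ?c])
    assume "eval (Arr aCUR (Num 0)) (conc (cfg C (Suc x) 0 0 0)) \<noteq> 0"
    then have "C \<noteq> []" by (simp add: eval_cur)
    then show "exob (Output (Reg aCUR)) (cfg C (Suc x) 0 0 0) ?c ?out b (cfg C (Suc x) 0 0 0)"
      using exo_Output[of aCUR "lists C" "2 + unit" b gap_bound "vars (Suc x) 0 0 0" marks] a(2) len
      by (simp add: cfg_def)
  next
    assume "eval (Arr aCUR (Num 0)) (conc (cfg C (Suc x) 0 0 0)) = 0"
    then have "C = []" by (simp add: eval_cur)
    then show "exob Skip (cfg C (Suc x) 0 0 0) ?c ?out b (cfg C (Suc x) 0 0 0)"
      using exo_exe[OF exe_Skip] by simp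
  qed simp
  have "exob Root (cfg [] x 0 0 p) (400 * unit + (5 + ?c)) ?out b (cfg C (Suc x) 0 0 0)"
    using exo_Seq[OF exo_exe[OF exe_Root[OF x p, folded C] order_refl] out] unfolding Root_def by
        simp
  then show "exob body (cfg [] x 0 0 p) (5 + (400 * unit + (5 + ?c))) ?out b (cfg C (Suc x) 0 0 0)"
    by (intro exo_Cond[where a = "400 * unit + (5 + ?c)"]) (simp_all add: eval_cur)
  show "1 + cost guard + (5 + (400 * unit + (5 + ?c))) \<le> a"
    using a \<kappa>_pos by (cases "C = []") auto
qed

text \<open>The parity is 1 after a tree and 0 after an id without a root, so the induction covers
  both values and leaves the final one open.\<close>

lemma explored_roots:
  "x \<le> n \<Longrightarrow> \<forall>p\<le>1. \<exists>p'\<le>1. explored (cfg [] x 0 0 p) (root_credit x) (roots_from x) (root_credit n)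
      (cfg [] n 0 0 p')"
proof (induction rule: inc_induct)
  case base
  show ?case
    unfolding roots_from_end by (auto intro: explored_silent tour.stop)
next
  case (step x)
  have x: "x < n" using step by simp
  show ?case
  proof (intro allI impI)
    fix p :: nat assume p: "p \<le> 1"
    show "\<exists>p'\<le>1. explored (cfg [] x 0 0 p) (root_credit x) (roots_from x) (root_credit n) (cfg []
        n 0 0 p')"
    proof (cases "x \<in> Z \<and> seed F (cmp {x}) = x")
      case True
      let ?S = "cmp {x}"
      have S: "?S \<in> maximal F" "is_root ?S"
        using comp_singleton_maximal[of x] True by (auto simp: is_root_def)
      have ne: "sl ?S \<noteq> []" using maximal_nonempty[OF S(1)] finite_sol[OF maximal_sol[OF S(1)]] by
          simp
      obtain p' where p': "p' \<le> 1"
        "explored (cfg [] (Suc x) 0 0 1) (root_credit (Suc x)) (roots_from (Suc x)) (root_credit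
            n) (cfg [] n 0 0 p')"
        using step.IH by (meson order_refl)
      have 1: "explored (cfg [] x 0 0 p) (root_credit x) {?S} (credit 0 0 0) (cfg (sl ?S) (Suc x)
          0 0 0)"
        using trav_root[OF x p refl, of "credit 0 0 0" "root_credit x"] True ne reserves(6)[of 0 0
            0]
        by (intro explored_emit) (simp add: root_credit_def)
      have 2: "explored (cfg (sl ?S) (Suc x) 0 0 0) (credit 0 0 0) (rest ?S 0 0) (reserve 0) (cfg
          (sl ?S) (Suc x) n 0 0)"
        by (rule explored_node[OF S(1)]) simp
      have 3: "explored (cfg (sl ?S) (Suc x) n 0 0) (reserve 0) {} (root_credit (Suc x)) (cfg []
          (Suc x) 0 0 1)"
        using trav_leave[OF S(1), of 0 "root_credit (Suc x)" "reserve 0" "Suc x"] S(2)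
            reserves(7)[of "Suc x"]
        by (intro explored_silent) simp
      have sub: "rest ?S 0 0 \<subseteq> maximal F" "{?S} \<subseteq> maximal F" using rest_maximal S by auto
      have "explored (cfg [] x 0 0 p) (root_credit x) (descendants ?S) (root_credit (Suc x)) (cfg
          [] (Suc x) 0 0 1)"
        using explored_trans[OF 1 explored_trans[OF 2 3 sub(1)]] rest_start[of ?S] sub by auto
      from explored_trans[OF this p'(2) descendants_maximal[OF S(1)] roots_from_maximal
          roots_from_Suc(2)] True
      show ?thesis using p'(1) roots_from_Suc(1)[of x] by auto
    next
      case False
      obtain p' where p': "p' \<le> 1"
        "explored (cfg [] (Suc x) 0 0 0) (root_credit (Suc x)) (roots_from (Suc x)) (root_credit
            n) (cfg [] n 0 0 p')"
        using step.IH by (meson zero_le)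
      have "explored (cfg [] x 0 0 p) (root_credit x) {} (root_credit (Suc x)) (cfg [] (Suc x) 0 0
          0)"
        using trav_root[OF x p refl, of "root_credit (Suc x)" "root_credit x"] False
            root_credit_Suc[OF x]
        by (intro explored_silent) auto
      from explored_trans[OF this p'(2)] show ?thesis
        using p'(1) roots_from_maximal roots_from_skip[OF False] by auto
    qed
  qed
qed

lemma exo_Traverse:
  obtains out \<tau> where "exob Traverse (cfg [] 0 0 0 0) (root_credit 0) out 0 \<tau>" "distinct out"
    "set out = sl ` maximal F"
proof -
  obtain p' out where "trav (cfg [] 0 0 0 0) (root_credit 0) out (root_credit n) (cfg [] n 0 0 p')"
    "distinct out" "set out = sl ` roots_from 0"
    using explored_roots[of 0] unfolding explored_def by auto
  moreover have "roots_from 0 = maximal F"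
    using roots_cover by (simp add: roots_from_def)
  moreover have "eval guard (conc (cfg [] n 0 0 p')) = 0"
    unfolding eval_guard by simp
  ultimately show ?thesis
    using that[of out "cfg [] n 0 0 p'"] tour_Loop[of gap_bound guard body _ _ out _ _ 0] \<kappa>_pos
    unfolding Traverse_def by (simp add: root_credit_def)
qed

end

section \<open>The complete program\<close>

text \<open>Expressions have no multiplication, so the array bases are built by repeated addition of
  \<open>n + 2\<close>.\<close>

primrec Init :: "nat \<Rightarrow> com" where
  "Init 0 = SetReg 1 (Plus (Reg 0) (Num 2))"
| "Init (Suc k) = (Init k ;; SetReg (Suc (Suc k)) (Plus (Reg (Suc k)) (Reg 1)))"

definition Any_Singleton :: com where
  "Any_Singleton = For rI (Reg 0) (Cond (Mem (Reg rI)) (SetReg rEQ (Num 1)) Skip)"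

text \<open>Without singletons the only solution is \<open>{}\<close>, whose list is the empty array
  \<open>aARG\<close>.\<close>

definition Main :: com where
  "Main = Cond (Reg rEQ) (SetReg rEQ (Num 0) ;; Traverse) (Output (Reg aARG))"

definition program :: com where
  "program = Seq (Init 11) (Any_Singleton ;; Main)"

section \<open>Initialisation of the machine\<close>

context machine
begin

definition start :: "nat set \<Rightarrow> store" where
  "start A = (\<lambda>_. 0, \<lambda>_. [], (\<lambda>_. {})(0 := A))"

lemma ok_start: "ok (start A)"
  by (simp add: start_def ok.simps)

lemma exec_Init:
  assumes "k \<le> 11" and m: "\<And>a. m a \<noteq> 0 \<Longrightarrow> a < n \<and> m a \<le> 1"
  shows "\<exists>es. exec sub B (Init k) (\<lambda>r. if r = 0 then n else 0, m) es
      (\<lambda>r. if r = 0 then n else if r \<le> Suc k then r * L else 0, m) \<and>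
     outputs es = [] \<and> elapsed es \<le> 5 * Suc k"
  using assms(1)
proof (induction k)
  let ?s = "\<lambda>k. (\<lambda>r. if r = 0 then n else if r \<le> k then r * L else 0, m)"
  have fits: "fits B (?s k)" if "k \<le> 12" for k
  proof -
    have "r * L \<le> B" if "r \<le> k" for r
      using mult_le_mono1[OF le_trans[OF that \<open>k \<le> 12\<close>], of L] unfolding B_def by linarith
    moreover have "n \<le> B" "1 \<le> B" using W by (simp_all add: B_def)
    moreover have "m a \<le> B" "a < B" if "m a \<noteq> 0" for a
      using m[OF that] W by (simp_all add: B_def)
    ultimately show ?thesis unfolding fits_def by auto
  qed
  {
    case 0
    have "exec sub B (SetReg 1 (Plus (Reg 0) (Num 2))) (?s 0) [Tick (1 + cost (Plus (Reg 0) (Num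
        2)))] (?s 1)"
      by (rule exec.SetReg) (use fits in \<open>auto simp: fun_eq_iff eval.simps L_def le_Suc_eq\<close>)
    then show ?case by (intro exI[of _ "[Tick (1 + cost (Plus (Reg 0) (Num 2)))]"]) (simp add:
        le_Suc_eq cong: if_cong)
  next
    case (Suc k)
    then obtain es where es: "exec sub B (Init k) (\<lambda>r. if r = 0 then n else 0, m) es (?s (Suc k))"
      "outputs es = []" "elapsed es \<le> 5 * Suc k" by auto
    have "exec sub B (SetReg (Suc (Suc k)) (Plus (Reg (Suc k)) (Reg 1))) (?s (Suc k))
        [Tick (1 + cost (Plus (Reg (Suc k)) (Reg 1)))] (?s (Suc (Suc k)))"
      by (rule exec.SetReg) (use fits[of "Suc k"] fits[of "Suc (Suc k)"] Suc.prems in \<open>auto simp: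
          fun_eq_iff eval.simps le_Suc_eq\<close>)
    from exec.Seq[OF es(1) this] es(2,3) show ?case
      by (intro exI[of _ "es @ [Tick (1 + cost (Plus (Reg (Suc k)) (Reg 1)))]"]) simp
  }
qed

lemma conc_start:
  assumes "A \<subseteq> {..<n}"
  shows "conc (start A) = (\<lambda>r. if r = 0 then n else if r \<le> 12 then r * L else 0, \<lambda>a. if a \<in> A then
      1 else 0)"
proof -
  have "snd (conc (start A)) a = (if a \<in> A then 1 else 0)" for a
  proof (cases "a < L")
    case True
    then show ?thesis by (simp add: conc.simps start_def raw_def cells.simps)
  next
    case False
    then have "a \<notin> A" "a div L \<noteq> 0" using assms by (auto simp: L_def div_eq_0_iff)
    then show ?thesis by (auto simp: conc.simps start_def raw_def cells.simps array_def)
  qed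
  moreover have "fst (conc (start A)) = (\<lambda>r. if r = 0 then n else if r \<le> 12 then r * L else 0)"
    by (simp add: conc.simps start_def raw_def)
  ultimately show ?thesis by (simp add: prod_eq_iff fun_eq_iff)
qed

lemma exe_Any_Singleton:
  "exe Any_Singleton (start A) (30 * n + 10)
    ((\<lambda>_. 0)(rEQ := if \<exists>x<n. x \<in> A then 1 else 0), \<lambda>_. [], (\<lambda>_. {})(0 := A))"
  unfolding Any_Singleton_def start_def
proof (rule exe_conv[OF exe_For[where m = n and t = "\<lambda>_. 10" and
      f = "\<lambda>j. ((\<lambda>_. 0)(rEQ := if \<exists>x<j. x \<in> A then 1 else 0), \<lambda>_. [], (\<lambda>_. {})(0 := A))"]])
  fix j assume j: "j < n"
  show "exe (Cond (Mem (Reg rI)) (SetReg rEQ (Num 1)) Skip)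
     (with_var rI j ((\<lambda>_. 0)(rEQ := if \<exists>x<j. x \<in> A then 1 else 0), \<lambda>_. [], (\<lambda>_. {})(0 := A))) 10
     (with_var rI j ((\<lambda>_. 0)(rEQ := if \<exists>x<Suc j. x \<in> A then 1 else 0), \<lambda>_. [], (\<lambda>_. {})(0 := A)))"
    unfolding with_var_simp
    by (rule exe_le[OF exe_Cond[where t = 2]])
      (use j W in \<open>auto simp: eval_input less_Suc_eq fun_eq_iff intro!: exe_conv[OF exe_SetReg]
          exe_conv[OF exe_Skip]\<close>)
qed (use W in \<open>auto simp: fun_eq_iff\<close>)

lemma exec_program:
  assumes A: "A \<subseteq> {..<n}"
    and rest: "exo G Main
      ((\<lambda>_. 0)(rEQ := if \<exists>x<n. x \<in> A then 1 else 0), \<lambda>_. [], (\<lambda>_. {})(0 := A)) a out 0 \<tau>"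
    and G: "30 * n + 70 + a \<le> G"
  shows "\<exists>es s. exec sub B program (\<lambda>r. if r = 0 then n else 0, \<lambda>a. if a \<in> A then 1 else 0) es s \<and>
    outputs es = out \<and> delay es \<le> G"
proof -
  have m: "(if a \<in> A then 1 else 0 :: nat) \<noteq> 0 \<Longrightarrow> a < n \<and> (if a \<in> A then 1 else 0 :: nat) \<le> 1" for a
    using A by (auto split: if_splits)
  obtain es where es: "exec sub B (Init 11) (\<lambda>r. if r = 0 then n else 0, \<lambda>a. if a \<in> A then 1 else
      0) es (conc (start A))"
    "outputs es = []" "elapsed es \<le> 60"
    using exec_Init[OF order_refl, of "\<lambda>a. if a \<in> A then 1 else 0", OF m] unfolding conc_start[OF A]
    by (auto cong: if_cong)
  have "exo G (Any_Singleton ;; Main)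
      (start A) (30 * n + 10 + a) ([] @ out) 0 \<tau>"
    by (rule exo_Seq[OF exo_exe[OF exe_Any_Singleton order_refl] rest])
  then obtain fs where fs: "exec sub B (Any_Singleton ;; Main)
      (conc (start A)) fs (conc \<tau>)" "paid G (30 * n + 10 + a) fs 0" "outputs fs = out"
    using ok_start unfolding exo_def by auto
  have "paid G G es (30 * n + 10 + a)"
    using es(2,3) G by (intro paid_silent) simp_all
  from paid_delay[OF paid_append[OF this fs(2)]] exec.Seq[OF es(1) fs(1)]
  show ?thesis
    unfolding program_def using es(2) fs(3) by (intro exI[of _ "es @ fs"] exI[of _ "conc \<tau>"]) simp
qed

end

section \<open>The delay bound of the program\<close>

context enumeration
begin

text \<open>For \<open>w\<close> in \<open>S\<close> the only neighbour is \<open>S\<close>, so some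
  list is nonempty. This permits replacing \<open>OT\<close> by \<open>RN * OT\<close>, and bounding
  the moves and the root search, \<open>(n + 5) * \<kappa>\<close>, by a multiple of
  \<open>n * RN * \<kappa>\<close>.\<close>

lemma RN_pos: "1 \<le> RN"
proof -
  obtain z where "z \<in> Z" using singleton by auto
  then have S: "cmp {z} \<in> maximal F" "z \<in> cmp {z}" using comp_singleton_maximal by blast+
  then have z: "z < n" using sol_less maximal_sol by blast
  have "set (nb (cmp {z}) z) = {cmp {z}}"
    using nb[OF S(1), of z] neighbors_of_member[OF S] z by simp
  then have "nb (cmp {z}) z \<noteq> []" by auto
  then have "1 \<le> length (nb (cmp {z}) z)" by (simp add: Suc_le_eq)
  then show ?thesis using length_nb[OF S(1) z] by simp
qed

lemma gap_bound_le:
  assumes "1 \<le> n"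
  shows "gap_bound \<le> 64000 * (n * RT + n * RN * q * (RT + RN * OT + CT))"
proof -
  let ?V = "RT + RN * OT + CT"
  have "unit \<le> ?V" using RN_pos mult_le_mono1[of 1 RN OT] by (simp add: unit_def)
  then have "unit_q \<le> q * ?V" unfolding unit_q_def by (rule mult_le_mono2)
  then have "n * RN * unit_q \<le> n * RN * (q * ?V)" by (rule mult_le_mono2)
  moreover have "n * RN * \<kappa> = 8000 * (n * RN * unit_q)" by (simp add: \<kappa>_def)
  moreover have "n * RN * (q * ?V) = n * RN * q * ?V" by (simp only: mult.assoc)
  ultimately have 1: "n * RN * \<kappa> \<le> 8000 * (n * RN * q * ?V)" by linarith
  have "n * \<kappa> \<le> n * RN * \<kappa>" using RN_pos by simp
  moreover have "\<kappa> \<le> n * \<kappa>" using assms by simp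
  moreover have "n * slot_cost = 300 * (n * RT) + n * RN * \<kappa>"
    by (simp add: slot_cost_def algebra_simps)
  moreover have "(n + 5) * \<kappa> = n * \<kappa> + 5 * \<kappa>" by (simp add: algebra_simps)
  \<comment> \<open>Two scans contribute \<open>600 * (n * RT)\<close> and
    \<open>2 * (n * RN * \<kappa>)\<close>; since \<open>n\<close> and \<open>RN\<close> are
    positive, \<open>(n + 5) * \<kappa>\<close> is at most six times
    \<open>n * RN * \<kappa>\<close>. With the 8000 in \<open>\<kappa>\<close>, the factor 8 becomes
    64000.\<close>
  ultimately have "gap_bound \<le> 600 * (n * RT) + 8 * (n * RN * \<kappa>)"
    unfolding gap_bound_def by linarith
  also have "\<dots> \<le> 64000 * (n * RT) + 64000 * (n * RN * q * ?V)"
    using 1 by linarith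
  finally show ?thesis by (simp only: add_mult_distrib2)
qed

lemma start_gap: "30 * n + 75 + root_credit 0 \<le> gap_bound"
proof -
  have "n * \<kappa> \<le> n * slot_cost"
    unfolding slot_cost_def using RN_pos by (intro mult_le_mono2) (simp add: trans_le_add2)
  moreover have "n * 500 \<le> n * \<kappa>" using \<kappa>_pos by (intro mult_le_mono2) simp
  moreover have "(n + 5) * \<kappa> = n * \<kappa> + 5 * \<kappa>" by (simp add: algebra_simps)
  moreover have "root_credit 0 = n * \<kappa> + \<kappa>" by (simp add: root_credit_def)
  ultimately show ?thesis
    unfolding gap_bound_def using \<kappa>_pos(1) by linarith
qed

lemma exec_enumeration:
  "\<exists>es s. exec sub B program (\<lambda>r. if r = 0 then n else 0, \<lambda>a. if a \<in> Z then 1 else 0) es s \<and>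
    distinct (outputs es) \<and> set (outputs es) = sl ` maximal F \<and> delay es \<le> gap_bound"
proof -
  obtain out \<tau> where out: "exob Traverse (cfg [] 0 0 0 0) (root_credit 0) out 0 \<tau>" "distinct out"
    "set out = sl ` maximal F"
    by (rule exo_Traverse)
  obtain z where z: "z \<in> Z" "z < n" using singleton Z_less by auto
  have c: "cfg [] 0 0 0 0 = (\<lambda>_. 0, \<lambda>_. [], (\<lambda>_. {})(0 := Z))"
    by (auto simp: cfg_def vars_def lists_def marks_def)
  have "exe (SetReg rEQ (Num 0)) ((\<lambda>_. 0)(rEQ := 1), \<lambda>_. [], (\<lambda>_. {})(0 := Z)) 2 (cfg [] 0 0 0 0)"
    unfolding c by (rule exe_conv[OF exe_SetReg]) (auto simp: fun_eq_iff)
  note run = exo_Seq[OF exo_exe[OF this order_refl] out(1)]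
  have "(if \<exists>x<n. x \<in> Z then 1 else 0 :: nat) = 1" using z by auto
  then have "exob Main
      ((\<lambda>_. 0)(rEQ := if \<exists>x<n. x \<in> Z then 1 else 0), \<lambda>_. [], (\<lambda>_. {})(0 := Z)) (4 + root_credit 0)
          out 0 \<tau>"
    unfolding Main_def using run by (intro exo_Cond[where a = "2 + root_credit 0"]) auto
  moreover have "Z \<subseteq> {..<n}" using Z_less by auto
  moreover have "30 * n + 70 + (4 + root_credit 0) \<le> gap_bound" using start_gap by simp
  ultimately obtain es s where
    "exec sub B program (\<lambda>r. if r = 0 then n else 0, \<lambda>a. if a \<in> Z then 1 else 0) es s"
    "outputs es = out" "delay es \<le> gap_bound"
    using exec_program by blast
  then show ?thesis using out(2,3) by blast
qed

end

section \<open>Admissible instances\<close>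

definition admissible :: "problem \<Rightarrow> bool" where
  "admissible p \<longleftrightarrow> ground p \<noteq> {} \<and> sols p \<noteq> {} \<and>
       set_system (ground p) (sols p) \<and>
       commutable (sols p) \<and>
       prefix_closed (sols p) (orders p) \<and>
       canonical_reconstruction (ground p) (sols p) (solution_order (sols p) (orders p))
         (lex_comp (sols p) (orders p)) (nbrs p) \<and>
       subroutines_correct p"

definition word_bound :: "problem \<Rightarrow> nat" where
  "word_bound p = ground_size p + RT p + RN p + CT p + OT p + 5"

definition space :: "problem \<Rightarrow> nat" where
  "space p = machine.B (ground_size p) (word_bound p)"

lemma machine_bound: "machine (ground_size p) (word_bound p)"
  by unfold_locales (simp add: word_bound_def)

lemma admissible_prefix_system:
  assumes "admissible p"
  shows "prefix_system {..<ground_size p} (sols p) (orders p)"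
proof
  have g: "ground p = {..<ground_size p}" by (simp add: ground_def)
  show "set_system {..<ground_size p} (sols p)" "strongly_accessible (sols p)" "prefix_closed
      (sols p) (orders p)"
    using assms unfolding admissible_def g commutable_def by auto
  then have "finite (sols p)" by (auto simp: set_system_def intro: finite_subset)
  \<comment> \<open>A maximal solution exists by finiteness, and the empty prefix of its canonical
    order is a solution.\<close>
  then obtain S where "S \<in> sols p" "\<forall>T\<in>sols p. S \<subseteq> T \<longrightarrow> S = T"
    using finite_has_maximal[of "sols p"] assms by (auto simp: admissible_def)
  then have S: "S \<in> maximal (sols p)" by (auto simp: maximal_def)
  have "\<forall>S\<in>maximal (sols p). \<forall>i\<le>length (solution_order (sols p) (orders p) S).
      set (take i (solution_order (sols p) (orders p) S)) \<in> sols p"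
    using assms unfolding admissible_def canonical_reconstruction_def by simp
  from this[THEN bspec, OF S, rule_format, of 0] show "{} \<in> sols p" by simp
qed

text \<open>\<open>nbrs\<close> yields only a set; the indices of slots come from the list that the
  subroutine returns.\<close>

definition neighbor_list :: "problem \<Rightarrow> nat set \<Rightarrow> nat \<Rightarrow> nat set list" where
  "neighbor_list p P w = (SOME Ds. set Ds = nbrs p P w \<and> length Ds \<le> RN p \<and>
     runs (subs p) Neighbors (w # sl P) (enc Ds) (RT p))"

lemma neighbor_list:
  assumes "admissible p" "P \<in> maximal (sols p)" "w < ground_size p"
  shows "set (neighbor_list p P w) = nbrs p P w" "length (neighbor_list p P w) \<le> RN p"
    "runs (subs p) Neighbors (w # sl P) (enc (neighbor_list p P w)) (RT p)"
proof -
  have "\<exists>Ds. set Ds = nbrs p P w \<and> length Ds \<le> RN p \<and> runs (subs p) Neighbors (w # sl P) (enc Ds)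
      (RT p)"
    using assms unfolding admissible_def subroutines_correct_def enc_def ground_def by blast
  from someI_ex[OF this, folded neighbor_list_def]
  show "set (neighbor_list p P w) = nbrs p P w" "length (neighbor_list p P w) \<le> RN p"
    "runs (subs p) Neighbors (w # sl P) (enc (neighbor_list p P w)) (RT p)" by simp_all
qed

lemma admissible_enumeration:
  assumes p: "admissible p" and ne: "singletons (sols p) \<noteq> {}"
  shows "enumeration (subs p) (ground_size p) (word_bound p) (sols p) (orders p) (nbrs p)
      (neighbor_list p)
    (RT p) (RN p) (CT p) (OT p)"
proof -
  interpret prefix_system "{..<ground_size p}" "sols p" "orders p"
    by (rule admissible_prefix_system[OF p])
  have sub: "subroutines_correct p" and can: "canonical_reconstruction {..<ground_size p} (sols p)
      (solution_order (sols p) (orders p)) (lex_comp (sols p) (orders p)) (nbrs p)"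
    using p by (simp_all add: admissible_def ground_def)
  show ?thesis
  proof
    show "ground_size p + 2 \<le> word_bound p" "RT p + 2 \<le> word_bound p" "RN p + 1 \<le> word_bound p"
      "CT p \<le> word_bound p" "OT p \<le> word_bound p"
      by (simp_all add: word_bound_def)
    show "canonical_reconstruction {..<ground_size p} (sols p)
      (solution_order (sols p) (orders p)) (lex_comp (sols p) (orders p)) (nbrs p)" by (rule can)
    show "set (neighbor_list p P w) = nbrs p P w" if "P \<in> maximal (sols p)" "w \<in> {..<ground_size
        p}" for P w
      using neighbor_list(1)[OF p] that by simp
    show "singletons (sols p) \<noteq> {}" by (rule ne)
    show "runs (subs p) Neighbors (w # sl P) (enc (neighbor_list p P w)) (RT p)"
      "length (neighbor_list p P w) \<le> RN p" if "P \<in> maximal (sols p)" "w < ground_size p" for P w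
      using neighbor_list(2,3)[OF p that] by auto
    show "runs (subs p) Complete (sl X) (sl (lex_comp (sols p) (orders p) X)) (CT p)"
      if "X \<in> sols p" "X \<noteq> {}" for X
      using sub seeded[OF that] that(1) unfolding subroutines_correct_def by blast
    show "runs (subs p) Order (v # sl X) (orders p X v) (OT p)"
      if "X \<in> sols p" "v \<in> X" "v \<in> singletons (sols p)" for X v
      using sub that unfolding subroutines_correct_def by blast
  qed
qed

lemma exec_admissible:
  assumes p: "admissible p"
  shows "\<exists>es s. exec (subs p) (space p) program (input p) es s \<and>
    distinct (outputs es) \<and> set (outputs es) = sl ` maximal (sols p) \<and>
    delay es \<le> 64000 * (card (ground p) * RT p
      + card (ground p) * RN p * max_size p * (RT p + RN p * OT p + CT p))"
proof -
  interpret prefix_system "{..<ground_size p}" "sols p" "orders p"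
    by (rule admissible_prefix_system[OF p])
  interpret machine "subs p" "ground_size p" "word_bound p"
    by (rule machine_bound)
  have n: "1 \<le> ground_size p" "card (ground p) = ground_size p"
    using p by (auto simp: admissible_def ground_def)
  have Zn: "Z \<subseteq> {..<ground_size p}"
    using sol_subset by (auto simp: singletons_def)
  have inp: "input p = (\<lambda>r. if r = 0 then ground_size p else 0, \<lambda>a. if a \<in> Z then 1 else 0)"
    using Zn by (auto simp: input_def ground_def fun_eq_iff)
  show ?thesis
  proof (cases "Z = {}")
    case False
    interpret enumeration "subs p" "ground_size p" "word_bound p" "sols p" "orders p" "nbrs p"
        "neighbor_list p"
      "RT p" "RN p" "CT p" "OT p"
      by (rule admissible_enumeration[OF p False])
    have q: "q = max_size p" by (simp add: q_def max_size_def)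
    obtain es s where "exec (subs p) B program (input p) es s" "distinct (outputs es)"
      "set (outputs es) = sl ` maximal (sols p)" and d: "delay es \<le> gap_bound"
      using exec_enumeration unfolding inp by blast
    with le_trans[OF d gap_bound_le[OF n(1), unfolded q]] show ?thesis
      unfolding n(2) space_def by blast
  next
    case True
    then have "S = {}" if "S \<in> sols p" for S using seeded[OF that] by auto
    then have F: "sols p = {{}}" using empty_sol by auto
    then have max: "maximal (sols p) = {{}}" by (auto simp: maximal_def)
    have "runs (subs p) Neighbors (0 # sl {}) (enc (neighbor_list p {} 0)) (RT p)"
      by (rule neighbor_list(3)[OF p]) (use max n in auto)
    \<comment> \<open>Even here the result of \<open>Neighbors\<close> has a word for the number of
      items, so \<open>RT p\<close> is positive, and the term with \<open>RT p\<close> pays for the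
      search for singletons, which is linear in the ground set.\<close>
    then have "1 \<le> RT p" by (auto simp: runs_def enc_def)
    then have nRT: "ground_size p * 1 \<le> ground_size p * RT p" by (rule mult_le_mono2)
    let ?\<sigma> = "((\<lambda>_. 0)(rEQ := if \<exists>x<ground_size p. x \<in> Z then 1 else 0), \<lambda>_. [], (\<lambda>_. {})(0 := Z))
        :: store"
    have "exo G Main ?\<sigma> 4 [[]] 0 ?\<sigma>" for G
      using exo_Output[of aARG "\<lambda>_. []" 2 0 G "(\<lambda>_. 0)(rEQ := 0)" "(\<lambda>_. {})(0 := {})"] True
      unfolding Main_def by (intro exo_Cond[where a = 2]) auto
    from exec_program[OF Zn this, of "64000 * (ground_size p * RT p
      + ground_size p * RN p * max_size p * (RT p + RN p * OT p + CT p))"]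
    obtain es s where "exec (subs p) B program (input p) es s" "outputs es = [[]]"
      "delay es \<le> 64000 * (ground_size p * RT p
        + ground_size p * RN p * max_size p * (RT p + RN p * OT p + CT p))"
      using nRT n(1) unfolding inp by auto
    then show ?thesis
      unfolding n(2) space_def max by (intro exI[of _ es] exI[of _ s]) simp
  qed
qed

lemma polynomially_bounded_space:
  assumes "polynomially_bounded I RT" "polynomially_bounded I RN" "polynomially_bounded I CT"
      "polynomially_bounded I OT"
  shows "polynomially_bounded I space"
proof -
  obtain Q1 Q2 Q3 Q4 :: "nat poly" where Q: "\<forall>p\<in>I. RT p \<le> poly Q1 (card (ground p))"
    "\<forall>p\<in>I. RN p \<le> poly Q2 (card (ground p))" "\<forall>p\<in>I. CT p \<le> poly Q3 (card (ground p))"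
    "\<forall>p\<in>I. OT p \<le> poly Q4 (card (ground p))"
    using assms unfolding polynomially_bounded_def by blast
  have "space p \<le> poly ([:31, 13:] + Q1 + Q2 + Q3 + Q4) (card (ground p))" if "p \<in> I" for p
  proof -
    interpret machine "subs p" "ground_size p" "word_bound p"
      by (rule machine_bound)
    \<comment> \<open>\<open>12 * (n + 2)\<close> for the arrays, 2 more, and \<open>n + 5\<close>
      from \<open>word_bound\<close>, next to the four parameters.\<close>
    have "space p = 31 + 13 * card (ground p) + RT p + RN p + CT p + OT p"
      unfolding space_def B_def L_def by (simp add: word_bound_def ground_def)
    moreover have "RT p \<le> poly Q1 (card (ground p))" "RN p \<le> poly Q2 (card (ground p))"
      "CT p \<le> poly Q3 (card (ground p))" "OT p \<le> poly Q4 (card (ground p))"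
      using Q that by blast+
    ultimately show ?thesis by (simp add: mult.commute)
  qed
  then show ?thesis unfolding polynomially_bounded_def by blast
qed

theorem theorem11p4:
  shows "\<exists>(prog :: com) (c :: nat). \<forall>I :: problem set.
    (\<forall>p\<in>I. ground p \<noteq> {} \<and> sols p \<noteq> {} \<and>
       set_system (ground p) (sols p) \<and>
       commutable (sols p) \<and>
       prefix_closed (sols p) (orders p) \<and>
       canonical_reconstruction (ground p) (sols p) (solution_order (sols p) (orders p))
         (lex_comp (sols p) (orders p)) (nbrs p) \<and>
       subroutines_correct p) \<and>
    polynomially_bounded I RT \<and> polynomially_bounded I RN \<and>
    polynomially_bounded I CT \<and> polynomially_bounded I OT
    \<longrightarrow>
    (\<exists>space :: problem \<Rightarrow> nat. polynomially_bounded I space \<and>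
      (\<forall>p\<in>I. \<exists>es s.
         exec (subs p) (space p) prog (input p) es s \<and>
         distinct (outputs es) \<and>
         set (outputs es) = sorted_list_of_set ` maximal (sols p) \<and>
         delay es \<le> c * (card (ground p) * RT p
           + card (ground p) * RN p * max_size p * (RT p + RN p * OT p + CT p))))"
proof (intro exI[of _ program] exI[of _ 64000] allI impI, elim conjE)
  fix I :: "problem set"
  assume adm: "\<forall>p\<in>I. ground p \<noteq> {} \<and> sols p \<noteq> {} \<and>
       set_system (ground p) (sols p) \<and>
       commutable (sols p) \<and>
       prefix_closed (sols p) (orders p) \<and>
       canonical_reconstruction (ground p) (sols p) (solution_order (sols p) (orders p))
         (lex_comp (sols p) (orders p)) (nbrs p) \<and>
       subroutines_correct p"
    and poly: "polynomially_bounded I RT" "polynomially_bounded I RN" "polynomially_bounded I CT"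
        "polynomially_bounded I OT"
  show "\<exists>space. polynomially_bounded I space \<and>
      (\<forall>p\<in>I. \<exists>es s.
         exec (subs p) (space p) program (input p) es s \<and>
         distinct (outputs es) \<and>
         set (outputs es) = sorted_list_of_set ` maximal (sols p) \<and>
         delay es \<le> 64000 * (card (ground p) * RT p
           + card (ground p) * RN p * max_size p * (RT p + RN p * OT p + CT p)))"
    using polynomially_bounded_space[OF poly] exec_admissible adm[folded admissible_def]
    by (intro exI[of _ space] conjI ballI) auto
qed

end
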